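(* Consider the sequence of (open) infinite-server systems with packing constraints described in the context, indexed by $r$, under the Greedy-DM algorithm with $\alpha>0$. Let $\{x^r_{(k,\hat k)}(\infty)\}$ denote the random complete state of the fluid-scaled process in a stationary regime, and let $x^r(\infty)=\{x^r_k(\infty)\}_{k\in\mathcal K}$ with $x_k^r(\infty)=\sum_{\hat k\le k}x^r_{(k,\hat k)}(\infty)$. Then, as $r\to\infty$, $$d\big(\{x^r_{(k,\hat k)}(\infty)\},\bar{\mathcal X}\big)\Longrightarrow 0,\qquad x^r(\infty)\Longrightarrow x^*,$$ where $x^*$ is the unique minimizer of $F(x)=\sum_{k\in\mathcal K}(1+\alpha)^{-1}x_k^{1+\alpha}$ over $\mathcal X=\{x\in\mathbb R^{|\mathcal K|}:x_k\ge0\ \forall k,\ \sum_kk_ix_k=\rho_i\ \forall i\}$.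
   Context: Configurations. $\mathcal I=\{1,\dots,I\}$ is the set of customer types. $\bar{\mathcal K}$ is a finite set of vectors $k=(k_i)_{i\in\mathcal I}$ with non-negative integer components, closed under passing to componentwise smaller non-negative integer vectors, containing $0$ and all unit vectors $e_i$. $\mathcal K=\bar{\mathcal K}\setminus\{0\}$. There are infinitely many servers; each server has a configuration $k\in\bar{\mathcal K}$. Parameters. $\lambda_i>0$, $\mu_i>0$, $\rho_i=\lambda_i/\mu_i$, $\sum_i\rho_i=1$; $\mu_0>0$ is a fixed parameter. The scaling parameter $r\ge 1$ increases to infinity along a discrete sequence. In the system with parameter $r$, actual type $i$ customers arrive as a Poisson process of rate $\lambda_i r$ and have exponential service times with mean $1/\mu_i$; all arrival processes and service times are mutually independent, and service is unaffected by other customers in the same server. Greedy-DM discipline. At any time there are two kinds of type $i$ customers: actual customers and tokens. For the purpose of defining configurations $k$ and the counts $X_k$ (number of servers in configuration $k$), type $i$ tokens are treated as type $i$ customers. "Greedy placement" of a type $i$ item at time $t$ means: it is added to a server in an available configuration $k\in\bar{\mathcal K}$ ($k=0$ or $X_k(t-)>0$) with $k+e_i\in\mathcal K$ minimizing $X_{k+e_i}(t-)^\alpha-I\{k\neq0\}X_k(t-)^\alpha$, ties broken by a deterministic rule. (1) When an actual type $i$ customer completes service, it leaves (its server's configuration changes from $k$ to $k-e_i$), and a new type $i$ token is immediately created and greedily placed ($t-$ meaning after the service completion but before the token placement). (2) When a new actual type $i$ customer arrives, it replaces an arbitrarily chosen type $i$ token (anywhere in the system) if there is one; otherwise it is greedily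 placed ($t-$ meaning just before the arrival). (3) Each token independently "completes service" at rate $\mu_0$; it then leaves and its server's configuration changes from $k$ to $k-e_i$, but no new token is created. Complete state. A complete server configuration is a pair $(k,\hat k)$ with $k\in\mathcal K$, $\hat k\in\bar{\mathcal K}$, $\hat k\le k$, where $k$ counts all customers (actual and tokens) and $\hat k$ counts actual customers. $X^r_{(k,\hat k)}(t)$ is the number of servers in complete configuration $(k,\hat k)$; $\{X^r_{(k,\hat k)}(\cdot)\}$ is a positive recurrent continuous-time Markov chain, and $x^r_{(k,\hat k)}=X^r_{(k,\hat k)}/r$. Set $\bar{\mathcal X}$. For a vector $\{x_{(k,\hat k)}\}$ with non-negative components put $y_i=\sum_{(k,\hat k)}k_ix_{(k,\hat k)}$, $\hat y_i=\sum_{(k,\hat k)}\hat k_ix_{(k,\hat k)}$. $\bar{\mathcal X}$ is the set of such vectors with $y_i=\hat y_i=\rho_i$ for all $i$. $d(\cdot,U)$ is the Euclidean distance to the set $U$; $\Longrightarrow$ is convergence in distribution. *)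

theory Defs
  imports "HOL-Probability.Probability" "HOL-Library.Function_Algebras"
begin

text \<open>
  The customer types are the elements of a finite type \<open>'i\<close>. Configurations are functions with the
  componentwise order and arithmetic. A complete configuration is a pair: all customers (actual
  ones and tokens), and actual customers only. Vectors indexed by a finite set of (complete)
  configurations are functions that vanish outside that set.
\<close>

type_synonym 'i config = "'i \<Rightarrow> nat"
type_synonym 'i cconfig = "'i config \<times> 'i config"
type_synonym 'i state = "'i cconfig \<Rightarrow> nat"

definition unit_config :: "'i \<Rightarrow> 'i config" where
  "unit_config i = (\<lambda>j. if j = i then 1 else 0)"

definition packing_constraints :: "'i::finite config set \<Rightarrow> bool" where
  "packing_constraints Kbar \<longleftrightarrow>
     finite Kbar \<and> 0 \<in> Kbar \<and> (\<forall>i. unit_config i \<in> Kbar) \<and>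
     (\<forall>k\<in>Kbar. \<forall>m. m \<le> k \<longrightarrow> m \<in> Kbar)"

definition configs :: "'i::finite config set \<Rightarrow> 'i config set" where
  "configs Kbar = Kbar - {0}"

definition cconfigs :: "'i::finite config set \<Rightarrow> 'i cconfig set" where
  "cconfigs Kbar = {(k, kh). k \<in> configs Kbar \<and> kh \<in> Kbar \<and> kh \<le> k}"

definition states :: "'i::finite config set \<Rightarrow> 'i state set" where
  "states Kbar = {X. \<forall>c. c \<notin> cconfigs Kbar \<longrightarrow> X c = 0}"

text \<open>The counts \<open>X_k\<close>, as a vector indexed by configurations.\<close>

definition config_count :: "'i::finite config set \<Rightarrow> 'i state \<Rightarrow> 'i config \<Rightarrow> nat" where
  "config_count Kbar X k = (if k \<in> configs Kbar then \<Sum>kh\<in>{..k}. X (k, kh) else 0)"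

text \<open>
  One server changes its complete configuration from \<open>c\<close> to \<open>c'\<close>. Empty servers, of which there are
  infinitely many, are not counted.
\<close>

definition shift :: "'i cconfig \<Rightarrow> 'i cconfig \<Rightarrow> 'i state \<Rightarrow> 'i state" where
  "shift c c' X =
     (\<lambda>d. if fst d = 0 then 0 else X d - (if d = c then 1 else 0) + (if d = c' then 1 else 0))"


definition available :: "'i::finite config set \<Rightarrow> 'i state \<Rightarrow> 'i \<Rightarrow> 'i config set" where
  "available Kbar X i =
     {k \<in> Kbar. k + unit_config i \<in> configs Kbar \<and> (k = 0 \<or> config_count Kbar X k > 0)}"

definition greedy_weight ::
    "'i::finite config set \<Rightarrow> real \<Rightarrow> 'i state \<Rightarrow> 'i \<Rightarrow> 'i config \<Rightarrow> real" where
  "greedy_weight Kbar \<alpha> X i k =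
     real (config_count Kbar X (k + unit_config i)) powr \<alpha>
     - (if k \<noteq> 0 then real (config_count Kbar X k) powr \<alpha> else 0)"

definition has_token :: "'i state \<Rightarrow> 'i \<Rightarrow> 'i cconfig \<Rightarrow> bool" where
  "has_token X i c \<longleftrightarrow> X c > 0 \<and> snd c i < fst c i"

text \<open>
  What the discipline leaves open. \<open>tie_break X i\<close> is the configuration in which a type \<open>i\<close> item is
  greedily placed, a deterministic function of the state. \<open>host X i\<close> picks, possibly at random, one
  of the servers in that configuration, by the second component of its complete configuration.
  \<open>token_choice X i\<close> picks, possibly at random, the complete configuration of the server whose
  type \<open>i\<close> token is replaced by an arriving actual customer.
\<close>

record 'i rules =
  tie_break :: "'i state \<Rightarrow> 'i \<Rightarrow> 'i config"
  host :: "'i state \<Rightarrow> 'i \<Rightarrow> 'i config pmf"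
  token_choice :: "'i state \<Rightarrow> 'i \<Rightarrow> 'i cconfig pmf"

definition greedy_dm_rules :: "'i::finite config set \<Rightarrow> real \<Rightarrow> 'i rules \<Rightarrow> bool" where
  "greedy_dm_rules Kbar \<alpha> R \<longleftrightarrow>
     (\<forall>X\<in>states Kbar. \<forall>i.
        is_arg_min (greedy_weight Kbar \<alpha> X i) (\<lambda>k. k \<in> available Kbar X i) (tie_break R X i) \<and>
        (\<forall>kh\<in>set_pmf (host R X i).
           if tie_break R X i = 0 then kh = 0 else X (tie_break R X i, kh) > 0) \<and>
        ((\<exists>c. has_token X i c) \<longrightarrow> (\<forall>c\<in>set_pmf (token_choice R X i). has_token X i c)))"

definition place_actual :: "'i rules \<Rightarrow> 'i \<Rightarrow> 'i state \<Rightarrow> 'i state pmf" where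
  "place_actual R i X =
     (let k = tie_break R X i
      in map_pmf (\<lambda>kh. shift (k, kh) (k + unit_config i, kh + unit_config i) X) (host R X i))"

definition place_token :: "'i rules \<Rightarrow> 'i \<Rightarrow> 'i state \<Rightarrow> 'i state pmf" where
  "place_token R i X =
     (let k = tie_break R X i
      in map_pmf (\<lambda>kh. shift (k, kh) (k + unit_config i, kh) X) (host R X i))"

definition arrival :: "'i rules \<Rightarrow> 'i state \<Rightarrow> 'i \<Rightarrow> 'i state pmf" where
  "arrival R X i =
     (if \<exists>c. has_token X i c
      then map_pmf (\<lambda>c. shift c (fst c, snd c + unit_config i) X) (token_choice R X i)
      else place_actual R i X)"

definition service_completion ::
    "'i rules \<Rightarrow> 'i state \<Rightarrow> 'i \<Rightarrow> 'i cconfig \<Rightarrow> 'i state pmf" where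
  "service_completion R X i c =
     place_token R i (shift c (fst c - unit_config i, snd c - unit_config i) X)"

definition token_completion :: "'i state \<Rightarrow> 'i \<Rightarrow> 'i cconfig \<Rightarrow> 'i state pmf" where
  "token_completion X i c = return_pmf (shift c (fst c - unit_config i, snd c) X)"

text \<open>
  Transition rate matrix of the system with arrival rates \<open>\<lambda>\<^sub>i r\<close>. An event that occurs at rate \<open>q\<close>
  and leads to a state with law \<open>p\<close> contributes \<open>q (p(Y) - 1[Y = X])\<close> to the entry at \<open>X, Y\<close>.
\<close>

definition jump :: "'s \<Rightarrow> 's pmf \<Rightarrow> 's \<Rightarrow> real" where
  "jump X p Y = pmf p Y - (if Y = X then 1 else 0)"

definition rate_matrix ::
    "'i::finite config set \<Rightarrow> ('i \<Rightarrow> real) \<Rightarrow> ('i \<Rightarrow> real) \<Rightarrow> real \<Rightarrow> 'i rules \<Rightarrow> real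
     \<Rightarrow> 'i state \<Rightarrow> 'i state \<Rightarrow> real" where
  "rate_matrix Kbar lam mu mu0 R r X Y =
     (\<Sum>i\<in>UNIV. lam i * r * jump X (arrival R X i) Y)
   + (\<Sum>i\<in>UNIV. \<Sum>c\<in>cconfigs Kbar.
        mu i * real (snd c i * X c) * jump X (service_completion R X i c) Y)
   + (\<Sum>i\<in>UNIV. \<Sum>c\<in>cconfigs Kbar.
        mu0 * real ((fst c i - snd c i) * X c) * jump X (token_completion X i c) Y)"

text \<open>
  \<open>P t X\<close> is the law at time \<open>t\<close> of a continuous-time Markov chain on \<open>S\<close> with rate matrix \<open>Q\<close>
  started in \<open>X\<close>. Since every \<open>P t X\<close> is a probability, the chain does not explode.
\<close>

definition transition_function ::
    "'s set \<Rightarrow> ('s \<Rightarrow> 's \<Rightarrow> real) \<Rightarrow> (real \<Rightarrow> 's \<Rightarrow> 's pmf) \<Rightarrow> bool" where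
  "transition_function S Q P \<longleftrightarrow>
     (\<forall>X\<in>S. P 0 X = return_pmf X) \<and>
     (\<forall>t\<ge>0. \<forall>X\<in>S. set_pmf (P t X) \<subseteq> S) \<and>
     (\<forall>s\<ge>0. \<forall>t\<ge>0. \<forall>X\<in>S. P (s + t) X = bind_pmf (P s X) (P t)) \<and>
     (\<forall>X\<in>S. \<forall>Y\<in>S. ((\<lambda>t. pmf (P t X) Y) has_real_derivative Q X Y) (at 0 within {0..}))"

definition stationary_distribution ::
    "'s set \<Rightarrow> ('s \<Rightarrow> 's \<Rightarrow> real) \<Rightarrow> 's pmf \<Rightarrow> bool" where
  "stationary_distribution S Q \<pi> \<longleftrightarrow>
     set_pmf \<pi> \<subseteq> S \<and>
     (\<exists>P. transition_function S Q P \<and> (\<forall>t\<ge>0. bind_pmf \<pi> (P t) = \<pi>))"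


definition scaled :: "real \<Rightarrow> ('c \<Rightarrow> nat) \<Rightarrow> 'c \<Rightarrow> real" where
  "scaled r X c = real (X c) / r"

definition Xbar_set :: "'i::finite config set \<Rightarrow> ('i \<Rightarrow> real) \<Rightarrow> ('i cconfig \<Rightarrow> real) set" where
  "Xbar_set Kbar \<rho> =
     {x. (\<forall>c\<in>cconfigs Kbar. x c \<ge> 0) \<and> (\<forall>c. c \<notin> cconfigs Kbar \<longrightarrow> x c = 0) \<and>
         (\<forall>i. (\<Sum>c\<in>cconfigs Kbar. real (fst c i) * x c) = \<rho> i) \<and>
         (\<forall>i. (\<Sum>c\<in>cconfigs Kbar. real (snd c i) * x c) = \<rho> i)}"

definition X_set :: "'i::finite config set \<Rightarrow> ('i \<Rightarrow> real) \<Rightarrow> ('i config \<Rightarrow> real) set" where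
  "X_set Kbar \<rho> =
     {x. (\<forall>k\<in>configs Kbar. x k \<ge> 0) \<and> (\<forall>k. k \<notin> configs Kbar \<longrightarrow> x k = 0) \<and>
         (\<forall>i. (\<Sum>k\<in>configs Kbar. real (k i) * x k) = \<rho> i)}"

definition objective :: "'i::finite config set \<Rightarrow> real \<Rightarrow> ('i config \<Rightarrow> real) \<Rightarrow> real" where
  "objective Kbar \<alpha> x = (\<Sum>k\<in>configs Kbar. (x k powr (1 + \<alpha>)) / (1 + \<alpha>))"

text \<open>
  Euclidean distance to a set of vectors indexed by \<open>C\<close>. (The library metric on functions with
  countable domain is a different one.)
\<close>

definition euclidean_setdist :: "'c set \<Rightarrow> ('c \<Rightarrow> real) \<Rightarrow> ('c \<Rightarrow> real) set \<Rightarrow> real" where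
  "euclidean_setdist C x U = (INF u\<in>U. L2_set (\<lambda>c. x c - u c) C)"

text \<open>
  Weak convergence of probability measures; \<open>weak_conv_m\<close> is only available on the reals.
  On functions \<open>continuous_on\<close> refers to the product topology, which on functions
  vanishing outside a finite set is the Euclidean one.
\<close>

definition weakly_converges :: "(nat \<Rightarrow> 'b::topological_space measure) \<Rightarrow> 'b measure \<Rightarrow> bool" where
  "weakly_converges M N \<longleftrightarrow>
     (\<forall>f::'b \<Rightarrow> real. continuous_on UNIV f \<and> bounded (range f) \<longrightarrow>
        (\<lambda>n. \<integral>x. f x \<partial>M n) \<longlonglongrightarrow> (\<integral>x. f x \<partial>N))"

end

theory Submission
  imports Defs
begin

text \<open>
  The proof works directly with the stationary distribution: the drift of a function with finite
  sublevel sets has nonnegative stationary mean, so a drift bounded by \<open>B - W\<close> gives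
  \<open>E W \<le> E B\<close>.

  A quadratic Lyapunov function of the numbers of actual customers and of tokens shows that the
  former are within \<open>O(\<surd>r)\<close> of \<open>\<rho>\<^sub>i r\<close> and the latter are \<open>O(\<surd>r)\<close>. Hence nearly every departure is
  followed by a greedy placement of the departed type while arrivals hardly ever change the counts
  \<open>X\<^sub>k\<close>. Moving an item from \<open>k\<close> to the greedy place decreases \<open>F\<close> up to a small error, because the
  server just left, in configuration \<open>k - e\<^sub>i\<close>, is itself an available place; the stationary mean of
  the decrease is therefore \<open>o(1)\<close>. So in the limit no single move decreases \<open>F\<close> to first order.

  Such a state \<open>x \<in> \<X>\<close> is the minimizer: with \<open>\<eta>\<^sub>i\<close> the largest marginal cost
  \<open>x\<^sub>k\<^sup>\<alpha> - x\<^sub>m\<^sup>\<alpha>\<close>, \<open>m = k - e\<^sub>i\<close>, over the used \<open>k\<close>, induction on the size of \<open>k\<close> gives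
  \<open>x\<^sub>k\<^sup>\<alpha> = max 0 (\<Sum>\<^sub>i k\<^sub>i \<eta>\<^sub>i)\<close>, which are the Karush-Kuhn-Tucker conditions of the convex program.
\<close>

subsection \<open>Analytic preliminaries\<close>

text \<open>No moment of a stationary distribution is known to be finite beforehand, and rates enter
  only as entrywise derivatives at time 0. Test functions are therefore cut off to
  \<open>f - N\<close> on the finite set where \<open>f < N\<close>; only finite sums occur there,
  and monotone convergence removes the cutoff.

  One event changes the potential by O(1) and events occur at rate of order \<open>r\<close>, so
  errors in the drift have to be o(\<open>r\<close>). The O(\<surd>\<open>r\<close>) fluctuations
  satisfy this. The change of \<open>psi\<close> over a step \<open>1 / r\<close> is only controlled
  by a modulus of continuity \<open>\<omega>\<close>, since \<open>psi\<close> is not Lipschitz at 0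
  when \<alpha> < 1; hence \<open>\<omega>\<close> is fixed before \<open>r\<close> grows.

  Few tokens alone do not make arrivals harmless: a state without type i tokens might be frequent.
  What helps is their balance. Tokens are created at nearly the arrival rate and few of them expire,
  so nearly every arrival must consume one. A multiple of the number of tokens in the test function
  encodes this.

  The optimality conditions and the load equations are collected in continuous functions whose
  stationary means vanish; compactness turns this into convergence in probability without any
  rate.\<close>

lemma powr_tangent:
  fixes a b \<alpha> :: real
  assumes "a \<ge> 0" "b \<ge> 0" "\<alpha> > 0"
  shows "a powr (1 + \<alpha>) / (1 + \<alpha>) + a powr \<alpha> * (b - a) \<le> b powr (1 + \<alpha>) / (1 + \<alpha>)" (is ?le)
    and "a \<noteq> b \<Longrightarrow> a powr (1 + \<alpha>) / (1 + \<alpha>) + a powr \<alpha> * (b - a) < b powr (1 + \<alpha>) / (1 + \<alpha>)"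
proof -
  define F where "F x = x powr (1 + \<alpha>) / (1 + \<alpha>)" for x :: real
  have cont: "continuous_on {u..v} F" if "u \<ge> 0" for u v
    unfolding F_def using assms(3) that
    by (intro continuous_on_divide continuous_on_powr' continuous_intros) auto
  have der: "(F has_real_derivative x powr \<alpha>) (at x)" if "x > 0" for x
    unfolding F_def using that assms(3) by (auto intro!: derivative_eq_intros)
  \<comment> \<open>The mean value theorem asks for a derivative only inside the interval, so
    \<open>a = 0\<close> and \<open>b = 0\<close> are covered although \<open>der\<close> is
    confined to positive arguments.\<close>
  have mv: "\<exists>z. u < z \<and> z < v \<and> F v - F u = (v - u) * z powr \<alpha>" if "0 \<le> u" "u < v" for u v
  proof -
    have "\<exists>l z. u < z \<and> z < v \<and> DERIV F z :> l \<and> F v - F u = (v - u) * l"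
    proof (rule MVT[OF that(2) cont[OF that(1)]])
      fix x assume "u < x"
      then show "F differentiable (at x)"
        using der[of x] that(1) by (auto simp: real_differentiable_def)
    qed
    then obtain l z where z: "u < z" "z < v" "DERIV F z :> l" "F v - F u = (v - u) * l" by blast
    have "l = z powr \<alpha>" using der[of z] z that by (intro DERIV_unique[OF z(3)]) auto
    with z show ?thesis by blast
  qed
  have strict: "F a + a powr \<alpha> * (b - a) < F b" if "a \<noteq> b"
  proof (cases "a < b")
    case True
    then obtain z where z: "a < z" "z < b" "F b - F a = (b - a) * z powr \<alpha>" using mv assms by blast
    have "a powr \<alpha> < z powr \<alpha>" using z assms by (intro powr_less_mono2) auto
    then have "(b - a) * a powr \<alpha> < (b - a) * z powr \<alpha>" using True by simp
    with z show ?thesis by (simp add: algebra_simps)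
  next
    case False
    then have "b < a" using that by simp
    then obtain z where z: "b < z" "z < a" "F a - F b = (a - b) * z powr \<alpha>" using mv assms by blast
    have "z powr \<alpha> < a powr \<alpha>" using z assms by (intro powr_less_mono2) auto
    then have "(a - b) * z powr \<alpha> < (a - b) * a powr \<alpha>" using \<open>b < a\<close> by simp
    with z show ?thesis by (simp add: algebra_simps)
  qed
  then show "a \<noteq> b \<Longrightarrow> a powr (1 + \<alpha>) / (1 + \<alpha>) + a powr \<alpha> * (b - a) < b powr (1 + \<alpha>) / (1 + \<alpha>)"
    by (simp add: F_def)
  show ?le using strict by (cases "a = b") (auto simp: F_def)
qed

text \<open>The index type may be infinite, so this is Tychonoff's theorem, with the coordinates
  outside \<open>C\<close> pinned to 0.\<close>

lemma compact_box: "compact {x :: 'c \<Rightarrow> real. \<forall>c. x c \<in> (if c \<in> C then {0..b} else {0})}"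
proof -
  have "compactin (product_topology (\<lambda>_. euclidean) UNIV)
      (Pi\<^sub>E UNIV (\<lambda>c. if c \<in> C then {0..b} else {0 :: real}))"
    by (auto simp: compactin_PiE)
  moreover have "Pi\<^sub>E UNIV (\<lambda>c. if c \<in> C then {0..b} else {0 :: real})
      = {x. \<forall>c. x c \<in> (if c \<in> C then {0..b} else {0})}"
    by (auto simp: PiE_def Pi_def)
  ultimately show ?thesis by (simp add: euclidean_product_topology)
qed

text \<open>The bound confines the points with \<open>G x < 1\<close> to a compact box.\<close>

lemma small_imp_in_open:
  fixes G :: "('c \<Rightarrow> real) \<Rightarrow> real" and C :: "'c set"
  assumes cont: "continuous_on UNIV G" and U: "open U"
    and nn: "\<And>x. (\<forall>c\<in>C. 0 \<le> x c) \<Longrightarrow> 0 \<le> G x"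
    and zero: "\<And>x. (\<forall>c\<in>C. 0 \<le> x c) \<Longrightarrow> (\<forall>c. c \<notin> C \<longrightarrow> x c = 0) \<Longrightarrow> G x = 0 \<Longrightarrow> x \<in> U"
    and bound: "\<And>x c. (\<forall>c\<in>C. 0 \<le> x c) \<Longrightarrow> c \<in> C \<Longrightarrow> x c \<le> b + G x"
  shows "\<exists>\<delta>>0. \<forall>x. (\<forall>c\<in>C. 0 \<le> x c) \<longrightarrow> (\<forall>c. c \<notin> C \<longrightarrow> x c = 0) \<longrightarrow> G x < \<delta> \<longrightarrow> x \<in> U"
proof -
  define K where "K = {x. \<forall>c. x c \<in> (if c \<in> C then {0..b + 1} else {0})} - U"
  have K: "compact K" unfolding K_def using compact_box U by (rule compact_diff)
  have in_K: "x \<in> K" if "\<forall>c\<in>C. 0 \<le> x c" "\<forall>c. c \<notin> C \<longrightarrow> x c = 0" "G x < 1" "x \<notin> U" for x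
  proof -
    have "x c \<le> b + 1" if "c \<in> C" for c
      using bound[OF \<open>\<forall>c\<in>C. 0 \<le> x c\<close> that] \<open>G x < 1\<close> by linarith
    with that show ?thesis unfolding K_def by auto
  qed
  show ?thesis
  proof (cases "K = {}")
    case True
    then show ?thesis using in_K by (intro exI[of _ 1]) auto
  next
    case False
    then obtain y where y: "y \<in> K" "\<And>x. x \<in> K \<Longrightarrow> G y \<le> G x"
      using continuous_attains_inf[OF K _ continuous_on_subset[OF cont]] by auto
    have yn: "\<forall>c\<in>C. 0 \<le> y c" "\<forall>c. c \<notin> C \<longrightarrow> y c = 0" "y \<notin> U"
      using y(1) unfolding K_def by (auto split: if_splits)
    then have "G y > 0" using nn[of y] zero[of y] by fastforce
    show ?thesis
    proof (intro exI[of _ "min 1 (G y)"] conjI allI impI)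
      show "min 1 (G y) > 0" using \<open>G y > 0\<close> by simp
      fix x assume x: "\<forall>c\<in>C. 0 \<le> x c" "\<forall>c. c \<notin> C \<longrightarrow> x c = 0" "G x < min 1 (G y)"
      show "x \<in> U"
      proof (rule ccontr)
        assume "x \<notin> U"
        then have "x \<in> K" using x by (intro in_K) auto
        then show False using y(2)[of x] x(3) by simp
      qed
    qed
  qed
qed

text \<open>Convergence in probability to a constant: \<open>f\<close> is within
  \<open>e / 2\<close> of \<open>f z\<close> on a neighbourhood \<open>V\<close>, and off
  \<open>V\<close>, which has small probability, the difference is at most
  \<open>2 * B\<close>.\<close>

lemma weakly_converges_return:
  fixes h :: "nat \<Rightarrow> 's \<Rightarrow> 'b::topological_space" and p :: "nat \<Rightarrow> 's pmf"
  assumes U: "\<And>U. open U \<Longrightarrow> z \<in> U \<Longrightarrow> (\<lambda>n. measure (measure_pmf (p n)) {s. h n s \<notin> U}) \<longlonglongrightarrow> 0"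
  shows "weakly_converges (\<lambda>n. distr (measure_pmf (p n)) borel (h n)) (return borel z)"
  unfolding weakly_converges_def
proof (intro allI impI, elim conjE)
  fix f :: "'b \<Rightarrow> real" assume f: "continuous_on UNIV f" and "bounded (range f)"
  then obtain B where B: "\<And>x. \<bar>f x\<bar> \<le> B" by (auto simp: bounded_iff)
  have B0: "B \<ge> 0" using B[of undefined] by linarith
  have meas: "f \<in> borel_measurable borel" using f by (rule borel_measurable_continuous_onI)
  have I: "(\<integral>x. f x \<partial>distr (measure_pmf (p n)) borel (h n)) = (\<integral>s. f (h n s) \<partial>measure_pmf (p n))" for n
    using meas by (intro integral_distr) auto
  have Z: "(\<integral>x. f x \<partial>return borel z) = f z" using meas by (intro integral_return) auto
  have "(\<lambda>n. \<integral>s. f (h n s) \<partial>measure_pmf (p n)) \<longlonglongrightarrow> f z"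
  proof (rule LIMSEQ_I)
    fix e :: real assume e: "e > 0"
    define V where "V = {x. \<bar>f x - f z\<bar> < e / 2}"
    have "open V" unfolding V_def using f by (intro open_Collect_less continuous_intros) auto
    moreover have "z \<in> V" using e by (simp add: V_def)
    ultimately have "(\<lambda>n. measure (measure_pmf (p n)) {s. h n s \<notin> V}) \<longlonglongrightarrow> 0" by (rule U)
    then obtain N where N: "\<And>n. n \<ge> N \<Longrightarrow> measure (measure_pmf (p n)) {s. h n s \<notin> V} < e / (4 * B + 1)"
      using order_tendstoD(2)[of _ 0 sequentially "e / (4 * B + 1)"] B0 e
      unfolding eventually_sequentially by force
    show "\<exists>N. \<forall>n\<ge>N. norm ((\<integral>s. f (h n s) \<partial>measure_pmf (p n)) - f z) < e"
    proof (intro exI[of _ N] allI impI)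
      fix n assume n: "n \<ge> N"
      let ?P = "measure_pmf (p n)"
      have int: "integrable ?P (\<lambda>s. f (h n s))"
        using B by (intro measure_pmf.integrable_const_bound[where B = B]) auto
      have "norm ((\<integral>s. f (h n s) \<partial>?P) - f z) = norm (\<integral>s. f (h n s) - f z \<partial>?P)"
        using int by (simp add: Bochner_Integration.integral_diff)
      also have "\<dots> \<le> (\<integral>s. norm (f (h n s) - f z) \<partial>?P)" by (rule integral_norm_bound)
      also have "\<dots> \<le> (\<integral>s. e / 2 + 2 * B * indicator {s. h n s \<notin> V} s \<partial>?P)"
      proof (rule integral_mono)
        show "integrable ?P (\<lambda>s. norm (f (h n s) - f z))" using int by auto
        show "integrable ?P (\<lambda>s. e / 2 + 2 * B * indicator {s. h n s \<notin> V} s)"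
          using B0 e by (intro measure_pmf.integrable_const_bound[where B = "e / 2 + 2 * B"])
            (auto simp: indicator_def)
        show "norm (f (h n s) - f z) \<le> e / 2 + 2 * B * indicator {s. h n s \<notin> V} s" for s
          using B[of "h n s"] B[of z] e by (auto simp: V_def indicator_def)
      qed
      also have "\<dots> = e / 2 + 2 * B * measure ?P {s. h n s \<notin> V}"
      proof -
        have "integrable ?P (\<lambda>s. 2 * B * indicator {s. h n s \<notin> V} s)"
          using B0 by (intro measure_pmf.integrable_const_bound[where B = "2 * B"]) (auto simp: indicator_def)
        then show ?thesis by (subst Bochner_Integration.integral_add) auto
      qed
      also have "\<dots> < e"
      proof -
        have "2 * B * measure ?P {s. h n s \<notin> V} \<le> 2 * B * (e / (4 * B + 1))"
          using N[OF n] B0 by (intro mult_left_mono) auto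
        also have "\<dots> < e / 2" using B0 e by (simp add: field_simps)
        finally show ?thesis by simp
      qed
      finally show "norm ((\<integral>s. f (h n s) \<partial>?P) - f z) < e" .
    qed
  qed
  then show "(\<lambda>n. \<integral>x. f x \<partial>distr (measure_pmf (p n)) borel (h n)) \<longlonglongrightarrow> (\<integral>x. f x \<partial>return borel z)"
    by (simp only: I Z)
qed

lemma real_distribution_return: "real_distribution (return borel (z :: real))"
  by (intro real_distribution.intro real_distribution_axioms.intro prob_space_return) auto

text \<open>Passes from bounded continuous test functions to distribution functions on the reals:
  the piecewise linear \<open>cts_step\<close> functions are such test functions, and they
  suffice.\<close>

lemma weak_conv_m_return:
  fixes h :: "nat \<Rightarrow> 's \<Rightarrow> real"
  assumes "weakly_converges (\<lambda>n. distr (measure_pmf (p n)) borel (h n)) (return borel z)"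
  shows "weak_conv_m (\<lambda>n. distr (measure_pmf (p n)) borel (h n)) (return borel z)"
proof (rule integral_cts_step_conv_imp_weak_conv)
  show "real_distribution (distr (measure_pmf (p n)) borel (h n))" for n
    by (rule prob_space.real_distribution_distr) (auto intro: measure_pmf.prob_space_axioms)
  show "real_distribution (return borel z)" by (rule real_distribution_return)
  fix x y :: real assume "x < y"
  then have "continuous_on UNIV (cts_step x y)"
    by (intro uniformly_continuous_imp_continuous cts_step_uniformly_continuous)
  moreover have "bounded (range (cts_step x y))"
    by (rule boundedI[of _ 1]) (auto simp: cts_step_def divide_le_eq)
  ultimately show "(\<lambda>n. integral\<^sup>L (distr (measure_pmf (p n)) borel (h n)) (cts_step x y))
      \<longlonglongrightarrow> integral\<^sup>L (return borel z) (cts_step x y)"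
    using assms by (auto simp: weakly_converges_def)
qed

text \<open>Markov's inequality. With the nonnegative integral, integrability of \<open>g\<close>
  needs no proof, and negative values of \<open>g\<close> count as 0, which is harmless because
  \<open>\<delta>\<close> is positive.\<close>

lemma markov_tendsto:
  fixes g :: "nat \<Rightarrow> 's \<Rightarrow> real"
  assumes lim: "(\<lambda>n. \<integral>\<^sup>+s. ennreal (g n s) \<partial>measure_pmf (p n)) \<longlonglongrightarrow> 0" and \<delta>: "\<delta> > 0"
    and sub: "\<And>n s. s \<in> set_pmf (p n) \<Longrightarrow> s \<in> A n \<Longrightarrow> \<delta> \<le> g n s"
  shows "(\<lambda>n. measure (measure_pmf (p n)) (A n)) \<longlonglongrightarrow> 0"
proof -
  have le: "emeasure (measure_pmf (p n)) (A n) \<le> ennreal (1 / \<delta>) * (\<integral>\<^sup>+s. ennreal (g n s) \<partial>measure_pmf (p n))" for n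
  proof -
    have "emeasure (measure_pmf (p n)) (A n) = (\<integral>\<^sup>+s. indicator (A n) s \<partial>measure_pmf (p n))" by simp
    also have "\<dots> \<le> (\<integral>\<^sup>+s. ennreal (1 / \<delta>) * ennreal (g n s) \<partial>measure_pmf (p n))"
    proof (rule nn_integral_mono_AE, unfold AE_measure_pmf_iff, intro ballI)
      fix s assume s: "s \<in> set_pmf (p n)"
      have "1 \<le> ennreal (1 / \<delta>) * ennreal (g n s)" if "s \<in> A n"
      proof -
        have "1 \<le> 1 / \<delta> * g n s" using sub[OF s that] \<delta> by simp
        then have "ennreal 1 \<le> ennreal (1 / \<delta> * g n s)" by (rule ennreal_leI)
        then show ?thesis using \<delta> by (simp add: ennreal_mult'[symmetric])
      qed
      then show "indicator (A n) s \<le> ennreal (1 / \<delta>) * ennreal (g n s)"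
        by (auto simp: indicator_def)
    qed
    also have "\<dots> = ennreal (1 / \<delta>) * (\<integral>\<^sup>+s. ennreal (g n s) \<partial>measure_pmf (p n))"
      by (simp add: nn_integral_cmult)
    finally show ?thesis .
  qed
  have "(\<lambda>n. ennreal (1 / \<delta>) * (\<integral>\<^sup>+s. ennreal (g n s) \<partial>measure_pmf (p n))) \<longlonglongrightarrow> ennreal (1 / \<delta>) * 0"
    by (intro ennreal_tendsto_cmult lim) simp
  then have up: "(\<lambda>n. ennreal (1 / \<delta>) * (\<integral>\<^sup>+s. ennreal (g n s) \<partial>measure_pmf (p n))) \<longlonglongrightarrow> 0"
    by simp
  have "(\<lambda>n. emeasure (measure_pmf (p n)) (A n)) \<longlonglongrightarrow> 0"
    by (rule tendsto_sandwich[OF _ _ tendsto_const up]) (simp_all add: le)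
  then have "(\<lambda>n. ennreal (measure (measure_pmf (p n)) (A n))) \<longlonglongrightarrow> ennreal 0"
    by (simp add: measure_pmf.emeasure_eq_measure)
  then show ?thesis by (subst (asm) tendsto_ennreal_iff) auto
qed

lemma ennreal_tendsto_0I:
  fixes f :: "nat \<Rightarrow> ennreal"
  assumes "\<And>e::real. e > 0 \<Longrightarrow> \<forall>\<^sub>F n in sequentially. f n \<le> ennreal e"
  shows "f \<longlonglongrightarrow> 0"
proof (rule order_tendstoI)
  fix y :: ennreal assume "0 < y"
  then obtain z where z: "0 < z" "z < y" using dense by blast
  then have "z < top" using less_le_trans[OF z(2) top_greatest] by simp
  then obtain e where e: "z = ennreal e" "0 \<le> e" by (cases z) auto
  then have "e > 0" using z(1) by (simp add: ennreal_less_zero_iff)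
  from assms[OF this] show "\<forall>\<^sub>F n in sequentially. f n < y"
    by eventually_elim (use e z(2) in auto)
qed auto

subsection \<open>Drift criterion for stationary distributions\<close>

lemma finite_sum_le_bind_pmf:
  assumes "finite A"
  shows "(\<Sum>X\<in>A. pmf p X * pmf (q X) Y) \<le> pmf (bind_pmf p q) Y"
proof -
  have int: "integrable (measure_pmf p) (\<lambda>X. pmf (q X) Y)"
    by (rule measure_pmf.integrable_const_bound[where B=1]) (auto simp: pmf_le_1)
  have "(\<Sum>X\<in>A. pmf p X * pmf (q X) Y) = (\<integral>X. indicator A X * pmf (q X) Y \<partial>measure_pmf p)"
    by (subst integral_measure_pmf[OF assms]) (auto simp: indicator_eq_0_iff mult.commute)
  also have "\<dots> \<le> (\<integral>X. pmf (q X) Y \<partial>measure_pmf p)"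
    by (intro integral_mono measure_pmf.integrable_const_bound[where B=1])
       (auto simp: indicator_def pmf_le_1)
  finally show ?thesis by (simp add: pmf_bind)
qed

text \<open>Stationarity gives that the mass flowing from \<open>A\<close> to \<open>Y\<close> in
  time \<open>t\<close> is at most the mass of \<open>Y\<close>. Multiplying by
  \<open>g Y \<le> 0\<close> reverses the sign, and division by \<open>t\<close> followed by
  \<open>t\<close> tending to 0 produces the rates. As \<open>A\<close> is finite, entrywise
  derivatives suffice.\<close>

lemma stationary_truncated_drift:
  assumes "stationary_distribution S Q \<pi>" and "finite A" and "A \<subseteq> S"
    and g: "\<And>Y. Y \<in> A \<Longrightarrow> g Y \<le> 0"
  shows "0 \<le> (\<Sum>X\<in>A. pmf \<pi> X * (\<Sum>Y\<in>A. g Y * Q X Y))"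
proof -
  obtain P where P: "transition_function S Q P" and st: "\<And>t. t \<ge> 0 \<Longrightarrow> bind_pmf \<pi> (P t) = \<pi>"
    using assms(1) by (auto simp: stationary_distribution_def)
  have P0: "pmf (P 0 X) Y = (if X = Y then 1 else 0)" if "X \<in> A" for X Y
    using P that assms(3) unfolding transition_function_def by (simp add: subset_iff indicator_def)
  define D where "D t X Y = (pmf (P t X) Y - pmf (P 0 X) Y) / (t - 0)" for t X Y
  have lim: "((\<lambda>t. D t X Y) \<longlongrightarrow> Q X Y) (at_right 0)" if "X \<in> A" "Y \<in> A" for X Y
  proof -
    have "((\<lambda>t. pmf (P t X) Y) has_real_derivative Q X Y) (at 0 within {0..})"
      using P that assms(3) unfolding transition_function_def by blast
    then have "((\<lambda>t. D t X Y) \<longlongrightarrow> Q X Y) (at 0 within {0..})"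
      by (simp add: has_field_derivative_iff D_def)
    then show ?thesis by (rule tendsto_within_subset) auto
  qed
  have nn: "0 \<le> (\<Sum>X\<in>A. pmf \<pi> X * (\<Sum>Y\<in>A. g Y * D t X Y))" if t: "t > 0" for t
  proof -
    have "(\<Sum>X\<in>A. pmf \<pi> X * (\<Sum>Y\<in>A. g Y * (pmf (P t X) Y - pmf (P 0 X) Y)))
        = (\<Sum>Y\<in>A. g Y * ((\<Sum>X\<in>A. pmf \<pi> X * pmf (P t X) Y) - (\<Sum>X\<in>A. pmf \<pi> X * pmf (P 0 X) Y)))"
      by (subst sum_subtractf[symmetric], simp only: sum_distrib_left, subst sum.swap)
         (intro sum.cong refl, simp add: algebra_simps)
    also have "\<dots> = (\<Sum>Y\<in>A. g Y * ((\<Sum>X\<in>A. pmf \<pi> X * pmf (P t X) Y) - pmf \<pi> Y))"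
    proof (intro sum.cong refl)
      fix Y assume Y: "Y \<in> A"
      have "(\<Sum>X\<in>A. pmf \<pi> X * pmf (P 0 X) Y) = (\<Sum>X\<in>A. if X = Y then pmf \<pi> X else 0)"
        by (intro sum.cong) (simp_all add: P0)
      then show "g Y * ((\<Sum>X\<in>A. pmf \<pi> X * pmf (P t X) Y) - (\<Sum>X\<in>A. pmf \<pi> X * pmf (P 0 X) Y))
         = g Y * ((\<Sum>X\<in>A. pmf \<pi> X * pmf (P t X) Y) - pmf \<pi> Y)"
        using Y assms(2) by simp
    qed
    also have "\<dots> \<ge> 0"
      using finite_sum_le_bind_pmf[OF assms(2), of \<pi> "P t"] g st[of t] t
      by (intro sum_nonneg mult_nonpos_nonpos) auto
    finally have "0 \<le> (\<Sum>X\<in>A. pmf \<pi> X * (\<Sum>Y\<in>A. g Y * (pmf (P t X) Y - pmf (P 0 X) Y))) / t"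
      using t by simp
    also have "\<dots> = (\<Sum>X\<in>A. pmf \<pi> X * (\<Sum>Y\<in>A. g Y * D t X Y))"
      by (simp add: D_def sum_divide_distrib sum_distrib_left)
    finally show ?thesis .
  qed
  have "((\<lambda>t. \<Sum>X\<in>A. pmf \<pi> X * (\<Sum>Y\<in>A. g Y * D t X Y)) \<longlongrightarrow>
          (\<Sum>X\<in>A. pmf \<pi> X * (\<Sum>Y\<in>A. g Y * Q X Y))) (at_right 0)"
    by (intro tendsto_intros lim) auto
  moreover have "\<forall>\<^sub>F t in at_right 0. 0 \<le> (\<Sum>X\<in>A. pmf \<pi> X * (\<Sum>Y\<in>A. g Y * D t X Y))"
    using nn by (auto simp: eventually_at_filter)
  ultimately show ?thesis
    by (intro tendsto_lowerbound) auto
qed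

text \<open>Only the part of a jump that stays below the truncation level \<open>N\<close> is seen by the finite sum;
  what is lost is nonnegative.\<close>

lemma truncated_jump_le:
  assumes A: "A = {X \<in> S. f X < N}" and "finite A" and X: "X \<in> A" and "set_pmf p \<subseteq> S"
    and d: "\<And>Y. Y \<in> set_pmf p \<Longrightarrow> f Y - f X \<le> d"
  shows "(\<Sum>Y\<in>A. (f Y - N) * jump X p Y) \<le> (d::real)"
proof -
  have "(\<Sum>Y\<in>A. (f Y - N) * jump X p Y)
      = (\<Sum>Y\<in>A. (f Y - N) * pmf p Y) - (\<Sum>Y\<in>A. if Y = X then f Y - N else 0)"
    by (subst sum_subtractf[symmetric], intro sum.cong) (auto simp: jump_def algebra_simps)
  also have "\<dots> = (\<Sum>Y\<in>A. (f Y - N) * pmf p Y) - (f X - N)"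
    using X assms(2) by simp
  also have "(\<Sum>Y\<in>A. (f Y - N) * pmf p Y) = (\<integral>Y. indicator A Y * (f Y - N) \<partial>measure_pmf p)"
    by (subst integral_measure_pmf[OF assms(2)]) (auto simp: indicator_eq_0_iff mult.commute)
  also have "\<dots> \<le> (\<integral>Y. d + (f X - N) \<partial>measure_pmf p)"
  proof (rule integral_mono_AE)
    show "integrable (measure_pmf p) (\<lambda>Y. indicator A Y * (f Y - N))"
    proof (rule measure_pmf.integrable_const_bound)
      show "AE Y in measure_pmf p. norm (indicator A Y * (f Y - N)) \<le> (\<Sum>Y\<in>A. \<bar>f Y - N\<bar>)"
        using member_le_sum[of _ A "\<lambda>Y. \<bar>f Y - N\<bar>"] assms(2)
        by (auto simp: indicator_def sum_nonneg)
    qed simp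
    \<comment> \<open>Outside \<open>A\<close> the left side is 0, and \<open>f Y \<ge> N\<close>
      makes the right side at least \<open>f Y - N\<close>, hence nonnegative.\<close>
    show "AE Y in measure_pmf p. indicator A Y * (f Y - N) \<le> d + (f X - N)"
      using assms(4) d by (fastforce simp: AE_measure_pmf_iff indicator_def A)
  qed simp
  finally show ?thesis by simp
qed

subsection \<open>Counts and transitions\<close>

locale packing =
  fixes Kbar :: "'i::finite config set"
  assumes packing: "packing_constraints Kbar"
begin

text \<open>All counts are linear functionals of the state, so that \<open>total_shift\<close> alone
  determines how each of them reacts to a move of one server.\<close>

definition total :: "('i cconfig \<Rightarrow> real) \<Rightarrow> 'i state \<Rightarrow> real" where
  "total u X = (\<Sum>c\<in>cconfigs Kbar. u c * real (X c))"

definition actuals :: "'i \<Rightarrow> 'i state \<Rightarrow> real" where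
  "actuals i = total (\<lambda>c. real (snd c i))"

definition tokens :: "'i \<Rightarrow> 'i state \<Rightarrow> real" where
  "tokens i = total (\<lambda>c. real (fst c i - snd c i))"

abbreviation cnt :: "'i state \<Rightarrow> 'i config \<Rightarrow> nat" where
  "cnt X k \<equiv> config_count Kbar X k"

text \<open>The conditions under which the truncated subtraction in \<open>shift\<close> is exact
  and the result is again a state. An empty server is represented by the pair of zeros and is never
  counted.\<close>

definition valid_shift :: "'i cconfig \<Rightarrow> 'i cconfig \<Rightarrow> 'i state \<Rightarrow> bool" where
  "valid_shift c c' X \<longleftrightarrow> X \<in> states Kbar \<and>
     (if fst c = 0 then snd c = 0 else X c > 0) \<and> (if fst c' = 0 then snd c' = 0 else c' \<in> cconfigs Kbar)"

lemma finite_Kbar: "finite Kbar" and zero_in_Kbar: "0 \<in> Kbar"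
  and unit_in_Kbar: "unit_config i \<in> Kbar" and Kbar_down: "k \<in> Kbar \<Longrightarrow> m \<le> k \<Longrightarrow> m \<in> Kbar"
  using packing by (auto simp: packing_constraints_def)

lemma finite_configs: "finite (configs Kbar)"
  using finite_Kbar by (simp add: configs_def)

lemma finite_cconfigs: "finite (cconfigs Kbar)"
  by (rule finite_subset[of _ "Kbar \<times> Kbar"])
     (use finite_Kbar in \<open>auto simp: cconfigs_def configs_def\<close>)

lemma zero_notin_configs [simp]: "0 \<notin> configs Kbar"
  by (simp add: configs_def)

lemma unit_config_nonzero [simp]: "unit_config i \<noteq> 0" "k + unit_config i \<noteq> 0"
  "k \<noteq> k + unit_config i" "k + unit_config i \<noteq> k"
  by (metis add_is_0 plus_fun_apply unit_config_def zero_fun_apply zero_neq_one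
    add_cancel_left_right)+

lemma unit_in_configs: "unit_config i \<in> configs Kbar"
  by (simp add: configs_def unit_in_Kbar)

lemma cconfigsD:
  assumes "c \<in> cconfigs Kbar"
  shows "fst c \<in> configs Kbar" "snd c \<le> fst c" "fst c \<noteq> 0"
  using assms by (auto simp: cconfigs_def configs_def)

lemma cconfigsI: "k \<in> configs Kbar \<Longrightarrow> kh \<le> k \<Longrightarrow> (k, kh) \<in> cconfigs Kbar"
  using Kbar_down by (auto simp: cconfigs_def configs_def)

lemma in_cconfigs_if_pos: "X \<in> states Kbar \<Longrightarrow> X c > 0 \<Longrightarrow> c \<in> cconfigs Kbar"
proof (rule ccontr)
  assume "X \<in> states Kbar" "X c > 0" "c \<notin> cconfigs Kbar"
  then have "X c = 0" unfolding states_def by blast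
  with \<open>X c > 0\<close> show False by simp
qed

lemma sub_unit_add:
  assumes "(k::'i config) i > 0"
  shows "(k - unit_config i) + unit_config i = k"
proof
  fix j show "((k - unit_config i) + unit_config i) j = k j"
    using assms by (cases "j = i") (auto simp: unit_config_def fun_diff_def)
qed

lemma shift_states: "valid_shift c c' X \<Longrightarrow> shift c c' X \<in> states Kbar"
  by (auto simp: valid_shift_def states_def shift_def split: if_splits)

lemma total_shift:
  assumes v: "valid_shift c c' X" and u: "fst c = 0 \<Longrightarrow> u c = 0" "fst c' = 0 \<Longrightarrow> u c' = 0"
  shows "total u (shift c c' X) = total u X - u c + u c'"
proof -
  let ?C = "cconfigs Kbar"
  have "total u (shift c c' X) =
      (\<Sum>d\<in>?C. u d * real (X d) - (if d = c then u d else 0) + (if d = c' then u d else 0))"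
    unfolding total_def
  proof (intro sum.cong refl)
    fix d assume d: "d \<in> ?C"
    show "u d * real (shift c c' X d) =
        u d * real (X d) - (if d = c then u d else 0) + (if d = c' then u d else 0)"
      using cconfigsD[OF d] v
      by (auto simp: shift_def valid_shift_def algebra_simps of_nat_diff)
  qed
  also have "\<dots> = total u X - (if c \<in> ?C then u c else 0) + (if c' \<in> ?C then u c' else 0)"
    using finite_cconfigs by (simp add: total_def sum.distrib sum_subtractf)
  also have "(if c \<in> ?C then u c else 0) = u c"
    using v u in_cconfigs_if_pos[of X c] by (auto simp: valid_shift_def split: if_splits)
  also have "(if c' \<in> ?C then u c' else 0) = u c'"
    using v u by (auto simp: valid_shift_def split: if_splits)
  finally show ?thesis .
qed

lemma cnt_zero [simp]: "cnt X 0 = 0"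
  by (simp add: config_count_def)

lemma cnt_eq_total:
  assumes "X \<in> states Kbar"
  shows "real (cnt X k) = total (\<lambda>c. if fst c = k then 1 else 0) X"
proof -
  have "total (\<lambda>c. if fst c = k then 1 else 0) X
      = (\<Sum>c\<in>cconfigs Kbar. if fst c = k then real (X c) else 0)"
    unfolding total_def by (intro sum.cong) auto
  also have "\<dots> = (\<Sum>c\<in>{c\<in>cconfigs Kbar. fst c = k}. real (X c))"
    using finite_cconfigs by (simp add: sum.inter_filter)
  also have "\<dots> = real (cnt X k)"
  proof (cases "k \<in> configs Kbar")
    case True
    then have "{c\<in>cconfigs Kbar. fst c = k} = Pair k ` {..k}"
      using cconfigsI cconfigsD by (fastforce simp: image_iff)
    then show ?thesis
      using True by (simp add: config_count_def sum.reindex inj_on_def)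
  next
    case False
    then have e: "{c\<in>cconfigs Kbar. fst c = k} = {}"
      using cconfigsD by auto
    show ?thesis unfolding e using False by (simp add: config_count_def)
  qed
  finally show ?thesis by simp
qed

lemma cnt_shift:
  assumes v: "valid_shift c c' X" and k: "k \<noteq> 0"
  shows "real (cnt (shift c c' X) k) =
    real (cnt X k) - (if k = fst c then 1 else 0) + (if k = fst c' then 1 else 0)"
proof -
  have "X \<in> states Kbar" using v by (simp add: valid_shift_def)
  then show ?thesis
    using total_shift[OF v, of "\<lambda>c. if fst c = k then 1 else 0"] k
    by (simp add: cnt_eq_total shift_states[OF v] eq_commute[of k "fst c"] eq_commute[of k "fst c'"])
qed

lemma total_nonneg: "(\<And>c. c \<in> cconfigs Kbar \<Longrightarrow> u c \<ge> 0) \<Longrightarrow> total u X \<ge> 0"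
  unfolding total_def by (intro sum_nonneg mult_nonneg_nonneg) auto

lemma tokens_nonneg: "tokens i X \<ge> 0"
  unfolding tokens_def by (rule total_nonneg) simp

text \<open>A nonempty server holds at least one item, so there are at most as many servers as
  items.\<close>

lemma cnt_le_total:
  assumes "X \<in> states Kbar"
  shows "real (cnt X k) \<le> (\<Sum>i\<in>UNIV. actuals i X + tokens i X)"
proof -
  have "real (cnt X k) \<le> (\<Sum>c\<in>cconfigs Kbar. (\<Sum>i\<in>UNIV. real (fst c i)) * real (X c))"
    unfolding cnt_eq_total[OF assms] total_def
  proof (intro sum_mono mult_right_mono)
    fix c assume "c \<in> cconfigs Kbar"
    then have "fst c \<noteq> 0" using cconfigsD by auto
    then obtain i where "fst c i \<noteq> 0" by (metis ext zero_fun_apply)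
    then have "1 \<le> real (fst c i)" by linarith
    also have "\<dots> \<le> (\<Sum>i\<in>UNIV. real (fst c i))" by (intro member_le_sum) auto
    finally show "(if fst c = k then 1 else 0) \<le> (\<Sum>i\<in>UNIV. real (fst c i))" by auto
  qed auto
  also have "\<dots> = (\<Sum>i\<in>UNIV. \<Sum>c\<in>cconfigs Kbar. real (fst c i) * real (X c))"
    by (simp add: sum_distrib_right) (rule sum.swap)
  also have "\<dots> = (\<Sum>i\<in>UNIV. actuals i X + tokens i X)"
    unfolding actuals_def tokens_def total_def sum.distrib[symmetric]
  proof (intro sum.cong refl)
    fix i c assume "c \<in> cconfigs Kbar"
    then have "snd c i \<le> fst c i" using cconfigsD by (auto simp: le_fun_def)
    then show "real (fst c i) * real (X c) =
        real (snd c i) * real (X c) + real (fst c i - snd c i) * real (X c)"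
      by (simp add: of_nat_diff algebra_simps)
  qed
  finally show ?thesis .
qed

lemma has_token_iff: "X \<in> states Kbar \<Longrightarrow> (\<exists>c. has_token X i c) \<longleftrightarrow> tokens i X > 0"
proof
  assume X: "X \<in> states Kbar" and "\<exists>c. has_token X i c"
  then obtain c where c: "X c > 0" "snd c i < fst c i" by (auto simp: has_token_def)
  then show "tokens i X > 0"
    using in_cconfigs_if_pos[OF X c(1)] finite_cconfigs unfolding tokens_def total_def
    by (intro sum_pos2[of _ c]) auto
next
  assume X: "X \<in> states Kbar" and "tokens i X > 0"
  then show "\<exists>c. has_token X i c"
    unfolding tokens_def total_def has_token_def
    by (metis (mono_tags, lifting) gr0I less_irrefl mult_zero_left mult_zero_right of_nat_0 sum.neutral
       zero_less_diff)
qed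

lemma finite_bounded_states: "finite {X \<in> states Kbar. \<forall>i. actuals i X + tokens i X \<le> b}"
proof -
  define N where "N = real CARD('i) * \<bar>b\<bar>"
  have "{X \<in> states Kbar. \<forall>i. actuals i X + tokens i X \<le> b}
      \<subseteq> {X. X ` cconfigs Kbar \<subseteq> {..nat \<lceil>N\<rceil>} \<and> (\<forall>c. c \<notin> cconfigs Kbar \<longrightarrow> X c = 0)}"
  proof safe
    fix X c assume X: "X \<in> states Kbar" and b: "\<forall>i. actuals i X + tokens i X \<le> b"
      and c: "c \<in> cconfigs Kbar"
    have "real (X c) \<le> real (cnt X (fst c))"
      unfolding cnt_eq_total[OF X] total_def
      using member_le_sum[of c "cconfigs Kbar" "\<lambda>d. (if fst d = fst c then 1 else 0) * real (X d)"]
        c finite_cconfigs by simp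
    also have "\<dots> \<le> (\<Sum>i\<in>UNIV. actuals i X + tokens i X)" by (rule cnt_le_total[OF X])
    also have "\<dots> \<le> (\<Sum>i\<in>(UNIV::'i set). \<bar>b\<bar>)"
      using b by (intro sum_mono) (meson abs_ge_self order_trans)
    also have "\<dots> = N" by (simp add: N_def)
    finally show "X c \<le> nat \<lceil>N\<rceil>" by linarith
  qed (auto simp: states_def)
  moreover have "finite {X. X ` cconfigs Kbar \<subseteq> {..nat \<lceil>N\<rceil>} \<and> (\<forall>c. c \<notin> cconfigs Kbar \<longrightarrow> X c = 0)}"
  proof -
    have "finite {X. \<forall>c. (c \<in> cconfigs Kbar \<longrightarrow> X c \<in> {..nat \<lceil>N\<rceil>}) \<and> (c \<notin> cconfigs Kbar \<longrightarrow> X c = 0)}"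
      using finite_cconfigs by (intro finite_set_of_finite_funs) auto
    then show ?thesis by (rule rev_finite_subset) auto
  qed
  ultimately show ?thesis by (rule finite_subset)
qed

section \<open>Events as moves of single servers\<close>

lemma actuals_shift:
  assumes "valid_shift c c' X"
  shows "actuals j (shift c c' X) = actuals j X - real (snd c j) + real (snd c' j)"
  unfolding actuals_def by (rule total_shift[OF assms]) (use assms in \<open>auto simp: valid_shift_def\<close>)

lemma tokens_shift:
  assumes "valid_shift c c' X"
  shows "tokens j (shift c c' X)
    = tokens j X - real (fst c j - snd c j) + real (fst c' j - snd c' j)"
  unfolding tokens_def by (rule total_shift[OF assms]) (use assms in \<open>auto simp: valid_shift_def\<close>)

lemma place_valid:
  assumes R: "greedy_dm_rules Kbar \<alpha> R" and X: "X \<in> states Kbar"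
    and k: "k = tie_break R X i" and kh: "kh \<in> set_pmf (host R X i)"
  shows "valid_shift (k, kh) (k + unit_config i, kh + unit_config i) X"
    and "valid_shift (k, kh) (k + unit_config i, kh) X"
    and "kh \<le> k"
proof -
  have av: "k \<in> available Kbar X i" and h: "if k = 0 then kh = 0 else X (k, kh) > 0"
    using R X kh unfolding greedy_dm_rules_def is_arg_min_def k by auto
  show le: "kh \<le> k"
    using h cconfigsD(2)[OF in_cconfigs_if_pos[OF X, of "(k, kh)"]] by (auto split: if_splits)
  have "k + unit_config i \<in> configs Kbar" using av by (simp add: available_def)
  moreover have "kh + unit_config i \<le> k + unit_config i" "kh \<le> k + unit_config i"
    using le by (auto simp: le_fun_def trans_le_add1)
  ultimately have "(k + unit_config i, kh + unit_config i) \<in> cconfigs Kbar"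
      "(k + unit_config i, kh) \<in> cconfigs Kbar"
    by (auto intro: cconfigsI)
  then show "valid_shift (k, kh) (k + unit_config i, kh + unit_config i) X"
    "valid_shift (k, kh) (k + unit_config i, kh) X"
    using X h by (auto simp: valid_shift_def)
qed

lemma removal_valid:
  assumes X: "X \<in> states Kbar" and c: "X c > 0" and i: "fst c i > 0" "kh \<le> fst c - unit_config i"
  shows "valid_shift c (fst c - unit_config i, kh) X"
proof -
  have cc: "c \<in> cconfigs Kbar" using in_cconfigs_if_pos[OF X c] .
  have "fst c - unit_config i \<in> Kbar"
    using Kbar_down[of "fst c" "fst c - unit_config i"] cconfigsD[OF cc]
    by (auto simp: configs_def le_fun_def)
  moreover have "kh = 0" if "fst c - unit_config i = 0"
    using i(2) that by (simp add: le_fun_def fun_eq_iff)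
  ultimately show ?thesis
    using X c i(2) cconfigsD(3)[OF cc] cconfigsI by (auto simp: valid_shift_def configs_def)
qed

lemma arrival_cases:
  assumes R: "greedy_dm_rules Kbar \<alpha> R" and X: "X \<in> states Kbar" and Y: "Y \<in> set_pmf (arrival R X i)"
  obtains c c' where "valid_shift c c' X" "Y = shift c c' X" "snd c' = snd c + unit_config i"
    "if tokens i X > 0 then fst c' = fst c \<and> snd c i < fst c i
     else fst c' = fst c + unit_config i \<and> snd c \<le> fst c"
proof (cases "tokens i X > 0")
  case True
  then have ex: "\<exists>c. has_token X i c" using has_token_iff[OF X] by simp
  then obtain c where c: "c \<in> set_pmf (token_choice R X i)"
    "Y = shift c (fst c, snd c + unit_config i) X"
    using Y by (auto simp: arrival_def)
  have t: "X c > 0" "snd c i < fst c i"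
    using R X ex c(1) unfolding greedy_dm_rules_def has_token_def by blast+
  have cc: "c \<in> cconfigs Kbar" using in_cconfigs_if_pos[OF X t(1)] .
  have "snd c + unit_config i \<le> fst c"
    using t(2) cconfigsD(2)[OF cc] by (auto simp: le_fun_def unit_config_def)
  then have "valid_shift c (fst c, snd c + unit_config i) X"
    using X t(1) cconfigsD[OF cc] cconfigsI by (auto simp: valid_shift_def)
  then show ?thesis using True c(2) t(2) by (intro that[of c "(fst c, snd c + unit_config i)"]) auto
next
  case False
  then have ex: "\<not> (\<exists>c. has_token X i c)" using has_token_iff[OF X] by simp
  define k where "k = tie_break R X i"
  obtain kh where "kh \<in> set_pmf (host R X i)"
    "Y = shift (k, kh) (k + unit_config i, kh + unit_config i) X"
    using Y ex by (auto simp: arrival_def place_actual_def Let_def k_def)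
  then show ?thesis
    using False place_valid[OF R X k_def] by (intro that[of "(k, kh)"]) auto
qed

text \<open>The event is a composition of two moves. The greedy choice is made in the intermediate
  state \<open>X'\<close>, where the server just left already counts in its reduced
  configuration.\<close>

lemma service_cases:
  assumes R: "greedy_dm_rules Kbar \<alpha> R" and X: "X \<in> states Kbar" and c: "X c > 0" "snd c i > 0"
    and Y: "Y \<in> set_pmf (service_completion R X i c)"
  obtains c1 X' kh where "c1 = (fst c - unit_config i, snd c - unit_config i)" "X' = shift c c1 X"
    "valid_shift c c1 X"
    "valid_shift (tie_break R X' i, kh) (tie_break R X' i + unit_config i, kh) X'"
    "kh \<le> tie_break R X' i"
    "Y = shift (tie_break R X' i, kh) (tie_break R X' i + unit_config i, kh) X'"
proof -
  define c1 where "c1 = (fst c - unit_config i, snd c - unit_config i)"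
  define X' where "X' = shift c c1 X"
  have le: "snd c \<le> fst c" using cconfigsD(2)[OF in_cconfigs_if_pos[OF X c(1)]] .
  then have "fst c i > 0" using c(2) by (metis le_funD less_le_trans)
  moreover have "snd c - unit_config i \<le> fst c - unit_config i"
    using le by (auto simp: le_fun_def diff_le_mono)
  ultimately have v: "valid_shift c c1 X" unfolding c1_def by (intro removal_valid X c)
  then have X': "X' \<in> states Kbar" unfolding X'_def by (rule shift_states)
  obtain kh where "kh \<in> set_pmf (host R X' i)"
    "Y = shift (tie_break R X' i, kh) (tie_break R X' i + unit_config i, kh) X'"
    using Y by (auto simp: service_completion_def place_token_def Let_def X'_def c1_def)
  then show ?thesis
    using place_valid[OF R X' refl] v by (intro that[of c1 X' kh] c1_def X'_def) auto
qed

lemma token_completion_cases: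
  assumes X: "X \<in> states Kbar" and c: "X c > 0" "snd c i < fst c i"
    and Y: "Y \<in> set_pmf (token_completion X i c)"
  shows "Y = shift c (fst c - unit_config i, snd c) X"
    and "valid_shift c (fst c - unit_config i, snd c) X"
proof -
  show "Y = shift c (fst c - unit_config i, snd c) X" using Y by (simp add: token_completion_def)
  have "snd c \<le> fst c - unit_config i"
    using c(2) cconfigsD(2)[OF in_cconfigs_if_pos[OF X c(1)]] by (auto simp: le_fun_def unit_config_def)
  then show "valid_shift c (fst c - unit_config i, snd c) X"
    using c by (intro removal_valid X) auto
qed

text \<open>Neither here nor for the two other events do the increments depend on the placement: the
  numbers of actual customers and of tokens evolve as they would without packing constraints. This
  makes the quadratic Lyapunov function tractable.\<close>

lemma arrival_counts:
  assumes "greedy_dm_rules Kbar \<alpha> R" "X \<in> states Kbar" "Y \<in> set_pmf (arrival R X i)"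
  shows "Y \<in> states Kbar"
    and "actuals j Y = actuals j X + (if j = i then 1 else 0)"
    and "tokens j Y = tokens j X - (if j = i \<and> tokens i X > 0 then 1 else 0)"
proof -
  obtain c c' where *: "valid_shift c c' X" "Y = shift c c' X" "snd c' = snd c + unit_config i"
    "if tokens i X > 0 then fst c' = fst c \<and> snd c i < fst c i
     else fst c' = fst c + unit_config i \<and> snd c \<le> fst c"
    using arrival_cases[OF assms] .
  show "Y \<in> states Kbar" using * shift_states by simp
  show "actuals j Y = actuals j X + (if j = i then 1 else 0)"
    using * by (auto simp: actuals_shift unit_config_def)
  show "tokens j Y = tokens j X - (if j = i \<and> tokens i X > 0 then 1 else 0)"
    using * by (auto simp: tokens_shift unit_config_def le_fun_def of_nat_diff split: if_splits)
qed

lemma service_counts: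
  assumes "greedy_dm_rules Kbar \<alpha> R" "X \<in> states Kbar" "X c > 0" "snd c i > 0"
    "Y \<in> set_pmf (service_completion R X i c)"
  shows "Y \<in> states Kbar"
    and "actuals j Y = actuals j X - (if j = i then 1 else 0)"
    and "tokens j Y = tokens j X + (if j = i then 1 else 0)"
proof -
  obtain c1 X' kh where *: "c1 = (fst c - unit_config i, snd c - unit_config i)" "X' = shift c c1 X"
    "valid_shift c c1 X"
    "valid_shift (tie_break R X' i, kh) (tie_break R X' i + unit_config i, kh) X'"
    "kh \<le> tie_break R X' i"
    "Y = shift (tie_break R X' i, kh) (tie_break R X' i + unit_config i, kh) X'"
    using service_cases[OF assms] .
  have le: "snd c \<le> fst c" using cconfigsD(2)[OF in_cconfigs_if_pos[OF assms(2,3)]] .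
  then have i: "snd c i \<le> fst c i" "snd c j \<le> fst c j" by (auto simp: le_fun_def)
  have kh: "kh j \<le> tie_break R X' i j" using *(5) by (auto simp: le_fun_def)
  show "Y \<in> states Kbar" using * shift_states by simp
  show "actuals j Y = actuals j X - (if j = i then 1 else 0)"
    unfolding *(6) actuals_shift[OF *(4)] unfolding *(2) actuals_shift[OF *(3)]
    using assms(4) i by (auto simp: *(1) unit_config_def of_nat_diff)
  have "tokens j Y = tokens j X' + (if j = i then 1 else 0)"
    unfolding *(6) tokens_shift[OF *(4)] using kh by (auto simp: unit_config_def of_nat_diff)
  also have "tokens j X' = tokens j X"
    unfolding *(2) tokens_shift[OF *(3)]
    using assms(4) i by (auto simp: *(1) unit_config_def of_nat_diff)
  finally show "tokens j Y = tokens j X + (if j = i then 1 else 0)" .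
qed

lemma token_completion_counts:
  assumes "X \<in> states Kbar" "X c > 0" "snd c i < fst c i" "Y \<in> set_pmf (token_completion X i c)"
  shows "Y \<in> states Kbar"
    and "actuals j Y = actuals j X"
    and "tokens j Y = tokens j X - (if j = i then 1 else 0)"
  unfolding token_completion_cases(1)[OF assms]
  using token_completion_cases(2)[OF assms] assms(3)
  by (auto simp: shift_states actuals_shift tokens_shift unit_config_def of_nat_diff)

end

subsection \<open>Second moments of the load\<close>

locale greedy_dm = packing Kbar
  for Kbar :: "'i::finite config set" +
  fixes lam mu \<rho> :: "'i \<Rightarrow> real" and mu0 \<alpha> :: real
  assumes lam_pos: "lam i > 0" and mu_pos: "mu i > 0" and mu0_pos: "mu0 > 0" and \<alpha>_pos: "\<alpha> > 0"
    and \<rho>_eq: "\<rho> i = lam i / mu i" and sum_\<rho>: "(\<Sum>i\<in>UNIV. \<rho> i) = 1"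
begin

text \<open>Foster's criterion in expectation form. \<open>stationary_truncated_drift\<close> is
  applied to \<open>f - N\<close> on the sublevel set of \<open>f\<close>, where it is negative; by
  \<open>truncated_jump_le\<close> the cutoff does not spoil the bounds on the increments. Both
  means may be infinite a priori.\<close>

lemma foster:
  fixes f W B :: "'i state \<Rightarrow> real"
  assumes st: "stationary_distribution (states Kbar) (rate_matrix Kbar lam mu mu0 R r) \<pi>"
    and R: "greedy_dm_rules Kbar \<alpha> R" and r: "r \<ge> 0"
    and fin: "\<And>N. finite {X \<in> states Kbar. f X < N}"
    and arr: "\<And>X i Y. X \<in> states Kbar \<Longrightarrow> Y \<in> set_pmf (arrival R X i) \<Longrightarrow> f Y - f X \<le> a i X"
    and srv: "\<And>X i c Y. X \<in> states Kbar \<Longrightarrow> X c > 0 \<Longrightarrow> snd c i > 0 \<Longrightarrow>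
                Y \<in> set_pmf (service_completion R X i c) \<Longrightarrow> f Y - f X \<le> s i c X"
    and tok: "\<And>X i c Y. X \<in> states Kbar \<Longrightarrow> X c > 0 \<Longrightarrow> snd c i < fst c i \<Longrightarrow>
                Y \<in> set_pmf (token_completion X i c) \<Longrightarrow> f Y - f X \<le> d i c X"
    and drift: "\<And>X. X \<in> states Kbar \<Longrightarrow>
        (\<Sum>i\<in>UNIV. lam i * r * a i X)
      + (\<Sum>i\<in>UNIV. \<Sum>c\<in>cconfigs Kbar. mu i * real (snd c i * X c) * s i c X)
      + (\<Sum>i\<in>UNIV. \<Sum>c\<in>cconfigs Kbar. mu0 * real ((fst c i - snd c i) * X c) * d i c X)
      \<le> B X - W X"
    and W: "\<And>X. W X \<ge> 0" and B: "\<And>X. B X \<ge> 0"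
  shows "(\<integral>\<^sup>+X. ennreal (W X) \<partial>measure_pmf \<pi>) \<le> (\<integral>\<^sup>+X. ennreal (B X) \<partial>measure_pmf \<pi>)"
proof -
  define A where "A N = {X \<in> states Kbar. f X < real N}" for N :: nat
  have fA: "finite (A N)" for N unfolding A_def by (rule fin)
  have sub: "set_pmf \<pi> \<subseteq> states Kbar" using st by (simp add: stationary_distribution_def)
  have trunc: "(\<Sum>Y\<in>A N. (f Y - N) * rate_matrix Kbar lam mu mu0 R r X Y) \<le> B X - W X"
    if X: "X \<in> A N" for X N
  proof -
    have XS: "X \<in> states Kbar" using X by (simp add: A_def)
    define J where "J p = (\<Sum>Y\<in>A N. (f Y - N) * jump X p Y)" for p
    have "(\<Sum>Y\<in>A N. (f Y - N) * rate_matrix Kbar lam mu mu0 R r X Y) =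
        (\<Sum>i\<in>UNIV. lam i * r * J (arrival R X i))
      + (\<Sum>i\<in>UNIV. \<Sum>c\<in>cconfigs Kbar. mu i * real (snd c i * X c) * J (service_completion R X i c))
      + (\<Sum>i\<in>UNIV. \<Sum>c\<in>cconfigs Kbar.
           mu0 * real ((fst c i - snd c i) * X c) * J (token_completion X i c))"
    proof -
      have 1: "(\<Sum>Y\<in>A N. (f Y - N) * (\<Sum>i\<in>UNIV. q i * h i Y)) = (\<Sum>i\<in>UNIV. q i * (\<Sum>Y\<in>A N. (f Y - N) * h i Y))"
        for q :: "'i \<Rightarrow> real" and h
        by (simp add: sum_distrib_left, subst sum.swap) (simp add: mult.left_commute)
      have 2: "(\<Sum>Y\<in>A N. (f Y - N) * (\<Sum>i\<in>UNIV. \<Sum>c\<in>cconfigs Kbar. q i c * h i c Y))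
          = (\<Sum>i\<in>UNIV. \<Sum>c\<in>cconfigs Kbar. q i c * (\<Sum>Y\<in>A N. (f Y - N) * h i c Y))"
        for q :: "'i \<Rightarrow> _ \<Rightarrow> real" and h
        by (simp add: sum_distrib_left, subst sum.swap, intro sum.cong refl, subst sum.swap)
           (simp add: mult.left_commute)
      show ?thesis
        unfolding rate_matrix_def J_def by (simp only: distrib_left sum.distrib 1 2)
    qed
    also have "\<dots> \<le> (\<Sum>i\<in>UNIV. lam i * r * a i X)
      + (\<Sum>i\<in>UNIV. \<Sum>c\<in>cconfigs Kbar. mu i * real (snd c i * X c) * s i c X)
      + (\<Sum>i\<in>UNIV. \<Sum>c\<in>cconfigs Kbar. mu0 * real ((fst c i - snd c i) * X c) * d i c X)"
    proof (intro add_mono sum_mono)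
      fix i
      have "J (arrival R X i) \<le> a i X" unfolding J_def
        using arr[OF XS] arrival_counts(1)[OF R XS]
        by (intro truncated_jump_le[OF A_def fA X]) auto
      then show "lam i * r * J (arrival R X i) \<le> lam i * r * a i X"
        using lam_pos[of i] r by (intro mult_left_mono) auto
    next
      \<comment> \<open>The increment bound is available only for events of positive rate; for the
        others both sides vanish.\<close>
      fix i c
      have "J (service_completion R X i c) \<le> s i c X" if "X c > 0" "snd c i > 0" unfolding J_def
        using srv[OF XS that] service_counts(1)[OF R XS that]
        by (intro truncated_jump_le[OF A_def fA X]) auto
      then show "mu i * real (snd c i * X c) * J (service_completion R X i c)
          \<le> mu i * real (snd c i * X c) * s i c X"
        using mu_pos[of i] by (cases "snd c i = 0"; cases "X c = 0") (simp_all add: mult_left_mono)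
    next
      fix i c
      have "J (token_completion X i c) \<le> d i c X" if "X c > 0" "snd c i < fst c i" unfolding J_def
        using tok[OF XS that] token_completion_counts(1)[OF XS that]
        by (intro truncated_jump_le[OF A_def fA X]) auto
      then show "mu0 * real ((fst c i - snd c i) * X c) * J (token_completion X i c)
          \<le> mu0 * real ((fst c i - snd c i) * X c) * d i c X"
        using mu0_pos by (cases "snd c i < fst c i"; cases "X c = 0") (simp_all add: mult_left_mono)
    qed
    also have "\<dots> \<le> B X - W X" by (rule drift[OF XS])
    finally show ?thesis .
  qed
  have le: "(\<integral>\<^sup>+X. ennreal (indicator (A N) X * W X) \<partial>measure_pmf \<pi>) \<le> (\<integral>\<^sup>+X. ennreal (B X) \<partial>measure_pmf \<pi>)"
    for N
  proof -
    have "0 \<le> (\<Sum>X\<in>A N. pmf \<pi> X * (\<Sum>Y\<in>A N. (f Y - N) * rate_matrix Kbar lam mu mu0 R r X Y))"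
      by (rule stationary_truncated_drift[OF st fA]) (auto simp: A_def)
    also have "\<dots> \<le> (\<Sum>X\<in>A N. pmf \<pi> X * (B X - W X))"
      by (intro sum_mono mult_left_mono trunc) auto
    finally have *: "(\<Sum>X\<in>A N. W X * pmf \<pi> X) \<le> (\<Sum>X\<in>A N. B X * pmf \<pi> X)"
      by (simp add: algebra_simps sum_subtractf)
    have **: "(\<integral>\<^sup>+X. ennreal (indicator (A N) X * h X) \<partial>measure_pmf \<pi>) = ennreal (\<Sum>X\<in>A N. h X * pmf \<pi> X)"
      if "\<And>X. h X \<ge> 0" for h
      using that
      by (subst nn_integral_measure_pmf_support[of "A N"])
         (auto simp: fA ennreal_mult sum_ennreal[symmetric] simp del: sum_ennreal)
    have "(\<integral>\<^sup>+X. ennreal (indicator (A N) X * W X) \<partial>measure_pmf \<pi>)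
        \<le> (\<integral>\<^sup>+X. ennreal (indicator (A N) X * B X) \<partial>measure_pmf \<pi>)"
      unfolding **[OF W] **[OF B] using * by (rule ennreal_leI)
    also have "\<dots> \<le> (\<integral>\<^sup>+X. ennreal (B X) \<partial>measure_pmf \<pi>)"
      using B by (intro nn_integral_mono ennreal_leI) (auto simp: indicator_def)
    finally show ?thesis .
  qed
  have "(\<integral>\<^sup>+X. ennreal (W X) \<partial>measure_pmf \<pi>)
      = (\<integral>\<^sup>+X. (SUP N. ennreal (indicator (A N) X * W X)) \<partial>measure_pmf \<pi>)"
  proof (rule nn_integral_cong_AE, unfold AE_measure_pmf_iff, intro ballI)
    fix X assume X: "X \<in> set_pmf \<pi>"
    obtain N :: nat where "f X < N" using reals_Archimedean2 by blast
    then have "X \<in> A N" using X sub by (auto simp: A_def)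
    then have "ennreal (W X) \<le> (SUP N. ennreal (indicator (A N) X * W X))"
      by (intro SUP_upper2[of N]) auto
    moreover have "(SUP N. ennreal (indicator (A N) X * W X)) \<le> ennreal (W X)"
      using W[of X] by (intro SUP_least ennreal_leI) (auto simp: indicator_def)
    ultimately show "ennreal (W X) = (SUP N. ennreal (indicator (A N) X * W X))" by (rule antisym)
  qed
  \<comment> \<open>The sets \<open>A N\<close> increase with \<open>N\<close> and exhaust the
    support of \<open>\<pi>\<close>.\<close>
  also have "\<dots> = (SUP N. \<integral>\<^sup>+X. ennreal (indicator (A N) X * W X) \<partial>measure_pmf \<pi>)"
    using W
    by (intro nn_integral_monotone_convergence_SUP)
       (auto simp: incseq_def le_fun_def A_def indicator_def intro!: ennreal_leI)
  also have "\<dots> \<le> (\<integral>\<^sup>+X. ennreal (B X) \<partial>measure_pmf \<pi>)"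
    by (intro SUP_least le)
  finally show ?thesis .
qed

definition dev :: "real \<Rightarrow> 'i \<Rightarrow> 'i state \<Rightarrow> real" where
  "dev r i X = actuals i X - \<rho> i * r"

text \<open>
  The weight \<open>\<mu>\<^sub>i / \<mu>\<^sub>0\<close> lets the decay of the first square absorb the cross term \<open>2 \<mu>\<^sub>i D Z\<close> in the
  drift of the second one.
\<close>

definition lyap :: "real \<Rightarrow> 'i state \<Rightarrow> real" where
  "lyap r X = (\<Sum>i\<in>UNIV. mu i / mu0 * (dev r i X)\<^sup>2 + (tokens i X)\<^sup>2)"

text \<open>The increments come from expanding the two squares after a change by one. At an arrival
  this is only an upper bound: without a token the second square stays put, and 1 is used in place
  of 0.\<close>

definition lyap_arr :: "real \<Rightarrow> 'i \<Rightarrow> 'i state \<Rightarrow> real" where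
  "lyap_arr r i X = mu i / mu0 * (2 * dev r i X + 1) - 2 * tokens i X + 1"

definition lyap_srv :: "real \<Rightarrow> 'i \<Rightarrow> 'i state \<Rightarrow> real" where
  "lyap_srv r i X = mu i / mu0 * (1 - 2 * dev r i X) + 2 * tokens i X + 1"

definition lyap_tok :: "'i \<Rightarrow> 'i state \<Rightarrow> real" where
  "lyap_tok i X = 1 - 2 * tokens i X"

text \<open>What is left after completing squares in \<open>lyap_drift\<close>: a term proportional
  to \<open>r\<close>, and a constant that is multiplied by \<open>r \<ge> 1\<close>.\<close>

definition lyap_const :: real where
  "lyap_const = (\<Sum>i\<in>UNIV. (mu i / mu0 + 1)\<^sup>2 * mu0 / 2 + mu0 / 2 + 2 * lam i * (mu i / mu0 + 1))"

lemma lyap_diff: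
  assumes "\<And>j. actuals j Y = actuals j X + (if j = i then u else 0)"
    and "\<And>j. tokens j Y = tokens j X + (if j = i then v else 0)"
  shows "lyap r Y - lyap r X = mu i / mu0 * (2 * u * dev r i X + u\<^sup>2) + (2 * v * tokens i X + v\<^sup>2)"
proof -
  have "lyap r Y - lyap r X = (\<Sum>j\<in>UNIV. if j = i then
      mu i / mu0 * (2 * u * dev r i X + u\<^sup>2) + (2 * v * tokens i X + v\<^sup>2) else 0)"
    unfolding lyap_def sum_subtractf[symmetric]
    by (intro sum.cong refl) (auto simp: dev_def assms power2_eq_square algebra_simps)
  then show ?thesis by simp
qed

lemma lyap_arrival:
  assumes "greedy_dm_rules Kbar \<alpha> R" "X \<in> states Kbar" "Y \<in> set_pmf (arrival R X i)"
  shows "lyap r Y - lyap r X \<le> lyap_arr r i X"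
proof -
  have "lyap r Y - lyap r X = mu i / mu0 * (2 * 1 * dev r i X + 1\<^sup>2)
      + (2 * (if tokens i X > 0 then - 1 else 0) * tokens i X + (if tokens i X > 0 then - 1 else 0)\<^sup>2)"
    by (rule lyap_diff) (auto simp: arrival_counts[OF assms])
  then show ?thesis using tokens_nonneg[of i X] by (auto simp: lyap_arr_def)
qed

lemma lyap_service:
  assumes "greedy_dm_rules Kbar \<alpha> R" "X \<in> states Kbar" "X c > 0" "snd c i > 0"
    "Y \<in> set_pmf (service_completion R X i c)"
  shows "lyap r Y - lyap r X = lyap_srv r i X"
proof -
  have "lyap r Y - lyap r X = mu i / mu0 * (2 * (-1) * dev r i X + (-1)\<^sup>2) + (2 * 1 * tokens i X + 1\<^sup>2)"
    by (rule lyap_diff) (auto simp: service_counts[OF assms])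
  then show ?thesis by (simp add: lyap_srv_def)
qed

lemma lyap_token:
  assumes "X \<in> states Kbar" "X c > 0" "snd c i < fst c i" "Y \<in> set_pmf (token_completion X i c)"
  shows "lyap r Y - lyap r X = lyap_tok i X"
proof -
  have "lyap r Y - lyap r X = mu i / mu0 * (2 * 0 * dev r i X + 0\<^sup>2) + (2 * (-1) * tokens i X + (-1)\<^sup>2)"
    by (rule lyap_diff) (auto simp: token_completion_counts[OF assms])
  then show ?thesis by (simp add: lyap_tok_def)
qed

lemma sum_actual_rate:
  "(\<Sum>c\<in>cconfigs Kbar. mu i * real (snd c i * X c) * s) = mu i * actuals i X * s"
  and sum_token_rate:
  "(\<Sum>c\<in>cconfigs Kbar. mu0 * real ((fst c i - snd c i) * X c) * s) = mu0 * tokens i X * s"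
  by (simp_all add: actuals_def tokens_def total_def sum_distrib_left sum_distrib_right mult.assoc)

lemma lyap_drift:
  assumes r: "r \<ge> 1"
  shows "(\<Sum>i\<in>UNIV. lam i * r * lyap_arr r i X) + (\<Sum>i\<in>UNIV. mu i * actuals i X * lyap_srv r i X)
       + (\<Sum>i\<in>UNIV. mu0 * tokens i X * lyap_tok i X)
     \<le> lyap_const * r - (\<Sum>i\<in>UNIV. (mu i)\<^sup>2 / (2 * mu0) * (dev r i X)\<^sup>2 + mu0 / 2 * (tokens i X)\<^sup>2)"
  unfolding lyap_const_def sum_distrib_right sum.distrib[symmetric] sum_subtractf[symmetric]
proof (rule sum_mono)
  fix i
  define D Z m where "D = dev r i X" and "Z = tokens i X" and "m = mu i"
  define A where "A = m / mu0"
  have m: "m = A * mu0" using mu0_pos by (simp add: A_def)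
  have A: "A > 0" using mu0_pos mu_pos by (simp add: A_def m_def)
  \<comment> \<open>Departures exceed arrivals by exactly \<open>m * D\<close>. Therefore all
    products of \<open>r\<close> with \<open>D\<close> or \<open>Z\<close> cancel, and
    \<open>r\<close> survives only in \<open>2 * (lam i * r) * (A + 1)\<close>.\<close>
  have act: "m * actuals i X = m * D + lam i * r"
    using mu_pos[of i] by (simp add: m_def D_def dev_def \<rho>_eq field_simps)
  have "lam i * r * lyap_arr r i X + mu i * actuals i X * lyap_srv r i X + mu0 * tokens i X * lyap_tok i X
      = lam i * r * (A * (2 * D + 1) - 2 * Z + 1) + (m * D + lam i * r) * (A * (1 - 2 * D) + 2 * Z + 1)
        + mu0 * Z * (1 - 2 * Z)"
    using act by (simp add: lyap_arr_def lyap_srv_def lyap_tok_def A_def m_def D_def Z_def)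
  also have "\<dots> = 2 * (lam i * r) * (A + 1) + mu0 * (- 2 * (A * D)\<^sup>2 + (A + 1) * (A * D) + 2 * (A * D) * Z + Z - 2 * Z\<^sup>2)"
    by (simp add: m algebra_simps power2_eq_square)
  also have "\<dots> \<le> 2 * (lam i * r) * (A + 1) + mu0 * ((A + 1)\<^sup>2 / 2 + 1 / 2 - (A * D)\<^sup>2 / 2 - Z\<^sup>2 / 2)"
  proof -
    \<comment> \<open>One square for each term to be absorbed: \<open>2 * (A * D) * Z\<close>,
      \<open>(A + 1) * (A * D)\<close> and \<open>Z\<close>. Of the coefficient -2 of each quadratic
      term, -1/2 remains.\<close>
    have "0 \<le> (A * D - Z)\<^sup>2" "0 \<le> (A * D - (A + 1))\<^sup>2" "0 \<le> (Z - 1)\<^sup>2" by simp_all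
    then have "- 2 * (A * D)\<^sup>2 + (A + 1) * (A * D) + 2 * (A * D) * Z + Z - 2 * Z\<^sup>2
        \<le> (A + 1)\<^sup>2 / 2 + 1 / 2 - (A * D)\<^sup>2 / 2 - Z\<^sup>2 / 2"
      by (simp add: power2_diff algebra_simps)
    then show ?thesis using mu0_pos by simp
  qed
  also have "\<dots> \<le> 2 * (lam i * r) * (A + 1) + mu0 * ((A + 1)\<^sup>2 / 2 + 1 / 2) * r
      - (m\<^sup>2 / (2 * mu0) * D\<^sup>2 + mu0 / 2 * Z\<^sup>2)"
  proof -
    have "mu0 * ((A + 1)\<^sup>2 / 2 + 1 / 2) * 1 \<le> mu0 * ((A + 1)\<^sup>2 / 2 + 1 / 2) * r"
      using mu0_pos r by (intro mult_left_mono) auto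
    moreover have "m\<^sup>2 / (2 * mu0) * D\<^sup>2 = mu0 * ((A * D)\<^sup>2 / 2)"
      using mu0_pos by (simp add: m power2_eq_square)
    ultimately show ?thesis by (simp add: algebra_simps)
  qed
  also have "\<dots> = ((mu i / mu0 + 1)\<^sup>2 * mu0 / 2 + mu0 / 2 + 2 * lam i * (mu i / mu0 + 1)) * r
      - ((mu i)\<^sup>2 / (2 * mu0) * (dev r i X)\<^sup>2 + mu0 / 2 * (tokens i X)\<^sup>2)"
    by (simp add: A_def m_def D_def Z_def algebra_simps)
  finally show "lam i * r * lyap_arr r i X + mu i * actuals i X * lyap_srv r i X + mu0 * tokens i X * lyap_tok i X
     \<le> ((mu i / mu0 + 1)\<^sup>2 * mu0 / 2 + mu0 / 2 + 2 * lam i * (mu i / mu0 + 1)) * r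
      - ((mu i)\<^sup>2 / (2 * mu0) * (dev r i X)\<^sup>2 + mu0 / 2 * (tokens i X)\<^sup>2)" .
qed

lemma finite_lyap_sublevel: "finite {X \<in> states Kbar. lyap r X < N}"
proof -
  define b where "b i = \<bar>\<rho> i * r\<bar> + N * mu0 / mu i + N + 2" for i
  have "actuals i X + tokens i X \<le> (\<Sum>i\<in>UNIV. \<bar>b i\<bar>)" if "lyap r X < N" for i X
  proof -
    have le: "mu i / mu0 * (dev r i X)\<^sup>2 + (tokens i X)\<^sup>2 \<le> lyap r X"
      unfolding lyap_def using mu_pos mu0_pos by (intro member_le_sum) (auto simp: less_imp_le)
    have sq: "x \<le> x\<^sup>2 + 1" for x :: real
      using zero_le_power2[of "x - 1/2"] by (simp add: power2_diff power2_eq_square algebra_simps)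
    have "mu i / mu0 * (dev r i X)\<^sup>2 \<le> N"
      using le that zero_le_power2[of "tokens i X"] by linarith
    then have "(dev r i X)\<^sup>2 \<le> N * mu0 / mu i"
      using mu_pos[of i] mu0_pos by (simp add: field_simps)
    moreover have "0 \<le> mu i / mu0 * (dev r i X)\<^sup>2" using mu_pos[of i] mu0_pos by simp
    then have "(tokens i X)\<^sup>2 \<le> N" using le that by linarith
    ultimately have "dev r i X + tokens i X \<le> N * mu0 / mu i + N + 2"
      using sq[of "dev r i X"] sq[of "tokens i X"] by linarith
    then have "actuals i X + tokens i X \<le> \<bar>b i\<bar>" unfolding b_def dev_def by linarith
    also have "\<dots> \<le> (\<Sum>i\<in>UNIV. \<bar>b i\<bar>)" by (intro member_le_sum) auto
    finally show ?thesis .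
  qed
  then show ?thesis
    by (intro finite_subset[OF _ finite_bounded_states[of "\<Sum>i\<in>UNIV. \<bar>b i\<bar>"]]) auto
qed

text \<open>A single quantity that dominates all deviations from balance, so that later error terms
  need only its first two moments.\<close>

definition fluctuation :: "real \<Rightarrow> 'i state \<Rightarrow> real" where
  "fluctuation r X = (\<Sum>i\<in>UNIV. \<bar>dev r i X\<bar> + tokens i X)"

text \<open>\<open>foster\<close> bounds the mean of the quadratic form in \<open>lyap_drift\<close>
  by a multiple of \<open>r\<close>, and weighted Cauchy-Schwarz compares the square of the sum with
  that form. The constant serves all rules, all \<open>r \<ge> 1\<close> and all stationary
  distributions.\<close>

lemma second_moment_bound:
  "\<exists>C\<ge>0. \<forall>R r \<pi>. greedy_dm_rules Kbar \<alpha> R \<longrightarrow> r \<ge> 1 \<longrightarrow>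
    stationary_distribution (states Kbar) (rate_matrix Kbar lam mu mu0 R r) \<pi> \<longrightarrow>
    (\<integral>\<^sup>+X. ennreal ((fluctuation r X)\<^sup>2) \<partial>measure_pmf \<pi>) \<le> ennreal (C * r)"
proof -
  \<comment> \<open>The smaller of the two coefficients of the quadratic form; the factor 2 in
    \<open>K\<close> is from the square of a sum of two terms.\<close>
  define q where "q i = min ((mu i)\<^sup>2 / (2 * mu0)) (mu0 / 2)" for i
  have q: "q i > 0" for i using mu_pos[of i] mu0_pos by (simp add: q_def)
  define K where "K = 2 * (\<Sum>i\<in>UNIV. 1 / q i)"
  have K: "K \<ge> 0" unfolding K_def using q by (simp add: sum_nonneg less_imp_le)
  have lc: "lyap_const \<ge> 0"
    unfolding lyap_const_def using mu_pos lam_pos mu0_pos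
    by (intro sum_nonneg) (simp add: less_imp_le add_nonneg_nonneg)
  define W where "W r X = (\<Sum>i\<in>UNIV. (mu i)\<^sup>2 / (2 * mu0) * (dev r i X)\<^sup>2 + mu0 / 2 * (tokens i X)\<^sup>2)" for r X
  have WW: "(fluctuation r X)\<^sup>2 \<le> K * W r X" for r X
  proof -
    define x where "x i = \<bar>dev r i X\<bar> + tokens i X" for i
    have "(\<Sum>i\<in>UNIV. x i)\<^sup>2 = (\<Sum>i\<in>UNIV. (1 / sqrt (q i)) * (sqrt (q i) * x i))\<^sup>2"
      using q by (simp add: less_imp_neq[symmetric])
    also have "\<dots> \<le> (\<Sum>i\<in>UNIV. (1 / sqrt (q i))\<^sup>2) * (\<Sum>i\<in>UNIV. (sqrt (q i) * x i)\<^sup>2)"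
      by (rule Cauchy_Schwarz_ineq_sum)
    also have "\<dots> = (\<Sum>i\<in>UNIV. 1 / q i) * (\<Sum>i\<in>UNIV. q i * (x i)\<^sup>2)"
      using q by (simp add: power_mult_distrib power_divide less_imp_le)
    also have "\<dots> \<le> (\<Sum>i\<in>UNIV. 1 / q i) * (2 * W r X)"
    proof (rule mult_left_mono)
      show "(\<Sum>i\<in>UNIV. q i * (x i)\<^sup>2) \<le> 2 * W r X"
        unfolding W_def sum_distrib_left
      proof (intro sum_mono)
        fix i
        have "(x i)\<^sup>2 \<le> 2 * (dev r i X)\<^sup>2 + 2 * (tokens i X)\<^sup>2"
          using zero_le_power2[of "\<bar>dev r i X\<bar> - tokens i X"]
          by (simp add: x_def power2_sum power2_diff)
        then have "q i * (x i)\<^sup>2 \<le> q i * (2 * (dev r i X)\<^sup>2 + 2 * (tokens i X)\<^sup>2)"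
          using q[of i] by (intro mult_left_mono) auto
        also have "\<dots> = 2 * (q i * (dev r i X)\<^sup>2 + q i * (tokens i X)\<^sup>2)" by (simp add: algebra_simps)
        also have "\<dots> \<le> 2 * ((mu i)\<^sup>2 / (2 * mu0) * (dev r i X)\<^sup>2 + mu0 / 2 * (tokens i X)\<^sup>2)"
          by (intro mult_left_mono add_mono mult_right_mono) (auto simp: q_def)
        finally show "q i * (x i)\<^sup>2 \<le> 2 * ((mu i)\<^sup>2 / (2 * mu0) * (dev r i X)\<^sup>2 + mu0 / 2 * (tokens i X)\<^sup>2)" .
      qed
    qed (use q in \<open>simp add: sum_nonneg less_imp_le\<close>)
    also have "\<dots> = K * W r X" by (simp add: K_def)
    finally show ?thesis by (simp add: x_def fluctuation_def)
  qed
  show ?thesis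
  proof (intro exI[of _ "K * lyap_const"] conjI allI impI)
    show "0 \<le> K * lyap_const" using K lc by simp
  next
    fix R r \<pi>
    assume R: "greedy_dm_rules Kbar \<alpha> R" and r: "r \<ge> (1::real)"
      and st: "stationary_distribution (states Kbar) (rate_matrix Kbar lam mu mu0 R r) \<pi>"
    have "(\<integral>\<^sup>+X. ennreal ((fluctuation r X)\<^sup>2) \<partial>measure_pmf \<pi>)
        \<le> (\<integral>\<^sup>+X. ennreal K * ennreal (W r X) \<partial>measure_pmf \<pi>)"
      using WW K by (intro nn_integral_mono) (simp add: ennreal_mult'[symmetric] ennreal_leI)
    also have "\<dots> = ennreal K * (\<integral>\<^sup>+X. ennreal (W r X) \<partial>measure_pmf \<pi>)"
      by (simp add: nn_integral_cmult)
    also have "(\<integral>\<^sup>+X. ennreal (W r X) \<partial>measure_pmf \<pi>) \<le> (\<integral>\<^sup>+X. ennreal (lyap_const * r) \<partial>measure_pmf \<pi>)"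
    proof (rule foster[OF st R, where f = "lyap r" and a = "lyap_arr r" and s = "\<lambda>i c. lyap_srv r i"
          and d = "\<lambda>i c. lyap_tok i"])
      show "0 \<le> r" using r by simp
      show "0 \<le> W r X" for X
        unfolding W_def using mu_pos mu0_pos by (intro sum_nonneg) (simp add: less_imp_le)
      show "0 \<le> lyap_const * r" using lc r by simp
    qed (use finite_lyap_sublevel lyap_arrival[OF R] lyap_service[OF R] lyap_token lyap_drift[OF r]
          in \<open>auto simp: sum_actual_rate sum_token_rate W_def order_eq_refl simp del: of_nat_mult\<close>)
    finally show "(\<integral>\<^sup>+X. ennreal ((fluctuation r X)\<^sup>2) \<partial>measure_pmf \<pi>)
        \<le> ennreal (K * lyap_const * r)"
      using K lc r by (simp add: ennreal_mult mult.assoc mult_left_mono)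
  qed
qed

subsection \<open>Drift of the objective\<close>

text \<open>
  The derivative \<open>x\<^sup>\<alpha>\<close> of the objective is truncated at \<open>3\<close>, so that increments of the potential are
  bounded and second moments suffice. Below the truncation level it orders placements as
  \<open>greedy_weight\<close> does, and states above that level are rare since \<open>x\<^sub>k\<close> is at most about \<open>1\<close>.
\<close>

definition psi :: "real \<Rightarrow> real" where
  "psi x = (min (max x 0) 3) powr \<alpha>"

definition psi_max :: real where
  "psi_max = 3 powr \<alpha>"

text \<open>The scaled and truncated counterpart of \<open>greedy_weight\<close>: the first-order
  cost in the objective of placing a type i item into a server in configuration
  \<open>k\<close>.\<close>

definition marginal :: "('i config \<Rightarrow> real) \<Rightarrow> 'i \<Rightarrow> 'i config \<Rightarrow> real" where
  "marginal x i k = psi (x (k + unit_config i)) - psi (x k)"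

text \<open>
  First-order gain of moving a type \<open>i\<close> item from \<open>k\<close> to \<open>m\<close>. The factor makes it vanish
  continuously where \<open>x\<^sub>m = 0\<close>, i.e. where \<open>m\<close> may be unavailable.
\<close>

definition loss :: "('i config \<Rightarrow> real) \<Rightarrow> 'i \<Rightarrow> 'i config \<Rightarrow> 'i config \<Rightarrow> real" where
  "loss x i k m = (if m = 0 then 1 else min 1 (x m)) *
     max 0 (marginal x i (k - unit_config i) - marginal x i m)"

text \<open>A discrete version of the objective, whose increments are exact values of \<open>psi\<close>.\<close>

definition potential :: "real \<Rightarrow> 'i state \<Rightarrow> real" where
  "potential r X = (\<Sum>k\<in>configs Kbar. \<Sum>j<cnt X k. psi (real (Suc j) / r))"

abbreviation scnt :: "real \<Rightarrow> 'i state \<Rightarrow> 'i config \<Rightarrow> real" where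
  "scnt r X \<equiv> scaled r (config_count Kbar X)"

lemma psi_nonneg: "psi x \<ge> 0" and psi_le_max: "psi x \<le> psi_max"
  and psi_0 [simp]: "psi 0 = 0" and psi_max_pos: "psi_max > 0"
  using \<alpha>_pos by (auto simp: psi_def psi_max_def intro!: powr_mono2)

lemma psi_mono: "x \<le> y \<Longrightarrow> psi x \<le> psi y"
  using \<alpha>_pos unfolding psi_def by (intro powr_mono2) auto

lemma psi_eq: "0 \<le> x \<Longrightarrow> x \<le> 3 \<Longrightarrow> psi x = x powr \<alpha>"
  by (simp add: psi_def)

lemma continuous_psi: "continuous_on A psi"
  unfolding psi_def using \<alpha>_pos by (intro continuous_on_powr' continuous_intros) auto

text \<open>Clamping to the compact interval from 0 to 3 does not change \<open>psi\<close>, so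
  uniform continuity there holds on the whole line. Increments to the right suffice because
  \<open>psi\<close> is monotone.\<close>

lemma psi_modulus:
  assumes "\<epsilon> > 0"
  shows "\<exists>\<delta>>0. \<forall>x h. 0 \<le> h \<longrightarrow> h < \<delta> \<longrightarrow> psi (x + h) - psi x \<le> \<epsilon>"
proof -
  define cl where "cl x = min (max x 0) (3::real)" for x
  have "uniformly_continuous_on {0..3} psi"
    by (intro compact_uniformly_continuous continuous_psi) auto
  then obtain \<delta> where d: "\<delta> > 0"
    "\<And>x y. x \<in> {0..3} \<Longrightarrow> y \<in> {0..3} \<Longrightarrow> dist y x < \<delta> \<Longrightarrow> dist (psi y) (psi x) < \<epsilon>"
    using assms unfolding uniformly_continuous_on_def by metis
  have "psi (x + h) - psi x \<le> \<epsilon>" if "0 \<le> h" "h < \<delta>" for x h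
  proof -
    have "psi (x + h) = psi (cl (x + h))" "psi x = psi (cl x)" by (auto simp: psi_def cl_def)
    moreover have "dist (psi (cl (x + h))) (psi (cl x)) < \<epsilon>"
      using that by (intro d) (auto simp: cl_def dist_real_def)
    ultimately show ?thesis by (simp add: dist_real_def)
  qed
  with d(1) show ?thesis by blast
qed

lemma marginal_bounds: "\<bar>marginal x i k\<bar> \<le> psi_max"
  using psi_nonneg[of "x k"] psi_nonneg[of "x (k + unit_config i)"]
    psi_le_max[of "x k"] psi_le_max[of "x (k + unit_config i)"]
  unfolding marginal_def by linarith

lemma loss_bounds:
  assumes "x m \<ge> 0"
  shows "0 \<le> loss x i k m" "loss x i k m \<le> (if m = 0 then 1 else min 1 (x m)) * (2 * psi_max)"
    "loss x i k m \<le> max 0 (marginal x i (k - unit_config i) - marginal x i m)"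
    "loss x i k m \<le> 2 * psi_max"
proof -
  let ?d = "max 0 (marginal x i (k - unit_config i) - marginal x i m)"
  have d: "0 \<le> ?d" "?d \<le> 2 * psi_max"
    using marginal_bounds[of x i "k - unit_config i"] marginal_bounds[of x i m] psi_max_pos by auto
  have t: "0 \<le> (if m = 0 then 1 else min 1 (x m))" "(if m = 0 then 1 else min 1 (x m)) \<le> 1"
    using assms by auto
  show "0 \<le> loss x i k m" unfolding loss_def by (rule mult_nonneg_nonneg[OF t(1) d(1)])
  show "loss x i k m \<le> (if m = 0 then 1 else min 1 (x m)) * (2 * psi_max)"
    unfolding loss_def by (rule mult_left_mono[OF d(2) t(1)])
  show *: "loss x i k m \<le> ?d" unfolding loss_def by (rule mult_left_le_one_le[OF d(1) t])
  show "loss x i k m \<le> 2 * psi_max" using * d(2) by linarith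
qed

lemma potential_nonneg: "potential r X \<ge> 0"
  unfolding potential_def by (intro sum_nonneg psi_nonneg)

text \<open>The partial sum for \<open>fst c\<close> loses its last term, whose argument is the old
  count; the one for \<open>fst c'\<close> gains a term, whose argument is the new count. Empty
  servers fit in since their count is 0 and \<open>psi 0 = 0\<close>.\<close>

lemma potential_shift:
  assumes v: "valid_shift c c' X" and ne: "fst c \<noteq> fst c'"
  shows "potential r (shift c c' X)
    = potential r X - psi (scnt r X (fst c)) + psi (scnt r (shift c c' X) (fst c'))"
proof -
  let ?Y = "shift c c' X" and ?S = "\<lambda>n. \<Sum>j<n. psi (real (Suc j) / r)"
  have X: "X \<in> states Kbar" using v by (simp add: valid_shift_def)
  have "potential r ?Y = (\<Sum>k\<in>configs Kbar. ?S (cnt X k)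
      - (if k = fst c then psi (scnt r X (fst c)) else 0) + (if k = fst c' then psi (scnt r ?Y (fst c')) else 0))"
    unfolding potential_def
  proof (intro sum.cong refl)
    fix k assume "k \<in> configs Kbar"
    then have k: "k \<noteq> 0" by auto
    note ch = cnt_shift[OF v k]
    show "?S (cnt ?Y k) = ?S (cnt X k)
      - (if k = fst c then psi (scnt r X (fst c)) else 0) + (if k = fst c' then psi (scnt r ?Y (fst c')) else 0)"
    proof (cases "k = fst c")
      case True
      then have "real (cnt X k) = real (cnt ?Y k) + 1" using ch ne by simp
      then have "cnt X k = Suc (cnt ?Y k)" by linarith
      then show ?thesis using True ne by (simp add: scaled_def)
    next
      case False
      show ?thesis
      proof (cases "k = fst c'")
        case True
        then have "real (cnt ?Y k) = real (cnt X k) + 1" using ch ne by simp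
        then have "cnt ?Y k = Suc (cnt X k)" by linarith
        then show ?thesis using True ne by (simp add: scaled_def)
      next
        case F2: False
        then have "cnt ?Y k = cnt X k" using ch False by simp
        then show ?thesis using False F2 by simp
      qed
    qed
  qed
  also have "\<dots> = potential r X - (if fst c \<in> configs Kbar then psi (scnt r X (fst c)) else 0)
      + (if fst c' \<in> configs Kbar then psi (scnt r ?Y (fst c')) else 0)"
    using finite_configs by (simp add: sum.distrib sum_subtractf potential_def)
  also have "(if fst c \<in> configs Kbar then psi (scnt r X (fst c)) else 0) = psi (scnt r X (fst c))"
    by (simp add: scaled_def config_count_def)
  also have "(if fst c' \<in> configs Kbar then psi (scnt r ?Y (fst c')) else 0) = psi (scnt r ?Y (fst c'))"
    by (simp add: scaled_def config_count_def)
  finally show ?thesis .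
qed

lemma potential_shift_same:
  assumes v: "valid_shift c c' X" and "fst c = fst c'"
  shows "potential r (shift c c' X) = potential r X"
proof -
  have "cnt (shift c c' X) k = cnt X k" for k
    using cnt_shift[OF v, of k] assms(2) by (cases "k = 0") auto
  then show ?thesis by (simp add: potential_def)
qed

lemma potential_shift_le:
  assumes v: "valid_shift c c' X"
  shows "potential r (shift c c' X) - potential r X \<le> psi_max"
proof (cases "fst c = fst c'")
  case True
  then show ?thesis using psi_max_pos potential_shift_same[OF v] by simp
next
  case False
  then show ?thesis
    using potential_shift[OF v False] psi_nonneg[of "scnt r X (fst c)"]
      psi_le_max[of "scnt r (shift c c' X) (fst c')"] by simp
qed

text \<open>Replacing a token changes only the second component of a complete configuration, which
  the counts do not see.\<close>

lemma potential_arrival: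
  assumes "greedy_dm_rules Kbar \<alpha> R" "X \<in> states Kbar" "Y \<in> set_pmf (arrival R X i)"
  shows "potential r Y - potential r X \<le> (if tokens i X > 0 then 0 else psi_max)"
proof -
  obtain c c' where *: "valid_shift c c' X" "Y = shift c c' X"
    "if tokens i X > 0 then fst c' = fst c \<and> snd c i < fst c i
     else fst c' = fst c + unit_config i \<and> snd c \<le> fst c"
    using arrival_cases[OF assms] by metis
  show ?thesis
  proof (cases "tokens i X > 0")
    case True
    then show ?thesis using potential_shift_same[OF *(1), of r] *(2,3) by simp
  next
    case False
    then show ?thesis using potential_shift_le[OF *(1), of r] *(2) by simp
  qed
qed

lemma potential_token:
  assumes "X \<in> states Kbar" "X c > 0" "snd c i < fst c i" "Y \<in> set_pmf (token_completion X i c)"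
  shows "potential r Y - potential r X \<le> psi_max"
  using token_completion_cases[OF assms] potential_shift_le by metis

lemma potential_service_le:
  assumes "greedy_dm_rules Kbar \<alpha> R" "X \<in> states Kbar" "X c > 0" "snd c i > 0"
    "Y \<in> set_pmf (service_completion R X i c)"
  shows "potential r Y - potential r X \<le> 2 * psi_max"
proof -
  obtain c1 X' kh where *: "X' = shift c c1 X" "valid_shift c c1 X"
    "valid_shift (tie_break R X' i, kh) (tie_break R X' i + unit_config i, kh) X'"
    "Y = shift (tie_break R X' i, kh) (tie_break R X' i + unit_config i, kh) X'"
    using service_cases[OF assms] by metis
  show ?thesis
    using potential_shift_le[OF *(2), of r] potential_shift_le[OF *(3), of r] *(1,4) by simp
qed

text \<open>Below the truncation level the two differ by a positive factor common to all places, so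
  the greedy choice also minimizes \<open>marginal\<close>.\<close>

lemma marginal_eq_greedy_weight:
  assumes "r > 0" and "\<And>k. real (cnt X k) \<le> 3 * r"
  shows "marginal (scnt r X) i k = greedy_weight Kbar \<alpha> X i k / r powr \<alpha>"
proof -
  have p: "psi (scnt r X k) = real (cnt X k) powr \<alpha> / r powr \<alpha>" for k
    using assms(1) assms(2)[of k] by (simp add: scaled_def psi_eq field_simps powr_divide)
  show ?thesis
    unfolding marginal_def greedy_weight_def p by (auto simp: diff_divide_distrib)
qed

text \<open>The increment is the marginal cost at the chosen place minus that at the place left,
  both in \<open>X'\<close>. Comparison with the place left bounds it by \<open>\<omega>\<close>;
  comparison with \<open>m\<close> brings in the gain. The \<open>+ 1\<close> in \<open>good\<close>
  leaves room for the additional server in \<open>X'\<close>.\<close>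

lemma potential_service_good:
  assumes R: "greedy_dm_rules Kbar \<alpha> R" and X: "X \<in> states Kbar" and c: "X c > 0" "snd c i > 0"
    and Y: "Y \<in> set_pmf (service_completion R X i c)"
    and r: "r > 0" and \<omega>: "\<And>x. psi (x + 1 / r) - psi x \<le> \<omega>"
    and good: "\<And>k. real (cnt X k) + 1 \<le> 3 * r"
    and m: "m \<in> Kbar" "m + unit_config i \<in> configs Kbar"
  shows "potential r Y - potential r X \<le> 5 * \<omega> + 2 * psi_max / r - loss (scnt r X) i (fst c) m"
proof -
  obtain c1 X' kh where *: "c1 = (fst c - unit_config i, snd c - unit_config i)" "X' = shift c c1 X"
    "valid_shift c c1 X"
    "valid_shift (tie_break R X' i, kh) (tie_break R X' i + unit_config i, kh) X'"
    "kh \<le> tie_break R X' i"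
    "Y = shift (tie_break R X' i, kh) (tie_break R X' i + unit_config i, kh) X'"
    using service_cases[OF R X c Y] .
  define t where "t = tie_break R X' i"
  define k1 where "k1 = fst c - unit_config i"
  have X': "X' \<in> states Kbar" using *(2,3) shift_states by simp
  note cc = cconfigsD[OF in_cconfigs_if_pos[OF X c(1)]]
  have "fst c i > 0" using cc(2) c(2) by (metis le_funD less_le_trans)
  then have k1: "fst c = k1 + unit_config i" unfolding k1_def by (simp add: sub_unit_add)
  have fc1: "fst c1 = k1" by (simp add: *(1) k1_def)
  have near: "\<bar>real (cnt X' k) - real (cnt X k)\<bar> \<le> 1" for k
    using cnt_shift[OF *(3), of k] *(2) by (cases "k = 0") auto
  have up: "scnt r X (fst c) = scnt r X' (fst c) + 1 / r"
    using cnt_shift[OF *(3), of "fst c"] cc(3) *(2) r k1 fc1 by (simp add: scaled_def field_simps)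
  have Yup: "scnt r Y (t + unit_config i) = scnt r X' (t + unit_config i) + 1 / r"
    using cnt_shift[OF *(4), of "t + unit_config i"] r
    by (simp add: *(6) t_def scaled_def field_simps)
  have \<omega>0: "\<omega> \<ge> 0" using \<omega>[of 0] psi_nonneg[of "0 + 1 / r"] by simp
  have "potential r Y - potential r X
      = (psi (scnt r X' (t + unit_config i) + 1 / r) - psi (scnt r X' t))
        - (psi (scnt r X' (fst c) + 1 / r) - psi (scnt r X' k1))"
    using potential_shift[OF *(3), of r] potential_shift[OF *(4)[folded t_def], of r] k1 fc1 up Yup
    by (simp add: *(2)[symmetric] *(6)[folded t_def, symmetric])
  also have "\<dots> \<le> \<omega> + marginal (scnt r X') i t - marginal (scnt r X') i k1"
    using \<omega>[of "scnt r X' (t + unit_config i)"] psi_mono[of "scnt r X' (fst c)" "scnt r X' (fst c) + 1 / r"] r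
    by (simp add: marginal_def k1)
  finally have le: "potential r Y - potential r X
      \<le> \<omega> + marginal (scnt r X') i t - marginal (scnt r X') i k1" .
  have good': "real (cnt X' k) \<le> 3 * r" for k using near[of k] good[of k] by linarith
  have tmin: "marginal (scnt r X') i t \<le> marginal (scnt r X') i q" if "q \<in> available Kbar X' i" for q
  proof -
    have "is_arg_min (greedy_weight Kbar \<alpha> X' i) (\<lambda>k. k \<in> available Kbar X' i) t"
      using R X' unfolding greedy_dm_rules_def t_def by blast
    then have "greedy_weight Kbar \<alpha> X' i t \<le> greedy_weight Kbar \<alpha> X' i q"
      using that unfolding is_arg_min_def by (meson not_less)
    then show ?thesis
      unfolding marginal_eq_greedy_weight[OF r good'] by (intro divide_right_mono) auto
  qed
  have psi_near: "\<bar>psi (scnt r X' k) - psi (scnt r X k)\<bar> \<le> \<omega>" for k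
  proof -
    have "scnt r X' k \<le> scnt r X k + 1 / r" "scnt r X k \<le> scnt r X' k + 1 / r"
      using near[of k] r by (auto simp: scaled_def field_simps)
    from this[THEN psi_mono] show ?thesis
      using \<omega>[of "scnt r X k"] \<omega>[of "scnt r X' k"] by linarith
  qed
  have mnear: "\<bar>marginal (scnt r X') i k - marginal (scnt r X) i k\<bar> \<le> 2 * \<omega>" for k
    using psi_near[of k] psi_near[of "k + unit_config i"] unfolding marginal_def by linarith
  have k1av: "k1 \<in> available Kbar X' i"
  proof -
    have "k1 \<in> Kbar" using Kbar_down[of "fst c" k1] cc(1) by (auto simp: configs_def k1_def le_fun_def)
    moreover have "cnt X' k1 > 0" if "k1 \<noteq> 0"
      using cnt_shift[OF *(3) that] *(2) fc1 k1 by auto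
    ultimately show ?thesis using cc(1) k1 by (cases "k1 = 0") (simp_all add: available_def)
  qed
  have small: "potential r Y - potential r X \<le> \<omega>" using le tmin[OF k1av] by linarith
  have xm: "scnt r X m \<ge> 0" using r by (simp add: scaled_def)
  show ?thesis
  proof (cases "m \<in> available Kbar X' i")
    case True
    \<comment> \<open>One \<open>\<omega>\<close> is already in \<open>le\<close>; each of the two
      marginals costs \<open>2 * \<omega>\<close> when \<open>X'\<close> is replaced by
      \<open>X\<close>.\<close>
    have "potential r Y - potential r X \<le> 5 * \<omega> - (marginal (scnt r X) i k1 - marginal (scnt r X) i m)"
      using le tmin[OF True] mnear[of m] mnear[of k1] by linarith
    then have "potential r Y - potential r X \<le> 5 * \<omega> - max 0 (marginal (scnt r X) i k1 - marginal (scnt r X) i m)"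
      using small \<omega>0 by linarith
    moreover have "2 * psi_max / r \<ge> 0" using psi_max_pos r by simp
    ultimately show ?thesis
      using loss_bounds(3)[of "scnt r X" m i "fst c", OF xm] unfolding k1_def[symmetric] by linarith
  next
    case False
    then have m0: "m \<noteq> 0" "cnt X' m = 0" using m by (auto simp: available_def)
    then have "real (cnt X m) \<le> 1" using near[of m] by simp
    then have "scnt r X m \<le> 1 / r" using r by (simp add: scaled_def divide_right_mono)
    then have "(if m = 0 then 1 else min 1 (scnt r X m)) * (2 * psi_max) \<le> 1 / r * (2 * psi_max)"
      using m0 psi_max_pos by (intro mult_right_mono) auto
    then have "loss (scnt r X) i (fst c) m \<le> 2 * psi_max / r"
      using loss_bounds(2)[of "scnt r X" m i "fst c", OF xm] by simp
    then show ?thesis using small \<omega>0 by linarith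
  qed
qed


text \<open>The token term is unbounded below, but by Young's inequality half of
  \<open>lyap r X / r\<close> dominates it up to a constant depending on \<open>r\<close>. This is
  why the Lyapunov function is added to the test function; scaled by \<open>1 / r\<close>, it adds
  at most \<open>lyap_const\<close> to the drift.\<close>

lemma finite_tilted_sublevel:
  assumes r: "r > 0"
  shows "finite {X \<in> states Kbar. potential r X - psi_max * (\<Sum>i\<in>UNIV. tokens i X) + lyap r X / r < N}"
proof -
  define b where "b = 2 * r * (N + real CARD('i) * (psi_max\<^sup>2 * r / 2))"
  have "lyap r X < b"
    if "potential r X - psi_max * (\<Sum>i\<in>UNIV. tokens i X) + lyap r X / r < N" for X
  proof -
    have "psi_max * (\<Sum>i\<in>UNIV. tokens i X)
        \<le> (\<Sum>i\<in>(UNIV :: 'i set). (tokens i X)\<^sup>2 / (2 * r) + psi_max\<^sup>2 * r / 2)"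
      unfolding sum_distrib_left
    proof (intro sum_mono)
      fix i
      have "0 \<le> (tokens i X - psi_max * r)\<^sup>2 / (2 * r)" using r by simp
      also have "\<dots> = (tokens i X)\<^sup>2 / (2 * r) + psi_max\<^sup>2 * r / 2 - psi_max * tokens i X"
        using r by (simp add: power2_eq_square field_simps)
      finally show "psi_max * tokens i X \<le> (tokens i X)\<^sup>2 / (2 * r) + psi_max\<^sup>2 * r / 2" by simp
    qed
    also have "\<dots> = (\<Sum>i\<in>UNIV. (tokens i X)\<^sup>2) / (2 * r) + real CARD('i) * (psi_max\<^sup>2 * r / 2)"
      by (simp add: sum.distrib sum_divide_distrib)
    also have "(\<Sum>i\<in>UNIV. (tokens i X)\<^sup>2) \<le> lyap r X"
      unfolding lyap_def using mu_pos mu0_pos by (intro sum_mono) (simp add: less_imp_le)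
    finally have "psi_max * (\<Sum>i\<in>UNIV. tokens i X)
        \<le> lyap r X / (2 * r) + real CARD('i) * (psi_max\<^sup>2 * r / 2)"
      using r by (simp add: divide_right_mono)
    moreover have "lyap r X / r = lyap r X / (2 * r) + lyap r X / (2 * r)" using r by (simp add: field_simps)
    ultimately have "lyap r X / (2 * r) < N + real CARD('i) * (psi_max\<^sup>2 * r / 2)"
      using that potential_nonneg[of r X] by linarith
    then show ?thesis using r by (simp add: b_def field_simps)
  qed
  then show ?thesis by (intro finite_subset[OF _ finite_lyap_sublevel[of r b]]) auto
qed

lemma \<rho>_pos: "\<rho> i > 0"
  using lam_pos mu_pos by (simp add: \<rho>_eq)

lemma \<rho>_le_1: "\<rho> i \<le> 1"
  using sum_\<rho> member_le_sum[of i UNIV \<rho>] \<rho>_pos by (simp add: less_imp_le)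

lemma fluctuation_ge:
  shows "\<bar>dev r i X\<bar> + tokens i X \<le> fluctuation r X" "\<bar>dev r i X\<bar> \<le> fluctuation r X"
    "tokens i X \<le> fluctuation r X" "fluctuation r X \<ge> 0"
proof -
  show 1: "\<bar>dev r i X\<bar> + tokens i X \<le> fluctuation r X"
    unfolding fluctuation_def using tokens_nonneg by (intro member_le_sum) auto
  then show "\<bar>dev r i X\<bar> \<le> fluctuation r X" "tokens i X \<le> fluctuation r X" "fluctuation r X \<ge> 0"
    using tokens_nonneg[of i X] by linarith+
qed

lemma actuals_le: "r \<ge> 0 \<Longrightarrow> actuals i X \<le> r + fluctuation r X"
  using fluctuation_ge(2)[of r i X] \<rho>_le_1[of i] mult_right_mono[of "\<rho> i" 1 r]
  unfolding dev_def by linarith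

text \<open>The nominal loads \<open>\<rho> i * r\<close> add up to \<open>r\<close>, and the rest
  is the fluctuation.\<close>

lemma cnt_le_fluctuation:
  assumes "X \<in> states Kbar"
  shows "real (cnt X k) \<le> r + fluctuation r X"
proof -
  have "real (cnt X k) \<le> (\<Sum>i\<in>UNIV. actuals i X + tokens i X)" by (rule cnt_le_total[OF assms])
  also have "\<dots> \<le> (\<Sum>i\<in>UNIV. \<rho> i * r + (\<bar>dev r i X\<bar> + tokens i X))"
    by (intro sum_mono) (auto simp: dev_def)
  also have "\<dots> = r + fluctuation r X"
    by (simp add: sum.distrib sum_\<rho> fluctuation_def flip: sum_distrib_right)
  finally show ?thesis .
qed

text \<open>Only departures of actual customers are followed by a placement, so the gain from
  configuration \<open>k\<close> is proportional to the actual customers in it. They are all its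
  items except for tokens, of which there are at most \<open>tokens i X\<close>.\<close>

lemma actuals_in_config:
  assumes X: "X \<in> states Kbar"
  shows "real (k i) * real (cnt X k) - tokens i X
    \<le> (\<Sum>c\<in>cconfigs Kbar. if fst c = k then real (snd c i * X c) else 0)"
proof -
  have "real (k i) * real (cnt X k) - tokens i X = (\<Sum>c\<in>cconfigs Kbar.
      real (k i) * ((if fst c = k then 1 else 0) * real (X c)) - real (fst c i - snd c i) * real (X c))"
    unfolding cnt_eq_total[OF X] tokens_def total_def by (simp add: sum_subtractf sum_distrib_left)
  also have "\<dots> \<le> (\<Sum>c\<in>cconfigs Kbar. if fst c = k then real (snd c i * X c) else 0)"
  proof (intro sum_mono)
    fix c assume "c \<in> cconfigs Kbar"
    then have "snd c i \<le> fst c i" using cconfigsD by (auto simp: le_fun_def)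
    then show "real (k i) * ((if fst c = k then 1 else 0) * real (X c)) - real (fst c i - snd c i) * real (X c)
        \<le> (if fst c = k then real (snd c i * X c) else 0)"
      by (auto simp: of_nat_diff algebra_simps mult_left_mono)
  qed
  finally show ?thesis .
qed

text \<open>Every completion is charged \<open>e\<close>, and those of type \<open>i0\<close> in
  configuration \<open>k0\<close> are credited \<open>x\<close>. Their rate falls short of
  \<open>mu i0 * k0 i0 * cnt X k0\<close> by at most the tokens, whence the middle error
  term.\<close>

lemma service_bound_sum:
  fixes i0 :: 'i
  assumes X: "X \<in> states Kbar" and r: "r \<ge> 1" and e: "e \<ge> 0" and x: "0 \<le> x" "x \<le> 2 * psi_max"
  shows "(\<Sum>i\<in>UNIV. \<Sum>c\<in>cconfigs Kbar. mu i * real (snd c i * X c) *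
       (e - (if i = i0 \<and> fst c = k0 then x else 0)))
    \<le> (\<Sum>i\<in>UNIV. mu i) * (r + fluctuation r X) * e + 2 * mu i0 * psi_max * fluctuation r X
       - mu i0 * real (k0 i0) * real (cnt X k0) * x"
proof -
  let ?S = "\<Sum>c\<in>cconfigs Kbar. if fst c = k0 then real (snd c i0 * X c) else 0"
  have "(\<Sum>i\<in>UNIV. \<Sum>c\<in>cconfigs Kbar. mu i * real (snd c i * X c) *
       (e - (if i = i0 \<and> fst c = k0 then x else 0)))
    = (\<Sum>i\<in>UNIV. mu i * actuals i X * e - (if i = i0 then mu i0 * ?S * x else 0))"
  proof (intro sum.cong refl)
    fix i
    have "(\<Sum>c\<in>cconfigs Kbar. mu i * real (snd c i * X c) * (e - (if i = i0 \<and> fst c = k0 then x else 0)))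
      = (\<Sum>c\<in>cconfigs Kbar. mu i * real (snd c i * X c) * e) -
        (\<Sum>c\<in>cconfigs Kbar. (if i = i0 then mu i0 * (if fst c = k0 then real (snd c i0 * X c) else 0) * x else 0))"
      unfolding sum_subtractf[symmetric] by (intro sum.cong refl) (auto simp: algebra_simps)
    also have "(\<Sum>c\<in>cconfigs Kbar. (if i = i0 then mu i0 * (if fst c = k0 then real (snd c i0 * X c) else 0) * x else 0))
       = (if i = i0 then mu i0 * ?S * x else 0)"
      by (simp add: sum_distrib_left sum_distrib_right)
    finally show "(\<Sum>c\<in>cconfigs Kbar. mu i * real (snd c i * X c) * (e - (if i = i0 \<and> fst c = k0 then x else 0)))
      = mu i * actuals i X * e - (if i = i0 then mu i0 * ?S * x else 0)"
      by (simp only: sum_actual_rate)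
  qed
  also have "\<dots> = (\<Sum>i\<in>UNIV. mu i * actuals i X * e) - mu i0 * ?S * x"
    by (simp add: sum_subtractf)
  also have "(\<Sum>i\<in>UNIV. mu i * actuals i X * e) \<le> (\<Sum>i\<in>UNIV. mu i * (r + fluctuation r X) * e)"
    using actuals_le[of r _ X] mu_pos r e
    by (intro sum_mono mult_right_mono mult_left_mono) (auto simp: less_imp_le)
  also have "\<dots> = (\<Sum>i\<in>UNIV. mu i) * (r + fluctuation r X) * e"
    by (simp add: sum_distrib_right)
  finally have 1: "(\<Sum>i\<in>UNIV. \<Sum>c\<in>cconfigs Kbar. mu i * real (snd c i * X c) *
       (e - (if i = i0 \<and> fst c = k0 then x else 0)))
    \<le> (\<Sum>i\<in>UNIV. mu i) * (r + fluctuation r X) * e - mu i0 * ?S * x" by simp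
  have "mu i0 * (real (k0 i0) * real (cnt X k0) - tokens i0 X) * x \<le> mu i0 * ?S * x"
    using mu_pos[of i0] x actuals_in_config[OF X, of k0 i0]
    by (intro mult_right_mono mult_left_mono) auto
  moreover have "mu i0 * tokens i0 X * x \<le> mu i0 * fluctuation r X * (2 * psi_max)"
    using mu_pos[of i0] x fluctuation_ge(3)[where i = i0 and r = r and X = X]
      fluctuation_ge(4)[where r = r and X = X] tokens_nonneg[of i0 X]
    by (intro mult_mono) auto
  ultimately have "mu i0 * real (k0 i0) * real (cnt X k0) * x - 2 * mu i0 * psi_max * fluctuation r X \<le> mu i0 * ?S * x"
    by (simp add: algebra_simps)
  with 1 show ?thesis by linarith
qed


text \<open>\<open>foster\<close> is applied to the tilted potential. Its drift contains the
  rate-weighted loss with a negative sign and is otherwise at most \<open>B\<close>, whose mean is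
  of order \<open>\<omega> * r + sqrt r\<close>; division by \<open>mu i0 * r\<close> gives the
  claim.\<close>

lemma loss_moment_bound:
  assumes k0: "k0 \<in> configs Kbar" and m0: "m0 \<in> Kbar" "m0 + unit_config i0 \<in> configs Kbar"
  shows "\<exists>C\<ge>0. \<forall>R r \<pi> \<omega>. greedy_dm_rules Kbar \<alpha> R \<longrightarrow> r \<ge> 1 \<longrightarrow>
    stationary_distribution (states Kbar) (rate_matrix Kbar lam mu mu0 R r) \<pi> \<longrightarrow>
    (\<forall>x. psi (x + 1 / r) - psi x \<le> \<omega>) \<longrightarrow> \<omega> \<le> psi_max \<longrightarrow>
    (\<integral>\<^sup>+X. ennreal (real (k0 i0) * scnt r X k0 * loss (scnt r X) i0 k0 m0) \<partial>measure_pmf \<pi>)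
      \<le> ennreal (C * (\<omega> + 1 / sqrt r))"
proof -
  obtain C2 where C2: "C2 \<ge> 0" and sm: "\<And>R r \<pi>. greedy_dm_rules Kbar \<alpha> R \<Longrightarrow> r \<ge> 1 \<Longrightarrow>
    stationary_distribution (states Kbar) (rate_matrix Kbar lam mu mu0 R r) \<pi> \<Longrightarrow>
    (\<integral>\<^sup>+X. ennreal ((fluctuation r X)\<^sup>2) \<partial>measure_pmf \<pi>) \<le> ennreal (C2 * r)"
    using second_moment_bound by blast
  define Km where "Km = (\<Sum>i\<in>UNIV. mu i) + 2 * mu0"
  have sum_mu: "(\<Sum>i\<in>UNIV. mu i) \<ge> 0" using mu_pos by (intro sum_nonneg) (simp add: less_imp_le)
  then have Km: "Km > 0" "(\<Sum>i\<in>UNIV. mu i) \<le> Km" "2 * mu0 \<le> Km" using mu0_pos by (auto simp: Km_def)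
  have mu_le: "mu i \<le> Km" for i
    using member_le_sum[of i UNIV mu] mu_pos Km(2) by (auto simp: less_imp_le intro: order_trans)
  define M where "M = psi_max"
  have M: "M > 0" using psi_max_pos by (simp add: M_def)
  have lc: "lyap_const \<ge> 0"
    unfolding lyap_const_def using mu_pos lam_pos mu0_pos
    by (intro sum_nonneg) (simp add: less_imp_le add_nonneg_nonneg)
  \<comment> \<open>The factor 10 is 7 + 2 + 1: the bound \<open>7 * M\<close> on
    \<open>\<eta>\<close>, the tokens in \<open>service_bound_sum\<close>, and the imbalance
    \<open>T\<close>.\<close>
  define q where "q = 10 * M * Km"
  have q: "q \<ge> 0" using M Km by (simp add: q_def)
  define C' where "C' = lyap_const + 5 * Km + 2 * M * Km + q * (1 + C2) / 2 + 8 * M * Km * C2"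
  have C': "C' \<ge> 0" unfolding C'_def using lc Km M q C2 by (intro add_nonneg_nonneg) simp_all
  show ?thesis
  proof (intro exI[of _ "C' / mu i0"] conjI allI impI)
    show "C' / mu i0 \<ge> 0" using C' mu_pos[of i0] by simp
  next
    fix R r \<pi> \<omega>
    assume R: "greedy_dm_rules Kbar \<alpha> R" and r: "r \<ge> (1::real)"
      and st: "stationary_distribution (states Kbar) (rate_matrix Kbar lam mu mu0 R r) \<pi>"
      and \<omega>A: "\<forall>x. psi (x + 1 / r) - psi x \<le> \<omega>" and \<omega>M: "\<omega> \<le> psi_max"
    have \<omega>: "psi (x + 1 / r) - psi x \<le> \<omega>" for x using \<omega>A by blast
    have \<omega>0: "\<omega> \<ge> 0" using \<omega>[of 0] psi_nonneg[of "0 + 1 / r"] by simp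
    define h where "h X = loss (scnt r X) i0 k0 m0" for X
    have h: "0 \<le> h X" "h X \<le> 2 * M" for X
      using loss_bounds(1,4)[of "scnt r X" m0 i0 k0] r by (auto simp: h_def M_def scaled_def)
    define \<eta> where "\<eta> = 5 * \<omega> + 2 * M / r"
    have "2 * M / r \<le> 2 * M" "2 * M / r \<ge> 0"
      using r M by (auto simp: divide_le_eq mult_le_cancel_left1)
    then have \<eta>: "\<eta> \<ge> 0" "\<eta> \<le> 7 * M" using \<omega>0 \<omega>M unfolding \<eta>_def M_def by linarith+
    \<comment> \<open>When the fluctuation reaches \<open>r\<close>, truncation may spoil the greedy
      comparison. Then \<open>4 * M\<close> covers the crude increment \<open>2 * M\<close> and the
      subtracted \<open>h X \<le> 2 * M\<close>.\<close>
    define e where "e X = \<eta> + (if r \<le> fluctuation r X then 4 * M else 0)" for X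
    have e: "e X \<ge> 0" for X using \<eta> M by (auto simp: e_def)
    define W where "W X = mu i0 * real (k0 i0) * real (cnt X k0) * h X" for X
    define B where "B X = lyap_const + \<eta> * Km * r + q * fluctuation r X
      + 8 * M * Km * (fluctuation r X)\<^sup>2 / r" for X
    have W0: "W X \<ge> 0" for X using mu_pos[of i0] h by (simp add: W_def)
    have B0: "B X \<ge> 0" for X
      unfolding B_def using lc \<eta> Km r q M fluctuation_ge(4)[of r X] by (intro add_nonneg_nonneg) simp_all
    \<comment> \<open>An arrival raises the potential only when there is no token of its type; otherwise it uses
      one up. The token term charges both cases alike, at a rate balanced by that of new tokens.\<close>
    define f where "f X = potential r X - psi_max * (\<Sum>i\<in>UNIV. tokens i X) + lyap r X / r" for X
    define E where "E i c X = e X - (if i = i0 \<and> fst c = k0 then h X else 0)" for i and c :: "'i cconfig" and X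
    have tok_sum: "(\<Sum>j\<in>UNIV. tokens j Y) = (\<Sum>j\<in>UNIV. tokens j X) + v"
      if "\<And>j. tokens j Y = tokens j X + (if j = i then v else 0)" for Y X i v
      unfolding that by (simp add: sum.distrib)
    have main: "(\<integral>\<^sup>+X. ennreal (W X) \<partial>measure_pmf \<pi>) \<le> (\<integral>\<^sup>+X. ennreal (B X) \<partial>measure_pmf \<pi>)"
    proof (rule foster[OF st R, where f = f and a = "\<lambda>i X. M + lyap_arr r i X / r"
          and s = "\<lambda>i c X. E i c X - M + lyap_srv r i X / r" and d = "\<lambda>i c X. 2 * M + lyap_tok i X / r"])
      show "0 \<le> r" using r by simp
      show "finite {X \<in> states Kbar. f X < N}" for N
        unfolding f_def using r by (intro finite_tilted_sublevel) simp
    next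
      fix X i Y assume X: "X \<in> states Kbar" and Y: "Y \<in> set_pmf (arrival R X i)"
      have "(\<Sum>j\<in>UNIV. tokens j Y) = (\<Sum>j\<in>UNIV. tokens j X) + (if tokens i X > 0 then - 1 else 0)"
        by (rule tok_sum[of Y X i]) (simp add: arrival_counts[OF R X Y])
      moreover have "(lyap r Y - lyap r X) / r \<le> lyap_arr r i X / r"
        using lyap_arrival[OF R X Y] r by (intro divide_right_mono) auto
      ultimately show "f Y - f X \<le> M + lyap_arr r i X / r"
        using potential_arrival[OF R X Y, of r]
        by (auto simp: f_def M_def diff_divide_distrib algebra_simps split: if_splits)
    next
      fix X i c Y assume X: "X \<in> states Kbar" and c: "X c > 0" "snd c i > 0"
        and Y: "Y \<in> set_pmf (service_completion R X i c)"
      have "(\<Sum>j\<in>UNIV. tokens j Y) = (\<Sum>j\<in>UNIV. tokens j X) + 1"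
        by (rule tok_sum[of Y X i]) (simp add: service_counts[OF R X c Y])
      moreover have "potential r Y - potential r X \<le> E i c X"
      proof (cases "r \<le> fluctuation r X")
        case True
        then show ?thesis
          using potential_service_le[OF R X c Y, of r] h[of X] \<eta>(1) M unfolding E_def e_def M_def by auto
      next
        case False
        \<comment> \<open>The count plus one is at most \<open>r + fluctuation r X + 1\<close>,
          which is below \<open>2 * r + 1\<close> and so at most \<open>3 * r\<close>: hence the
          truncation level 3.\<close>
        have good: "real (cnt X k) + 1 \<le> 3 * r" for k
          using cnt_le_fluctuation[OF X, of k r] False r by linarith
        have r0: "r > 0" using r by simp
        note g = potential_service_good[OF R X c Y r0 \<omega> good]
        show ?thesis
        proof (cases "i = i0 \<and> fst c = k0")
          case True
          then show ?thesis
            using g[of m0] m0 False by (simp add: E_def e_def h_def \<eta>_def M_def)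
        next
          case F: False
          have "potential r Y - potential r X \<le> 5 * \<omega> + 2 * psi_max / r - loss (scnt r X) i (fst c) 0"
            using zero_in_Kbar unit_in_configs by (intro g) auto
          moreover have "loss (scnt r X) i (fst c) 0 \<ge> 0"
            using loss_bounds(1)[of "scnt r X" 0 i "fst c"] r by (simp add: scaled_def)
          ultimately show ?thesis using F False by (auto simp: E_def e_def \<eta>_def M_def)
        qed
      qed
      ultimately show "f Y - f X \<le> E i c X - M + lyap_srv r i X / r"
        using lyap_service[OF R X c Y, of r]
        by (simp add: f_def M_def diff_divide_distrib[symmetric] algebra_simps)
          (simp add: add_divide_distrib[symmetric])
    next
      fix X i c Y assume X: "X \<in> states Kbar" and c: "X c > 0" "snd c i < fst c i"
        and Y: "Y \<in> set_pmf (token_completion X i c)"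
      have "(\<Sum>j\<in>UNIV. tokens j Y) = (\<Sum>j\<in>UNIV. tokens j X) + (- 1)"
        by (rule tok_sum[of Y X i]) (simp add: token_completion_counts[OF X c Y])
      then have "(\<Sum>j\<in>UNIV. tokens j X) = (\<Sum>j\<in>UNIV. tokens j Y) + 1" by simp
      moreover have "lyap r Y / r - lyap r X / r = lyap_tok i X / r"
        using lyap_token[OF X c Y, of r] by (simp add: diff_divide_distrib[symmetric])
      ultimately show "f Y - f X \<le> 2 * M + lyap_tok i X / r"
        using potential_token[OF X c Y, of r] by (simp add: f_def M_def algebra_simps)
    next
      fix X assume X: "X \<in> states Kbar"
      let ?fl = "fluctuation r X"
      have fl: "?fl \<ge> 0" by (rule fluctuation_ge(4))
      have S1: "(\<Sum>i\<in>UNIV. lam i * r * (M + lyap_arr r i X / r))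
          = (\<Sum>i\<in>UNIV. lam i * r * M) + (\<Sum>i\<in>UNIV. lam i * r * lyap_arr r i X) / r"
        by (simp add: algebra_simps sum.distrib sum_divide_distrib)
      have S2: "(\<Sum>i\<in>UNIV. \<Sum>c\<in>cconfigs Kbar. mu i * real (snd c i * X c) * (E i c X - M + lyap_srv r i X / r))
          = (\<Sum>i\<in>UNIV. \<Sum>c\<in>cconfigs Kbar. mu i * real (snd c i * X c) * E i c X)
            - (\<Sum>i\<in>UNIV. mu i * actuals i X * M) + (\<Sum>i\<in>UNIV. mu i * actuals i X * lyap_srv r i X) / r"
        unfolding sum_actual_rate[symmetric] sum_divide_distrib sum_subtractf[symmetric] sum.distrib[symmetric]
        by (intro sum.cong refl) (simp add: algebra_simps)
      have S3: "(\<Sum>i\<in>UNIV. \<Sum>c\<in>cconfigs Kbar. mu0 * real ((fst c i - snd c i) * X c) * (2 * M + lyap_tok i X / r))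
          = (\<Sum>i\<in>UNIV. mu0 * tokens i X * (2 * M)) + (\<Sum>i\<in>UNIV. mu0 * tokens i X * lyap_tok i X) / r"
        unfolding sum_token_rate by (simp add: algebra_simps sum.distrib sum_divide_distrib)
      have L: "(\<Sum>i\<in>UNIV. lam i * r * lyap_arr r i X) / r + (\<Sum>i\<in>UNIV. mu i * actuals i X * lyap_srv r i X) / r
        + (\<Sum>i\<in>UNIV. mu0 * tokens i X * lyap_tok i X) / r \<le> lyap_const"
      proof -
        have "(\<Sum>i\<in>UNIV. (mu i)\<^sup>2 / (2 * mu0) * (dev r i X)\<^sup>2 + mu0 / 2 * (tokens i X)\<^sup>2) \<ge> 0"
          using mu0_pos by (intro sum_nonneg) simp
        then show ?thesis
          using lyap_drift[OF r, of X] r by (simp add: add_divide_distrib[symmetric] divide_le_eq)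
      qed
      \<comment> \<open>The charges for the token term: \<open>M\<close> per arrival,
        \<open>- M\<close> per completion, which creates a token, and \<open>2 * M\<close> per token
        completion. The parts of order \<open>r\<close> cancel because
        \<open>lam i = mu i * \<rho> i\<close>.\<close>
      have T: "(\<Sum>i\<in>UNIV. lam i * r * M) - (\<Sum>i\<in>UNIV. mu i * actuals i X * M)
          + (\<Sum>i\<in>UNIV. mu0 * tokens i X * (2 * M)) \<le> M * Km * ?fl"
        unfolding sum_subtractf[symmetric] sum.distrib[symmetric] fluctuation_def sum_distrib_left
      proof (intro sum_mono)
        fix i
        have "lam i * r - mu i * actuals i X = - (mu i * dev r i X)"
          using mu_pos[of i] by (simp add: dev_def \<rho>_eq field_simps)
        also have "\<dots> \<le> mu i * \<bar>dev r i X\<bar>" using mu_pos[of i] by (simp add: abs_if)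
        also have "\<dots> \<le> Km * \<bar>dev r i X\<bar>" using mu_le by (intro mult_right_mono) auto
        finally have "lam i * r - mu i * actuals i X + 2 * mu0 * tokens i X \<le> Km * (\<bar>dev r i X\<bar> + tokens i X)"
          using mult_right_mono[OF Km(3) tokens_nonneg[of i X]] by (simp add: algebra_simps)
        from mult_left_mono[OF this, of M] M
        show "lam i * r * M - mu i * actuals i X * M + mu0 * tokens i X * (2 * M)
            \<le> M * Km * (\<bar>dev r i X\<bar> + tokens i X)" by (simp add: algebra_simps)
      qed
      have "(\<Sum>i\<in>UNIV. \<Sum>c\<in>cconfigs Kbar. mu i * real (snd c i * X c) * E i c X)
          \<le> (\<Sum>i\<in>UNIV. mu i) * (r + ?fl) * e X + 2 * mu i0 * M * ?fl - W X"
        unfolding E_def W_def M_def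
        by (rule service_bound_sum[OF X r e h(1) h(2)[unfolded M_def]])
      also have "\<dots> \<le> Km * (r + ?fl) * e X + 2 * Km * M * ?fl - W X"
        using Km(2) mu_le[of i0] fl r e M by (intro add_mono diff_mono mult_right_mono mult_left_mono) auto
      also have "Km * (r + ?fl) * e X \<le> Km * r * \<eta> + 7 * M * Km * ?fl + 8 * M * Km * ?fl\<^sup>2 / r"
      proof -
        have "?fl * \<eta> \<le> ?fl * (7 * M)" using \<eta> fl by (intro mult_left_mono) auto
        \<comment> \<open>On the exceptional event \<open>r + ?fl \<le> 2 * ?fl\<close> and
          \<open>1 \<le> ?fl / r\<close>, so a second moment controls this term without any tail
          estimate.\<close>
        moreover have "(r + ?fl) * (if r \<le> ?fl then 4 * M else 0) \<le> 8 * M * ?fl\<^sup>2 / r"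
        proof (cases "r \<le> ?fl")
          case True
          then have "(r + ?fl) * r \<le> (2 * ?fl) * ?fl" using r by (intro mult_mono) auto
          then have "(r + ?fl) * r * (4 * M) \<le> (2 * ?fl) * ?fl * (4 * M)" using M by (intro mult_right_mono) auto
          with True r show ?thesis by (simp add: pos_le_divide_eq power2_eq_square algebra_simps)
        qed (use M r in auto)
        ultimately have "(r + ?fl) * e X \<le> r * \<eta> + 7 * M * ?fl + 8 * M * ?fl\<^sup>2 / r"
          unfolding e_def by (simp add: algebra_simps)
        from mult_left_mono[OF this, of Km] Km(1) show ?thesis by (simp add: algebra_simps)
      qed
      finally have F: "(\<Sum>i\<in>UNIV. \<Sum>c\<in>cconfigs Kbar. mu i * real (snd c i * X c) * E i c X)
          \<le> Km * r * \<eta> + 7 * M * Km * ?fl + 8 * M * Km * ?fl\<^sup>2 / r + 2 * Km * M * ?fl - W X" by simp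
      have "Km * r * \<eta> + 7 * M * Km * ?fl + 8 * M * Km * ?fl\<^sup>2 / r + 2 * Km * M * ?fl + M * Km * ?fl + lyap_const = B X"
        by (simp add: B_def q_def algebra_simps)
      with S1 S2 S3 L T F
      show "(\<Sum>i\<in>UNIV. lam i * r * (M + lyap_arr r i X / r)) +
          (\<Sum>i\<in>UNIV. \<Sum>c\<in>cconfigs Kbar. mu i * real (snd c i * X c) * (E i c X - M + lyap_srv r i X / r)) +
          (\<Sum>i\<in>UNIV. \<Sum>c\<in>cconfigs Kbar. mu0 * real ((fst c i - snd c i) * X c) * (2 * M + lyap_tok i X / r))
          \<le> B X - W X" by linarith
    qed (use W0 B0 in auto)
    \<comment> \<open>The linear term is split by Young's inequality with weight
      \<surd>\<open>r\<close>, which balances the two halves since the second moment is of order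
      \<open>r\<close>.\<close>
    define s where "s = sqrt r"
    have s: "s \<ge> 1" "r = s\<^sup>2" using r by (auto simp: s_def)
    define c0 where "c0 = lyap_const + \<eta> * Km * r + q / 2 * s"
    define c1 where "c1 = q / (2 * s) + 8 * M * Km / r"
    have c01: "c0 \<ge> 0" "c1 \<ge> 0"
      unfolding c0_def c1_def using lc \<eta> Km r q s M by (auto intro!: add_nonneg_nonneg)
    have "B X \<le> c0 + c1 * (fluctuation r X)\<^sup>2" for X
    proof -
      let ?fl = "fluctuation r X"
      have "0 \<le> (?fl - s)\<^sup>2 / (2 * s)" using s by simp
      also have "\<dots> = s / 2 + ?fl\<^sup>2 / (2 * s) - ?fl" using s by (simp add: power2_eq_square field_simps)
      finally have "q * ?fl \<le> q * (s / 2 + ?fl\<^sup>2 / (2 * s))" using q by (intro mult_left_mono) auto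
      then show ?thesis by (simp add: B_def c0_def c1_def algebra_simps)
    qed
    then have "(\<integral>\<^sup>+X. ennreal (B X) \<partial>measure_pmf \<pi>)
        \<le> (\<integral>\<^sup>+X. (ennreal c0 + ennreal c1 * ennreal ((fluctuation r X)\<^sup>2)) \<partial>measure_pmf \<pi>)"
      using c01 by (intro nn_integral_mono) (simp add: ennreal_mult[symmetric] ennreal_plus[symmetric] ennreal_leI del: ennreal_plus)
    also have "\<dots> = ennreal c0 + ennreal c1 * (\<integral>\<^sup>+X. ennreal ((fluctuation r X)\<^sup>2) \<partial>measure_pmf \<pi>)"
      by (simp add: nn_integral_add nn_integral_cmult)
    also have "\<dots> \<le> ennreal c0 + ennreal c1 * ennreal (C2 * r)"
      by (intro add_mono mult_left_mono sm[OF R r st]) auto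
    also have "\<dots> = ennreal (c0 + c1 * (C2 * r))"
      using c01 C2 r by (simp add: ennreal_mult)
    finally have EB: "(\<integral>\<^sup>+X. ennreal (B X) \<partial>measure_pmf \<pi>) \<le> ennreal (c0 + c1 * (C2 * r))" .
    \<comment> \<open>Each summand is one of the constants in \<open>C'\<close> times 1,
      \<open>\<omega> * r\<close> or \<open>s\<close>, all of them at most
      \<open>\<omega> * r + s\<close>.\<close>
    have num: "c0 + c1 * (C2 * r) \<le> C' * (\<omega> + 1 / s) * r"
    proof -
      have "c0 + c1 * (C2 * r) = (lyap_const + 2 * M * Km + 8 * M * Km * C2) * 1
          + 5 * Km * (\<omega> * r) + q * (1 + C2) / 2 * s"
        using s by (simp add: c0_def c1_def \<eta>_def power2_eq_square field_simps)
      also have "\<dots> \<le> (lyap_const + 2 * M * Km + 8 * M * Km * C2) * (\<omega> * r + s)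
          + 5 * Km * (\<omega> * r + s) + q * (1 + C2) / 2 * (\<omega> * r + s)"
      proof (intro add_mono mult_left_mono)
        show "1 \<le> \<omega> * r + s" "s \<le> \<omega> * r + s" using \<omega>0 r s(1) by (auto intro: add_increasing)
      qed (use lc M Km q C2 \<omega>0 r s in auto)
      also have "\<dots> = C' * (\<omega> * r + s)" by (simp add: C'_def algebra_simps)
      also have "\<dots> = C' * (\<omega> + 1 / s) * r" using s by (simp add: power2_eq_square field_simps)
      finally show ?thesis .
    qed
    have "(\<integral>\<^sup>+X. ennreal (real (k0 i0) * scnt r X k0 * loss (scnt r X) i0 k0 m0) \<partial>measure_pmf \<pi>)
        = (\<integral>\<^sup>+X. ennreal (1 / (mu i0 * r)) * ennreal (W X) \<partial>measure_pmf \<pi>)"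
      using mu_pos[of i0] r W0
      by (intro nn_integral_cong) (simp add: ennreal_mult[symmetric] W_def h_def scaled_def less_imp_neq[symmetric] mult.assoc)
    also have "\<dots> = ennreal (1 / (mu i0 * r)) * (\<integral>\<^sup>+X. ennreal (W X) \<partial>measure_pmf \<pi>)"
      by (simp add: nn_integral_cmult)
    also have "\<dots> \<le> ennreal (1 / (mu i0 * r)) * ennreal (C' * (\<omega> + 1 / s) * r)"
      using main EB num by (intro mult_left_mono) (auto intro: order_trans ennreal_leI)
    also have "\<dots> = ennreal (C' / mu i0 * (\<omega> + 1 / sqrt r))"
      using mu_pos[of i0] r C' \<omega>0 s by (simp add: ennreal_mult[symmetric] s_def[symmetric] less_imp_neq[symmetric])
    finally show "(\<integral>\<^sup>+X. ennreal (real (k0 i0) * scnt r X k0 * loss (scnt r X) i0 k0 m0) \<partial>measure_pmf \<pi>)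
      \<le> ennreal (C' / mu i0 * (\<omega> + 1 / sqrt r))" .
  qed
qed

subsection \<open>Optimality conditions\<close>

lemma sub_unit_in_Kbar: "k \<in> configs Kbar \<Longrightarrow> k - unit_config i \<in> Kbar"
  using Kbar_down[of k "k - unit_config i"] by (auto simp: configs_def le_fun_def)

lemma size_sub_unit:
  assumes "(k :: 'i config) i > 0"
  shows "(\<Sum>j\<in>UNIV. (k - unit_config i) j) < (\<Sum>j\<in>UNIV. k j)"
  using assms by (intro sum_strict_mono_ex1) (auto simp: unit_config_def intro!: exI[of _ i])

lemma config_pos: "k \<noteq> (0 :: 'i config) \<Longrightarrow> \<exists>i. k i > 0"
  by (metis ext gr0I zero_fun_apply)

lemma X_set_le_1:
  assumes x: "x \<in> X_set Kbar \<rho>" and k: "k \<in> configs Kbar"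
  shows "x k \<le> 1"
proof -
  obtain i where i: "k i > 0" using k config_pos by (auto simp: configs_def)
  have xn: "x k \<ge> 0" if "k \<in> configs Kbar" for k using x that by (simp add: X_set_def)
  have "x k \<le> real (k i) * x k" using i xn[OF k] by (simp add: mult_le_cancel_right1)
  also have "\<dots> \<le> (\<Sum>k\<in>configs Kbar. real (k i) * x k)"
    using k finite_configs xn by (intro member_le_sum) auto
  also have "\<dots> \<le> 1" using x \<rho>_le_1 by (simp add: X_set_def)
  finally show ?thesis .
qed

section \<open>Karush-Kuhn-Tucker conditions from vanishing losses\<close>

context
  fixes x :: "'i config \<Rightarrow> real"
  assumes xX: "x \<in> X_set Kbar \<rho>"
    and no_loss: "\<And>i k m. k \<in> configs Kbar \<Longrightarrow> m \<in> Kbar \<Longrightarrow> m + unit_config i \<in> configs Kbar \<Longrightarrow>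
      real (k i) * x k * loss x i k m = 0"
begin

definition served :: "'i \<Rightarrow> 'i config set" where
  "served i = {k \<in> configs Kbar. k i > 0 \<and> x k > 0}"

text \<open>The multipliers \<open>\<eta>\<^sub>i\<close>; \<open>worth k\<close> is \<open>\<Sum>\<^sub>i k\<^sub>i \<eta>\<^sub>i\<close>.\<close>

definition price :: "'i \<Rightarrow> real" where
  "price i = Max ((\<lambda>k. psi (x k) - psi (x (k - unit_config i))) ` served i)"

definition worth :: "'i config \<Rightarrow> real" where
  "worth k = (\<Sum>i\<in>UNIV. real (k i) * price i)"

lemma x_nonneg: "x k \<ge> 0" and x_outside: "k \<notin> configs Kbar \<Longrightarrow> x k = 0" and x_zero: "x 0 = 0"
  using xX unfolding X_set_def by (cases "k \<in> configs Kbar"; force)+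

lemma load_eq: "(\<Sum>k\<in>configs Kbar. real (k i) * x k) = \<rho> i"
  using xX by (simp add: X_set_def)

text \<open>An empty \<open>served i\<close> would leave type i without load, against
  \<open>\<rho> i > 0\<close>; so the maximum defining \<open>price i\<close> is attained.\<close>

lemma served_finite: "finite (served i)" and served_nonempty: "served i \<noteq> {}"
proof -
  show "finite (served i)" using finite_configs by (simp add: served_def)
  show "served i \<noteq> {}"
  proof
    assume e: "served i = {}"
    have "(\<Sum>k\<in>configs Kbar. real (k i) * x k) = 0"
    proof (intro sum.neutral ballI)
      fix k assume "k \<in> configs Kbar"
      then have "k i = 0 \<or> x k = 0" using e x_nonneg[of k] by (fastforce simp: served_def)
      then show "real (k i) * x k = 0" by auto
    qed
    then show False using load_eq[of i] \<rho>_pos[of i] by simp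
  qed
qed

lemma price_ge: "k \<in> served i \<Longrightarrow> psi (x k) - psi (x (k - unit_config i)) \<le> price i"
  unfolding price_def using served_finite by (intro Max_ge) auto

text \<open>For \<open>k\<close> in \<open>served i\<close> and \<open>m\<close> available, all
  factors of the vanishing product other than the gain are positive, so no used \<open>k\<close> has
  a larger marginal cost than \<open>m\<close>. Together with \<open>price_ge\<close> this pins the
  price on configurations in use.\<close>

lemma price_le:
  assumes m: "m \<in> Kbar" "m + unit_config i \<in> configs Kbar" "m = 0 \<or> x m > 0"
  shows "psi (x m) + price i \<le> psi (x (m + unit_config i))"
proof -
  have "psi (x k) - psi (x (k - unit_config i)) \<le> psi (x (m + unit_config i)) - psi (x m)"
    if k: "k \<in> served i" for k
  proof -
    have "loss x i k m = 0" using no_loss[of k m i] k m by (simp add: served_def)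
    then have "marginal x i (k - unit_config i) \<le> marginal x i m"
      using m(3) x_nonneg[of m] by (auto simp: loss_def split: if_splits)
    then show ?thesis using k by (simp add: marginal_def served_def sub_unit_add)
  qed
  then have "price i \<le> psi (x (m + unit_config i)) - psi (x m)"
    unfolding price_def using served_finite served_nonempty by (subst Max_le_iff) auto
  then show ?thesis by simp
qed

lemma worth_sub_unit:
  assumes "k i > 0"
  shows "worth k = worth (k - unit_config i) + price i"
proof -
  have "worth k = (\<Sum>j\<in>UNIV. real ((k - unit_config i) j) * price j + (if j = i then price i else 0))"
    unfolding worth_def using assms
    by (intro sum.cong refl) (auto simp: unit_config_def of_nat_diff algebra_simps)
  then show ?thesis by (simp add: sum.distrib worth_def)
qed

lemma pos_psi: "psi (x k) > 0 \<Longrightarrow> x k > 0"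
  using x_nonneg[of k] by (cases "x k = 0") auto

text \<open>
  Remove an item of nonpositive price first, if there is one: then the rest still has positive worth,
  so it is used, and \<open>price_le\<close> applies to putting the item back.
\<close>

lemma worth_pos:
  assumes "k \<in> configs Kbar" "worth k > 0"
  shows "x k > 0 \<and> worth k \<le> psi (x k)"
  using assms
proof (induction "\<Sum>j\<in>UNIV. k j" arbitrary: k rule: less_induct)
  case less
  have ex: "\<exists>i. k i > 0" using less.prems(1) config_pos by (auto simp: configs_def)
  have "\<exists>i. k i > 0 \<and> (k - unit_config i = 0 \<or> worth (k - unit_config i) > 0)"
  proof (cases "\<exists>i. k i > 0 \<and> price i \<le> 0")
    case True
    then obtain i where i: "k i > 0" "price i \<le> 0" by blast
    then show ?thesis using less.prems(2) worth_sub_unit[of k i] by (intro exI[of _ i]) auto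
  next
    case False
    then have pr: "price i > 0" if "k i > 0" for i using False that by (meson not_le)
    obtain i where i: "k i > 0" using ex by blast
    have "worth (k - unit_config i) > 0" if ne: "k - unit_config i \<noteq> 0"
    proof -
      obtain j where j: "(k - unit_config i) j > 0" using config_pos[OF ne] by blast
      show ?thesis unfolding worth_def
      proof (rule sum_pos2[of _ j])
        show "0 < real ((k - unit_config i) j) * price j" using j pr[of j] by (simp split: if_splits)
        show "0 \<le> real ((k - unit_config i) l) * price l" for l
          using pr[of l] by (cases "k l = 0") (auto intro!: mult_nonneg_nonneg less_imp_le)
      qed auto
    qed
    then show ?thesis using i by blast
  qed
  then obtain i where i: "k i > 0" "k - unit_config i = 0 \<or> worth (k - unit_config i) > 0" by blast
  let ?m = "k - unit_config i"
  have m: "?m \<in> Kbar" "?m + unit_config i = k" using less.prems(1) i(1) by (auto simp: sub_unit_in_Kbar sub_unit_add)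
  have "(?m = 0 \<or> x ?m > 0) \<and> worth ?m \<le> psi (x ?m)"
  proof (cases "?m = 0")
    case True
    show ?thesis unfolding True by (simp add: worth_def x_zero)
  next
    case False
    then have "?m \<in> configs Kbar" using m(1) by (simp add: configs_def)
    then show ?thesis using less.hyps[OF size_sub_unit[of k i, OF i(1)]] i(2) False by blast
  qed
  then have "worth k \<le> psi (x k)"
    using price_le[of ?m i] m less.prems(1) worth_sub_unit[of k i, OF i(1)] by simp
  then show ?case using less.prems(2) pos_psi[of k] by linarith
qed

text \<open>If some item can be removed so that the rest is empty or in use, \<open>price_ge\<close>
  and the induction hypothesis add up. Otherwise each item in \<open>k\<close> has price at least
  \<open>psi (x k) > 0\<close>, so the rest after any removal has positive worth and is in use by
  \<open>worth_pos\<close>, a contradiction.\<close>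

lemma psi_le_worth:
  assumes "k \<in> configs Kbar" "x k > 0"
  shows "psi (x k) \<le> worth k"
  using assms
proof (induction "\<Sum>j\<in>UNIV. k j" arbitrary: k rule: less_induct)
  case less
  have "\<exists>i. k i > 0 \<and> (k - unit_config i = 0 \<or> x (k - unit_config i) > 0)"
  proof (rule ccontr)
    assume no: "\<not> ?thesis"
    have pr: "price i > 0" if "k i > 0" for i
    proof -
      have "\<not> x (k - unit_config i) > 0" using no that by blast
      then have "x (k - unit_config i) = 0" using x_nonneg[of "k - unit_config i"] by simp
      then have "psi (x k) \<le> price i"
        using price_ge[of k i] less.prems that by (simp add: served_def)
      moreover have "psi (x k) > 0" using less.prems(2) by (simp add: psi_def)
      ultimately show ?thesis by simp
    qed
    obtain i where i: "k i > 0" using less.prems(1) config_pos by (auto simp: configs_def)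
    then have ne: "k - unit_config i \<noteq> 0" using no by blast
    obtain j where j: "(k - unit_config i) j > 0" using config_pos[OF ne] by blast
    have "worth (k - unit_config i) > 0" unfolding worth_def
    proof (rule sum_pos2[of _ j])
      show "0 < real ((k - unit_config i) j) * price j" using j pr[of j] by (simp split: if_splits)
      show "0 \<le> real ((k - unit_config i) l) * price l" for l
        using pr[of l] by (cases "k l = 0") (auto intro!: mult_nonneg_nonneg less_imp_le)
    qed auto
    moreover have "k - unit_config i \<in> configs Kbar"
      using ne sub_unit_in_Kbar[OF less.prems(1)] by (simp add: configs_def)
    ultimately have "x (k - unit_config i) > 0" using worth_pos by blast
    then show False using no i by blast
  qed
  then obtain i where i: "k i > 0" "k - unit_config i = 0 \<or> x (k - unit_config i) > 0" by blast
  let ?m = "k - unit_config i"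
  have "psi (x ?m) \<le> worth ?m"
  proof (cases "?m = 0")
    case True
    show ?thesis unfolding True by (simp add: worth_def x_zero)
  next
    case False
    then have "?m \<in> configs Kbar" using sub_unit_in_Kbar[OF less.prems(1)] by (simp add: configs_def)
    then show ?thesis using less.hyps[OF size_sub_unit[of k i, OF i(1)]] i(2) False by blast
  qed
  then show ?case
    using price_ge[of k i] less.prems i(1) worth_sub_unit[of k i, OF i(1)] by (simp add: served_def)
qed

text \<open>Sufficiency of the optimality conditions for a convex objective: \<open>worth\<close> is
  linear in \<open>k\<close>, so equal loads make its sum against \<open>y - x\<close> vanish, and
  the strict tangent inequality does the rest.\<close>

lemma objective_less:
  assumes y: "y \<in> X_set Kbar \<rho>" and ne: "y \<noteq> x"
  shows "objective Kbar \<alpha> x < objective Kbar \<alpha> y"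
proof -
  have yn: "y k \<ge> 0" if "k \<in> configs Kbar" for k using y that by (auto simp: X_set_def)
  have yo: "y k = 0" if "k \<notin> configs Kbar" for k using y that by (auto simp: X_set_def)
  have yl: "(\<Sum>k\<in>configs Kbar. real (k i) * y k) = \<rho> i" for i using y by (simp add: X_set_def)
  obtain k0 where k0: "x k0 \<noteq> y k0" using ne by (metis ext)
  then have k0c: "k0 \<in> configs Kbar" using x_outside yo by metis
  have ps: "psi (x k) = x k powr \<alpha>" if "k \<in> configs Kbar" for k
    using x_nonneg[of k] X_set_le_1[OF xX that] by (intro psi_eq) auto
  have "(\<Sum>k\<in>configs Kbar. worth k * (y k - x k)) = 0"
  proof -
    have "(\<Sum>k\<in>configs Kbar. worth k * (y k - x k))
        = (\<Sum>k\<in>configs Kbar. \<Sum>i\<in>UNIV. price i * (real (k i) * y k - real (k i) * x k))"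
      unfolding worth_def sum_distrib_right by (intro sum.cong refl) (simp add: algebra_simps)
    also have "\<dots> = (\<Sum>i\<in>UNIV. price i * ((\<Sum>k\<in>configs Kbar. real (k i) * y k) - (\<Sum>k\<in>configs Kbar. real (k i) * x k)))"
      by (subst sum.swap) (simp add: sum_subtractf sum_distrib_left right_diff_distrib)
    also have "\<dots> = 0" by (simp only: yl load_eq) simp
    finally show ?thesis .
  qed
  moreover have "worth k * (y k - x k) \<le> psi (x k) * (y k - x k)" if k: "k \<in> configs Kbar" for k
  proof (cases "x k > 0")
    case True
    then have "psi (x k) > 0" by (simp add: psi_def)
    then have "psi (x k) = worth k" using psi_le_worth[OF k True] worth_pos[OF k] by linarith
    then show ?thesis by simp
  next
    case False
    then have "x k = 0" using x_nonneg[of k] by simp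
    moreover have "worth k \<le> 0" using False worth_pos[OF k] by force
    ultimately show ?thesis using yn[OF k] by (simp add: mult_nonpos_nonneg)
  qed
  then have "(\<Sum>k\<in>configs Kbar. worth k * (y k - x k)) \<le> (\<Sum>k\<in>configs Kbar. psi (x k) * (y k - x k))"
    by (intro sum_mono)
  moreover have "objective Kbar \<alpha> x + (\<Sum>k\<in>configs Kbar. psi (x k) * (y k - x k)) < objective Kbar \<alpha> y"
    unfolding objective_def sum.distrib[symmetric]
  proof (rule sum_strict_mono_ex1[OF finite_configs])
    show "\<forall>k\<in>configs Kbar. x k powr (1 + \<alpha>) / (1 + \<alpha>) + psi (x k) * (y k - x k) \<le> y k powr (1 + \<alpha>) / (1 + \<alpha>)"
      using powr_tangent(1) x_nonneg yn \<alpha>_pos by (simp add: ps)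
    show "\<exists>k\<in>configs Kbar. x k powr (1 + \<alpha>) / (1 + \<alpha>) + psi (x k) * (y k - x k) < y k powr (1 + \<alpha>) / (1 + \<alpha>)"
      using powr_tangent(2) x_nonneg yn \<alpha>_pos k0 k0c by (intro bexI[of _ k0]) (simp_all add: ps)
  qed
  ultimately show ?thesis by linarith
qed

end

section \<open>Existence and uniqueness of the minimizer\<close>

lemma X_set_nonempty: "X_set Kbar \<rho> \<noteq> {}"
proof -
  \<comment> \<open>Single-customer servers only: configuration \<open>unit_config i\<close> gets
    weight \<open>\<rho> i\<close>.\<close>
  define x :: "'i config \<Rightarrow> real" where "x k = (\<Sum>i\<in>UNIV. if k = unit_config i then \<rho> i else 0)" for k
  have "(\<Sum>k\<in>configs Kbar. real (k j) * x k) = \<rho> j" for j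
  proof -
    have "(\<Sum>k\<in>configs Kbar. real (k j) * x k)
        = (\<Sum>i\<in>UNIV. \<Sum>k\<in>configs Kbar. if k = unit_config i then real (k j) * \<rho> i else 0)"
      unfolding x_def sum_distrib_left by (subst sum.swap) (intro sum.cong refl, auto)
    also have "\<dots> = (\<Sum>i\<in>UNIV. if i = j then \<rho> i else 0)"
      using finite_configs unit_in_configs by (intro sum.cong refl) (simp add: unit_config_def)
    finally show ?thesis by simp
  qed
  moreover have "x k = 0" if "k \<notin> configs Kbar" for k
    using that unit_in_configs unfolding x_def by (intro sum.neutral) auto
  moreover have "x k \<ge> 0" for k unfolding x_def using \<rho>_pos by (intro sum_nonneg) (simp add: less_imp_le)
  ultimately have "x \<in> X_set Kbar \<rho>" by (simp add: X_set_def)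
  then show ?thesis by blast
qed

lemma compact_X_set: "compact (X_set Kbar \<rho>)"
proof -
  have "X_set Kbar \<rho> = {x. \<forall>c. x c \<in> (if c \<in> configs Kbar then {0..1} else {0})}
      \<inter> (\<Inter>i. {x. (\<Sum>k\<in>configs Kbar. real (k i) * x k) = \<rho> i})"
    using X_set_le_1 by (auto simp: X_set_def split: if_splits)
  moreover have "closed (\<Inter>i. {x. (\<Sum>k\<in>configs Kbar. real (k i) * x k) = \<rho> i})"
    by (intro closed_INT ballI closed_Collect_eq continuous_intros)
       (rule continuous_on_product_coordinates)
  ultimately show ?thesis by (simp only:) (intro compact_Int_closed compact_box)
qed

lemma minimizer_exists: "\<exists>x. is_arg_min (objective Kbar \<alpha>) (\<lambda>x. x \<in> X_set Kbar \<rho>) x"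
proof -
  have "continuous_on (X_set Kbar \<rho>) (\<lambda>x. x k powr (1 + \<alpha>) / (1 + \<alpha>))" if "k \<in> configs Kbar" for k
    using \<alpha>_pos that
    by (intro continuous_on_divide continuous_on_powr' continuous_on_const
         continuous_on_subset[OF continuous_on_product_coordinates]) (auto simp: X_set_def)
  then have "continuous_on (X_set Kbar \<rho>) (objective Kbar \<alpha>)"
    unfolding objective_def by (intro continuous_on_sum)
  from continuous_attains_inf[OF compact_X_set X_set_nonempty this]
  show ?thesis by (auto simp: is_arg_min_def not_less)
qed

lemma minimizer_unique:
  assumes "is_arg_min (objective Kbar \<alpha>) (\<lambda>x. x \<in> X_set Kbar \<rho>) x"
    and "is_arg_min (objective Kbar \<alpha>) (\<lambda>x. x \<in> X_set Kbar \<rho>) y"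
  shows "y = x"
proof (rule ccontr)
  assume "y \<noteq> x"
  then obtain k0 where k0: "x k0 \<noteq> y k0" by (metis ext)
  have X: "x \<in> X_set Kbar \<rho>" and Y: "y \<in> X_set Kbar \<rho>" using assms by (auto simp: is_arg_min_def)
  have k0c: "k0 \<in> configs Kbar" using k0 X Y unfolding X_set_def by (metis (mono_tags, lifting) mem_Collect_eq)
  have xn: "x k \<ge> 0" "y k \<ge> 0" if "k \<in> configs Kbar" for k using X Y that by (auto simp: X_set_def)
  define z where "z k = (x k + y k) / 2" for k
  have "z \<in> X_set Kbar \<rho>"
    using X Y by (simp add: X_set_def z_def algebra_simps add_divide_distrib sum.distrib flip: sum_divide_distrib)
  then have "objective Kbar \<alpha> x \<le> objective Kbar \<alpha> z" "objective Kbar \<alpha> y \<le> objective Kbar \<alpha> z"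
    using assms by (auto simp: is_arg_min_def not_less)
  moreover have "objective Kbar \<alpha> z + objective Kbar \<alpha> z < objective Kbar \<alpha> x + objective Kbar \<alpha> y"
    unfolding objective_def sum.distrib[symmetric]
  proof (rule sum_strict_mono_ex1[OF finite_configs])
    have d: "x k - z k = - (y k - z k)" for k by (simp add: z_def field_simps)
    have zn: "z k \<ge> 0" if "k \<in> configs Kbar" for k using xn[OF that] by (simp add: z_def)
    \<comment> \<open>At the midpoint the linear terms of the two tangent inequalities
      cancel.\<close>
    have s: "z k powr \<alpha> * (x k - z k) + z k powr \<alpha> * (y k - z k) = 0" for k
      unfolding d by (simp add: algebra_simps)
    show "\<forall>k\<in>configs Kbar. z k powr (1 + \<alpha>) / (1 + \<alpha>) + z k powr (1 + \<alpha>) / (1 + \<alpha>)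
        \<le> x k powr (1 + \<alpha>) / (1 + \<alpha>) + y k powr (1 + \<alpha>) / (1 + \<alpha>)"
    proof
      fix k assume k: "k \<in> configs Kbar"
      show "z k powr (1 + \<alpha>) / (1 + \<alpha>) + z k powr (1 + \<alpha>) / (1 + \<alpha>)
        \<le> x k powr (1 + \<alpha>) / (1 + \<alpha>) + y k powr (1 + \<alpha>) / (1 + \<alpha>)"
        using powr_tangent(1)[OF zn[OF k] xn(1)[OF k] \<alpha>_pos] powr_tangent(1)[OF zn[OF k] xn(2)[OF k] \<alpha>_pos] s[of k]
        by linarith
    qed
    have "z k0 \<noteq> x k0" using k0 by (simp add: z_def)
    then show "\<exists>k\<in>configs Kbar. z k powr (1 + \<alpha>) / (1 + \<alpha>) + z k powr (1 + \<alpha>) / (1 + \<alpha>)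
        < x k powr (1 + \<alpha>) / (1 + \<alpha>) + y k powr (1 + \<alpha>) / (1 + \<alpha>)"
      using powr_tangent(2)[OF zn[OF k0c] xn(1)[OF k0c] \<alpha>_pos] powr_tangent(1)[OF zn[OF k0c] xn(2)[OF k0c] \<alpha>_pos]
        s[of k0] k0c by (intro bexI[of _ k0]) linarith+
  qed
  ultimately show False by linarith
qed

subsection \<open>Convergence\<close>

text \<open>Young's inequality weighted so that a second moment of order \<open>r\<close> yields a
  mean of order \<open>1 / sqrt r\<close>.\<close>

lemma fluctuation_le_sq:
  assumes "r \<ge> 1"
  shows "fluctuation r X / r \<le> 1 / (2 * sqrt r) + 1 / (2 * sqrt r * r) * (fluctuation r X)\<^sup>2"
proof -
  define s where "s = sqrt r"
  have s: "s > 0" "r = s\<^sup>2" using assms by (auto simp: s_def)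
  have "0 \<le> (fluctuation r X - s)\<^sup>2 / (2 * s * r)" using s by simp
  also have "\<dots> = 1 / (2 * s) + 1 / (2 * s * r) * (fluctuation r X)\<^sup>2 - fluctuation r X / r"
    using s by (simp add: power2_eq_square field_simps)
  finally show ?thesis by (simp add: s_def)
qed

definition triples :: "('i \<times> 'i config \<times> 'i config) set" where
  "triples = {(i, k, m). k \<in> configs Kbar \<and> m \<in> Kbar \<and> m + unit_config i \<in> configs Kbar}"

lemma finite_triples: "finite triples"
  by (rule finite_subset[of _ "UNIV \<times> configs Kbar \<times> Kbar"])
     (use finite_configs finite_Kbar in \<open>auto simp: triples_def\<close>)

text \<open>Optimality and feasibility in one continuous function: among nonnegative vectors
  vanishing outside \<open>configs Kbar\<close>, only the minimizer can have gap 0, by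
  \<open>config_gap_zero\<close>.\<close>

definition config_gap :: "('i config \<Rightarrow> real) \<Rightarrow> real" where
  "config_gap x = (\<Sum>(i, k, m)\<in>triples. real (k i) * x k * loss x i k m)
     + (\<Sum>i\<in>UNIV. \<bar>(\<Sum>k\<in>configs Kbar. real (k i) * x k) - \<rho> i\<bar>)"

definition complete_gap :: "('i cconfig \<Rightarrow> real) \<Rightarrow> real" where
  "complete_gap x = (\<Sum>i\<in>UNIV. \<bar>(\<Sum>c\<in>cconfigs Kbar. real (fst c i) * x c) - \<rho> i\<bar>
     + \<bar>(\<Sum>c\<in>cconfigs Kbar. real (snd c i) * x c) - \<rho> i\<bar>)"

lemma continuous_loss: "continuous_on UNIV (\<lambda>x. loss x i k m)"
proof -
  have p: "continuous_on UNIV (\<lambda>x :: 'i config \<Rightarrow> real. psi (x j))" for j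
    by (rule continuous_on_compose2[OF continuous_psi[of UNIV] continuous_on_product_coordinates]) simp
  have "continuous_on UNIV (\<lambda>x :: 'i config \<Rightarrow> real. if m = 0 then 1 else min 1 (x m))"
    by (cases "m = 0") (auto intro!: continuous_intros)
  then show ?thesis
    unfolding loss_def marginal_def by (intro continuous_intros p)
qed

lemma continuous_config_gap: "continuous_on UNIV config_gap"
  unfolding config_gap_def case_prod_unfold
  by (intro continuous_intros continuous_loss continuous_on_product_coordinates)

lemma continuous_complete_gap: "continuous_on UNIV complete_gap"
  unfolding complete_gap_def by (intro continuous_intros continuous_on_product_coordinates)

lemma triple_nonneg:
  assumes "\<forall>k\<in>configs Kbar. 0 \<le> x k" "(i, k, m) \<in> triples"
  shows "0 \<le> real (k i) * x k * loss x i k m"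
proof -
  have "m = 0 \<or> x m \<ge> 0" "x k \<ge> 0" using assms by (auto simp: triples_def configs_def)
  then show ?thesis unfolding loss_def by (intro mult_nonneg_nonneg) auto
qed

lemma config_gap_ge:
  assumes "\<forall>k\<in>configs Kbar. 0 \<le> x k"
  shows "0 \<le> config_gap x"
    and "(i, k, m) \<in> triples \<Longrightarrow> real (k i) * x k * loss x i k m \<le> config_gap x"
    and "\<bar>(\<Sum>k\<in>configs Kbar. real (k i) * x k) - \<rho> i\<bar> \<le> config_gap x"
proof -
  let ?S = "\<Sum>(i, k, m)\<in>triples. real (k i) * x k * loss x i k m"
  let ?L = "\<lambda>i. \<bar>(\<Sum>k\<in>configs Kbar. real (k i) * x k) - \<rho> i\<bar>"
  have S: "0 \<le> ?S" using triple_nonneg[OF assms] by (intro sum_nonneg) auto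
  have L: "0 \<le> (\<Sum>i\<in>UNIV. ?L i)" by (intro sum_nonneg) auto
  show "0 \<le> config_gap x" using S L unfolding config_gap_def by linarith
  show "?L i \<le> config_gap x"
    using S member_le_sum[of i UNIV ?L] unfolding config_gap_def by simp
  show "real (k i) * x k * loss x i k m \<le> config_gap x" if "(i, k, m) \<in> triples"
  proof -
    have "(\<lambda>(i, k, m). real (k i) * x k * loss x i k m) (i, k, m) \<le> ?S"
      using triple_nonneg[OF assms] by (intro member_le_sum that finite_triples) auto
    then have "real (k i) * x k * loss x i k m \<le> ?S" by simp
    then show ?thesis using L unfolding config_gap_def by linarith
  qed
qed

lemma complete_gap_ge:
  shows "0 \<le> complete_gap x"
    and "\<bar>(\<Sum>c\<in>cconfigs Kbar. real (fst c i) * x c) - \<rho> i\<bar>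
      + \<bar>(\<Sum>c\<in>cconfigs Kbar. real (snd c i) * x c) - \<rho> i\<bar> \<le> complete_gap x"
proof -
  show "0 \<le> complete_gap x" unfolding complete_gap_def by (intro sum_nonneg) auto
  show "\<bar>(\<Sum>c\<in>cconfigs Kbar. real (fst c i) * x c) - \<rho> i\<bar>
      + \<bar>(\<Sum>c\<in>cconfigs Kbar. real (snd c i) * x c) - \<rho> i\<bar> \<le> complete_gap x"
    unfolding complete_gap_def by (intro member_le_sum) auto
qed

lemma config_gap_zero:
  assumes min: "is_arg_min (objective Kbar \<alpha>) (\<lambda>x. x \<in> X_set Kbar \<rho>) xstar"
    and x: "\<forall>k\<in>configs Kbar. 0 \<le> x k" "\<forall>k. k \<notin> configs Kbar \<longrightarrow> x k = 0" "config_gap x = 0"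
  shows "x = xstar"
proof (rule ccontr)
  assume "x \<noteq> xstar"
  have X: "x \<in> X_set Kbar \<rho>" using x config_gap_ge(3)[OF x(1)] by (simp add: X_set_def)
  have "real (k i) * x k * loss x i k m = 0"
    if "k \<in> configs Kbar" "m \<in> Kbar" "m + unit_config i \<in> configs Kbar" for i k m
    using config_gap_ge(2)[OF x(1), of i k m] triple_nonneg[OF x(1), of i k m] that x(3)
    by (simp add: triples_def)
  then have "objective Kbar \<alpha> x < objective Kbar \<alpha> xstar"
    using min \<open>x \<noteq> xstar\<close> by (intro objective_less[OF X]) (auto simp: is_arg_min_def)
  then show False using min X by (auto simp: is_arg_min_def)
qed

lemma scaled_actual_load: "(\<Sum>c\<in>cconfigs Kbar. real (snd c i) * scaled r X c) = actuals i X / r"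
  by (simp add: actuals_def total_def scaled_def sum_divide_distrib)

lemma scaled_load: "(\<Sum>c\<in>cconfigs Kbar. real (fst c i) * scaled r X c) = (actuals i X + tokens i X) / r"
  unfolding actuals_def tokens_def total_def sum.distrib[symmetric] sum_divide_distrib
proof (intro sum.cong refl)
  fix c assume "c \<in> cconfigs Kbar"
  then have "snd c i \<le> fst c i" using cconfigsD by (auto simp: le_fun_def)
  then show "real (fst c i) * scaled r X c
      = (real (snd c i) * real (X c) + real (fst c i - snd c i) * real (X c)) / r"
    by (simp add: scaled_def of_nat_diff algebra_simps)
qed

lemma scaled_config_load:
  assumes X: "X \<in> states Kbar"
  shows "(\<Sum>k\<in>configs Kbar. real (k i) * scnt r X k) = (actuals i X + tokens i X) / r"
proof -
  have "(\<Sum>k\<in>configs Kbar. real (k i) * scnt r X k)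
      = (\<Sum>k\<in>configs Kbar. \<Sum>c\<in>cconfigs Kbar. if k = fst c then real (fst c i) * scaled r X c else 0)"
    unfolding scaled_def cnt_eq_total[OF X] total_def sum_divide_distrib sum_distrib_left
    by (intro sum.cong refl) auto
  also have "\<dots> = (\<Sum>c\<in>cconfigs Kbar. real (fst c i) * scaled r X c)"
    using finite_configs cconfigsD(1) by (subst sum.swap) simp
  finally show ?thesis by (simp add: scaled_load)
qed

lemma load_deviation:
  assumes "r \<ge> 1"
  shows "\<bar>(actuals i X + tokens i X) / r - \<rho> i\<bar> \<le> (\<bar>dev r i X\<bar> + tokens i X) / r"
    and "\<bar>actuals i X / r - \<rho> i\<bar> \<le> (\<bar>dev r i X\<bar> + tokens i X) / r"
proof -
  have "(actuals i X + tokens i X) / r - \<rho> i = (dev r i X + tokens i X) / r"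
    "actuals i X / r - \<rho> i = dev r i X / r"
    using assms by (simp_all add: dev_def field_simps)
  then show "\<bar>(actuals i X + tokens i X) / r - \<rho> i\<bar> \<le> (\<bar>dev r i X\<bar> + tokens i X) / r"
    "\<bar>actuals i X / r - \<rho> i\<bar> \<le> (\<bar>dev r i X\<bar> + tokens i X) / r"
    using assms tokens_nonneg[of i X] by (auto simp: abs_div intro!: divide_right_mono)
qed

lemma complete_gap_scaled:
  assumes r: "r \<ge> 1"
  shows "complete_gap (scaled r X) \<le> 2 * (fluctuation r X / r)"
proof -
  have "complete_gap (scaled r X) \<le> (\<Sum>i\<in>UNIV. 2 * ((\<bar>dev r i X\<bar> + tokens i X) / r))"
    unfolding complete_gap_def scaled_actual_load scaled_load
    using load_deviation[OF r] by (intro sum_mono) (smt (verit))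
  then show ?thesis by (simp add: fluctuation_def sum_divide_distrib sum_distrib_left)
qed

lemma config_gap_scaled:
  assumes r: "r \<ge> 1" and X: "X \<in> states Kbar"
  shows "config_gap (scnt r X) \<le> (\<Sum>(i, k, m)\<in>triples. real (k i) * scnt r X k * loss (scnt r X) i k m)
    + fluctuation r X / r"
  unfolding config_gap_def scaled_config_load[OF X] fluctuation_def sum_divide_distrib
  using load_deviation(1)[OF r] by (intro add_left_mono sum_mono)

section \<open>Limits along the sequence of systems\<close>

context
  fixes r :: "nat \<Rightarrow> real" and R :: "nat \<Rightarrow> 'i rules" and \<pi> :: "nat \<Rightarrow> 'i state pmf"
  assumes r1: "r n \<ge> 1" and r_lim: "filterlim r at_top sequentially"
    and rules: "greedy_dm_rules Kbar \<alpha> (R n)"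
    and stat: "stationary_distribution (states Kbar) (rate_matrix Kbar lam mu mu0 (R n) (r n)) (\<pi> n)"
begin

lemma in_states: "X \<in> set_pmf (\<pi> n) \<Longrightarrow> X \<in> states Kbar"
  using stat[of n] by (auto simp: stationary_distribution_def)

lemma inverse_sqrt_limit: "(\<lambda>n. 1 / sqrt (r n)) \<longlonglongrightarrow> 0"
  by (intro tendsto_divide_0[OF tendsto_const] filterlim_at_top_imp_at_infinity
      filterlim_compose[OF sqrt_at_top r_lim])

lemma fluctuation_limit:
  "(\<lambda>n. \<integral>\<^sup>+X. ennreal (fluctuation (r n) X / r n) \<partial>measure_pmf (\<pi> n)) \<longlonglongrightarrow> 0"
proof -
  obtain C where C: "C \<ge> 0" and sm: "\<And>R r \<pi>. greedy_dm_rules Kbar \<alpha> R \<Longrightarrow> r \<ge> 1 \<Longrightarrow>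
    stationary_distribution (states Kbar) (rate_matrix Kbar lam mu mu0 R r) \<pi> \<Longrightarrow>
    (\<integral>\<^sup>+X. ennreal ((fluctuation r X)\<^sup>2) \<partial>measure_pmf \<pi>) \<le> ennreal (C * r)"
    using second_moment_bound by blast
  have le: "(\<integral>\<^sup>+X. ennreal (fluctuation (r n) X / r n) \<partial>measure_pmf (\<pi> n)) \<le> ennreal ((1 + C) / 2 * (1 / sqrt (r n)))" for n
  proof -
    define s where "s = sqrt (r n)"
    have s: "s > 0" "r n > 0" using r1[of n] by (auto simp: s_def)
    have "(\<integral>\<^sup>+X. ennreal (fluctuation (r n) X / r n) \<partial>measure_pmf (\<pi> n))
        \<le> (\<integral>\<^sup>+X. (ennreal (1 / (2 * s)) + ennreal (1 / (2 * s * r n)) * ennreal ((fluctuation (r n) X)\<^sup>2)) \<partial>measure_pmf (\<pi> n))"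
      using fluctuation_le_sq[OF r1[of n]] s
      by (intro nn_integral_mono)
         (simp add: s_def ennreal_mult[symmetric] ennreal_plus[symmetric] ennreal_leI del: ennreal_plus)
    also have "\<dots> = ennreal (1 / (2 * s)) + ennreal (1 / (2 * s * r n)) * (\<integral>\<^sup>+X. ennreal ((fluctuation (r n) X)\<^sup>2) \<partial>measure_pmf (\<pi> n))"
      by (simp add: nn_integral_add nn_integral_cmult)
    also have "\<dots> \<le> ennreal (1 / (2 * s)) + ennreal (1 / (2 * s * r n)) * ennreal (C * r n)"
      by (intro add_mono mult_left_mono sm[OF rules r1 stat]) auto
    also have "\<dots> = ennreal (1 / (2 * s) + 1 / (2 * s * r n) * (C * r n))"
      using s C by (simp add: ennreal_mult[symmetric] ennreal_plus[symmetric] del: ennreal_plus)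
    also have "1 / (2 * s) + 1 / (2 * s * r n) * (C * r n) = (1 + C) / 2 * (1 / sqrt (r n))"
      using s by (simp add: s_def[symmetric] field_simps)
    finally show ?thesis .
  qed
  have "(\<lambda>n. ennreal ((1 + C) / 2 * (1 / sqrt (r n)))) \<longlonglongrightarrow> ennreal ((1 + C) / 2 * 0)"
    by (intro tendsto_ennrealI tendsto_mult tendsto_const inverse_sqrt_limit)
  then have up: "(\<lambda>n. ennreal ((1 + C) / 2 * (1 / sqrt (r n)))) \<longlonglongrightarrow> 0" by simp
  show ?thesis by (rule tendsto_sandwich[OF _ _ tendsto_const up]) (simp_all only: le zero_le eventually_True)
qed

text \<open>\<open>\<omega>\<close> is fixed in terms of \<open>e\<close> alone;
  \<open>psi_modulus\<close> makes it an admissible bound once \<open>1 / r n\<close> is small, and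
  \<open>1 / sqrt (r n)\<close> is then made small as well.\<close>

lemma loss_limit:
  assumes T: "(i, k, m) \<in> triples"
  shows "(\<lambda>n. \<integral>\<^sup>+X. ennreal (real (k i) * scnt (r n) X k * loss (scnt (r n) X) i k m)
            \<partial>measure_pmf (\<pi> n)) \<longlonglongrightarrow> 0"
proof (rule ennreal_tendsto_0I)
  obtain C where C: "C \<ge> 0" and b: "\<And>R r \<pi> \<omega>. greedy_dm_rules Kbar \<alpha> R \<Longrightarrow> r \<ge> 1 \<Longrightarrow>
    stationary_distribution (states Kbar) (rate_matrix Kbar lam mu mu0 R r) \<pi> \<Longrightarrow>
    (\<forall>x. psi (x + 1 / r) - psi x \<le> \<omega>) \<Longrightarrow> \<omega> \<le> psi_max \<Longrightarrow>
    (\<integral>\<^sup>+X. ennreal (real (k i) * scnt r X k * loss (scnt r X) i k m) \<partial>measure_pmf \<pi>)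
      \<le> ennreal (C * (\<omega> + 1 / sqrt r))"
    using loss_moment_bound[of k m i] T unfolding triples_def by blast
  fix e :: real assume e: "e > 0"
  \<comment> \<open>Half of \<open>e\<close> is reserved for each summand of
    \<open>\<omega> + 1 / sqrt r\<close>; \<open>C + 1\<close> replaces \<open>C\<close>, which may
    be 0.\<close>
  define \<omega> where "\<omega> = min psi_max (e / (2 * (C + 1)))"
  have \<omega>: "\<omega> > 0" "\<omega> \<le> psi_max" "\<omega> \<le> e / (2 * (C + 1))"
    using e C psi_max_pos by (auto simp: \<omega>_def)
  obtain \<delta> where \<delta>: "\<delta> > 0" "\<And>x h. 0 \<le> h \<Longrightarrow> h < \<delta> \<Longrightarrow> psi (x + h) - psi x \<le> \<omega>"
    using psi_modulus[OF \<omega>(1)] by blast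
  have ev1: "\<forall>\<^sub>F n in sequentially. 1 / \<delta> < r n"
    using r_lim by (auto simp: filterlim_at_top_dense)
  have ev2: "\<forall>\<^sub>F n in sequentially. 1 / sqrt (r n) < e / (2 * (C + 1))"
    using inverse_sqrt_limit e C by (intro order_tendstoD(2)) auto
  from ev1 ev2
  show "\<forall>\<^sub>F n in sequentially. (\<integral>\<^sup>+X. ennreal (real (k i) * scnt (r n) X k * loss (scnt (r n) X) i k m)
            \<partial>measure_pmf (\<pi> n)) \<le> ennreal e"
  proof eventually_elim
    case (elim n)
    have rn: "r n \<ge> 1" by (rule r1)
    have "1 / r n < \<delta>" using elim(1) \<delta>(1) rn by (simp add: field_simps)
    then have "\<forall>x. psi (x + 1 / r n) - psi x \<le> \<omega>" using rn by (intro allI \<delta>(2)) auto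
    then have "(\<integral>\<^sup>+X. ennreal (real (k i) * scnt (r n) X k * loss (scnt (r n) X) i k m) \<partial>measure_pmf (\<pi> n))
        \<le> ennreal (C * (\<omega> + 1 / sqrt (r n)))"
      by (rule b[OF rules rn stat _ \<omega>(2)])
    also have "C * (\<omega> + 1 / sqrt (r n)) \<le> (C + 1) * (e / (2 * (C + 1)) + e / (2 * (C + 1)))"
      using C \<omega> elim(2) rn by (intro mult_mono add_mono) (auto intro: add_nonneg_nonneg)
    also have "\<dots> = e"
    proof -
      have "x * (e / (2 * x) + e / (2 * x)) = e" if "x > 0" for x using that by (simp add: field_simps)
      from this[of "C + 1"] show ?thesis using C by linarith
    qed
    finally show ?case by (simp add: ennreal_leI)
  qed
qed

lemma config_gap_limit:
  "(\<lambda>n. \<integral>\<^sup>+X. ennreal (config_gap (scnt (r n) X)) \<partial>measure_pmf (\<pi> n)) \<longlonglongrightarrow> 0"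
proof -
  let ?t = "\<lambda>n X (i, k, m). real (k i) * scnt (r n) X k * loss (scnt (r n) X) i k m"
  have up: "(\<lambda>n. (\<Sum>t\<in>triples. \<integral>\<^sup>+X. ennreal (?t n X t) \<partial>measure_pmf (\<pi> n))
      + (\<integral>\<^sup>+X. ennreal (fluctuation (r n) X / r n) \<partial>measure_pmf (\<pi> n))) \<longlonglongrightarrow> (\<Sum>t\<in>triples. 0) + 0"
    by (intro tendsto_add tendsto_sum fluctuation_limit) (auto intro: loss_limit)
  have le: "(\<integral>\<^sup>+X. ennreal (config_gap (scnt (r n) X)) \<partial>measure_pmf (\<pi> n))
      \<le> (\<Sum>t\<in>triples. \<integral>\<^sup>+X. ennreal (?t n X t) \<partial>measure_pmf (\<pi> n))
      + (\<integral>\<^sup>+X. ennreal (fluctuation (r n) X / r n) \<partial>measure_pmf (\<pi> n))" for n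
  proof -
    have nn: "0 \<le> ?t n X t" if "t \<in> triples" for X t
      using triple_nonneg[of "scnt (r n) X"] that r1[of n] by (cases t) (auto simp: scaled_def)
    have "(\<integral>\<^sup>+X. ennreal (config_gap (scnt (r n) X)) \<partial>measure_pmf (\<pi> n))
        \<le> (\<integral>\<^sup>+X. ((\<Sum>t\<in>triples. ennreal (?t n X t)) + ennreal (fluctuation (r n) X / r n)) \<partial>measure_pmf (\<pi> n))"
    proof (rule nn_integral_mono_AE, unfold AE_measure_pmf_iff, intro ballI)
      fix X assume "X \<in> set_pmf (\<pi> n)"
      then have X: "X \<in> states Kbar" by (rule in_states)
      have "ennreal (config_gap (scnt (r n) X)) \<le> ennreal ((\<Sum>t\<in>triples. ?t n X t) + fluctuation (r n) X / r n)"
        using config_gap_scaled[OF r1 X] by (intro ennreal_leI)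
      also have "\<dots> = (\<Sum>t\<in>triples. ennreal (?t n X t)) + ennreal (fluctuation (r n) X / r n)"
        using fluctuation_ge(4)[of "r n" X] r1[of n] nn
        by (subst ennreal_plus) (auto simp: sum_ennreal intro!: sum_nonneg)
      finally show "ennreal (config_gap (scnt (r n) X))
        \<le> (\<Sum>t\<in>triples. ennreal (?t n X t)) + ennreal (fluctuation (r n) X / r n)" .
    qed
    also have "\<dots> = (\<Sum>t\<in>triples. \<integral>\<^sup>+X. ennreal (?t n X t) \<partial>measure_pmf (\<pi> n))
      + (\<integral>\<^sup>+X. ennreal (fluctuation (r n) X / r n) \<partial>measure_pmf (\<pi> n))"
      by (simp add: nn_integral_add nn_integral_sum)
    finally show ?thesis .
  qed
  from up have "(\<lambda>n. (\<Sum>t\<in>triples. \<integral>\<^sup>+X. ennreal (?t n X t) \<partial>measure_pmf (\<pi> n))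
      + (\<integral>\<^sup>+X. ennreal (fluctuation (r n) X / r n) \<partial>measure_pmf (\<pi> n))) \<longlonglongrightarrow> 0" by simp
  from tendsto_sandwich[OF _ _ tendsto_const this] le show ?thesis by (simp add: always_eventually)
qed

lemma complete_gap_limit:
  "(\<lambda>n. \<integral>\<^sup>+X. ennreal (complete_gap (scaled (r n) X)) \<partial>measure_pmf (\<pi> n)) \<longlonglongrightarrow> 0"
proof -
  have "(\<lambda>n. 2 * (\<integral>\<^sup>+X. ennreal (fluctuation (r n) X / r n) \<partial>measure_pmf (\<pi> n))) \<longlonglongrightarrow> 2 * 0"
    by (intro ennreal_tendsto_cmult fluctuation_limit) simp
  then have up: "(\<lambda>n. 2 * (\<integral>\<^sup>+X. ennreal (fluctuation (r n) X / r n) \<partial>measure_pmf (\<pi> n))) \<longlonglongrightarrow> 0" by simp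
  have le: "(\<integral>\<^sup>+X. ennreal (complete_gap (scaled (r n) X)) \<partial>measure_pmf (\<pi> n))
      \<le> 2 * (\<integral>\<^sup>+X. ennreal (fluctuation (r n) X / r n) \<partial>measure_pmf (\<pi> n))" for n
  proof -
    have "ennreal (complete_gap (scaled (r n) X)) \<le> 2 * ennreal (fluctuation (r n) X / r n)" for X
    proof -
      have "ennreal (complete_gap (scaled (r n) X)) \<le> ennreal (2 * (fluctuation (r n) X / r n))"
        by (intro ennreal_leI complete_gap_scaled r1)
      also have "\<dots> = 2 * ennreal (fluctuation (r n) X / r n)"
        using fluctuation_ge(4)[of "r n" X] r1[of n] by (subst ennreal_mult) auto
      finally show ?thesis .
    qed
    then have "(\<integral>\<^sup>+X. ennreal (complete_gap (scaled (r n) X)) \<partial>measure_pmf (\<pi> n))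
      \<le> (\<integral>\<^sup>+X. 2 * ennreal (fluctuation (r n) X / r n) \<partial>measure_pmf (\<pi> n))"
      by (intro nn_integral_mono)
    then show ?thesis by (simp add: nn_integral_cmult)
  qed
  show ?thesis by (rule tendsto_sandwich[OF _ _ tendsto_const up]) (simp_all only: le zero_le eventually_True)
qed

text \<open>Leaving a neighbourhood of \<open>xstar\<close> forces the gap above some
  \<open>\<delta>\<close> by compactness, and Markov's inequality bounds the probability of
  that.\<close>

lemma config_convergence:
  assumes min: "is_arg_min (objective Kbar \<alpha>) (\<lambda>x. x \<in> X_set Kbar \<rho>) xstar"
  shows "weakly_converges (\<lambda>n. distr (measure_pmf (\<pi> n)) borel (\<lambda>X. scnt (r n) X)) (return borel xstar)"
proof (rule weakly_converges_return)
  fix U :: "('i config \<Rightarrow> real) set" assume U: "open U" "xstar \<in> U"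
  \<comment> \<open>A configuration contains some type i, and its weight is at most the load of that
    type, hence at most \<open>\<rho> i\<close> plus the gap.\<close>
  have bound: "x k \<le> 1 + config_gap x" if nn: "\<forall>k\<in>configs Kbar. 0 \<le> x k" and k: "k \<in> configs Kbar" for x k
  proof -
    obtain i where i: "k i > 0" using k config_pos by (auto simp: configs_def)
    have "x k \<le> real (k i) * x k" using mult_right_mono[of 1 "real (k i)" "x k"] i nn k by simp
    also have "\<dots> \<le> (\<Sum>k\<in>configs Kbar. real (k i) * x k)"
      using nn k finite_configs by (intro member_le_sum) auto
    also have "\<dots> \<le> 1 + config_gap x" using config_gap_ge(3)[OF nn, of i] \<rho>_le_1[of i] by linarith
    finally show ?thesis .
  qed
  have "\<exists>\<delta>>0. \<forall>x. (\<forall>c\<in>configs Kbar. 0 \<le> x c) \<longrightarrow> (\<forall>c. c \<notin> configs Kbar \<longrightarrow> x c = 0) \<longrightarrow>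
      config_gap x < \<delta> \<longrightarrow> x \<in> U"
  proof (rule small_imp_in_open[OF continuous_config_gap U(1), where b = 1])
    show "0 \<le> config_gap x" if "\<forall>k\<in>configs Kbar. 0 \<le> x k" for x
      using config_gap_ge(1)[OF that] .
    show "x \<in> U" if "\<forall>k\<in>configs Kbar. 0 \<le> x k" "\<forall>k. k \<notin> configs Kbar \<longrightarrow> x k = 0" "config_gap x = 0" for x
      using config_gap_zero[OF min that] U(2) by simp
  qed (use bound in auto)
  then obtain \<delta> where \<delta>: "\<delta> > 0" "\<And>x. (\<forall>k\<in>configs Kbar. 0 \<le> x k) \<Longrightarrow> (\<forall>k. k \<notin> configs Kbar \<longrightarrow> x k = 0)
      \<Longrightarrow> config_gap x < \<delta> \<Longrightarrow> x \<in> U"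
    by blast
  show "(\<lambda>n. measure (measure_pmf (\<pi> n)) {X. scnt (r n) X \<notin> U}) \<longlonglongrightarrow> 0"
  proof (rule markov_tendsto[OF config_gap_limit \<delta>(1)])
    fix n X assume "X \<in> {X. scnt (r n) X \<notin> U}"
    moreover have "\<forall>k\<in>configs Kbar. 0 \<le> scnt (r n) X k" using r1[of n] by (simp add: scaled_def)
    moreover have "\<forall>k. k \<notin> configs Kbar \<longrightarrow> scnt (r n) X k = 0"
      by (simp add: scaled_def config_count_def)
    ultimately show "\<delta> \<le> config_gap (scnt (r n) X)"
      using \<delta>(2)[of "scnt (r n) X"] by (intro leI notI) auto
  qed
qed

lemma complete_convergence:
  "weakly_converges (\<lambda>n. distr (measure_pmf (\<pi> n)) borel
     (\<lambda>X. euclidean_setdist (cconfigs Kbar) (scaled (r n) X) (Xbar_set Kbar \<rho>))) (return borel 0)"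
proof (rule weakly_converges_return)
  fix V :: "real set" assume "open V" "0 \<in> V"
  then obtain \<epsilon> where \<epsilon>: "\<epsilon> > 0" "\<And>y. \<bar>y\<bar> < \<epsilon> \<Longrightarrow> y \<in> V"
    by (auto simp: open_dist dist_real_def)
  \<comment> \<open>As a union of open balls, \<open>U\<close> is open without any continuity of the
    distance to a set; membership also supplies the point that bounds the infimum.\<close>
  define U where "U = (\<Union>u\<in>Xbar_set Kbar \<rho>. {x. L2_set (\<lambda>c. x c - u c) (cconfigs Kbar) < \<epsilon>})"
  have U: "open U"
    unfolding U_def L2_set_def
    by (intro open_UN ballI open_Collect_less continuous_intros continuous_on_product_coordinates)
  have dist: "euclidean_setdist (cconfigs Kbar) x (Xbar_set Kbar \<rho>) \<in> V" if x: "x \<in> U" for x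
  proof -
    obtain u where u: "u \<in> Xbar_set Kbar \<rho>" "L2_set (\<lambda>c. x c - u c) (cconfigs Kbar) < \<epsilon>"
      using x by (auto simp: U_def)
    have "euclidean_setdist (cconfigs Kbar) x (Xbar_set Kbar \<rho>) \<le> L2_set (\<lambda>c. x c - u c) (cconfigs Kbar)"
      unfolding euclidean_setdist_def
      by (rule cINF_lower[OF _ u(1)]) (auto intro!: bdd_belowI[of _ 0] simp: L2_set_nonneg)
    moreover have "0 \<le> euclidean_setdist (cconfigs Kbar) x (Xbar_set Kbar \<rho>)"
      unfolding euclidean_setdist_def using u(1) by (intro cINF_greatest) (auto simp: L2_set_nonneg)
    ultimately show ?thesis using u(2) by (intro \<epsilon>(2)) auto
  qed
  have "\<exists>\<delta>>0. \<forall>x. (\<forall>c\<in>cconfigs Kbar. 0 \<le> x c) \<longrightarrow> (\<forall>c. c \<notin> cconfigs Kbar \<longrightarrow> x c = 0) \<longrightarrow>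
      complete_gap x < \<delta> \<longrightarrow> x \<in> U"
  proof (rule small_imp_in_open[OF continuous_complete_gap U, where b = 1])
    show "0 \<le> complete_gap x" for x by (rule complete_gap_ge(1))
    show "x \<in> U" if x: "\<forall>c\<in>cconfigs Kbar. 0 \<le> x c" "\<forall>c. c \<notin> cconfigs Kbar \<longrightarrow> x c = 0" "complete_gap x = 0" for x
    proof -
      have "(\<Sum>c\<in>cconfigs Kbar. real (fst c i) * x c) = \<rho> i"
        "(\<Sum>c\<in>cconfigs Kbar. real (snd c i) * x c) = \<rho> i" for i
        using complete_gap_ge(2)[of i x] x(3) by linarith+
      then have "x \<in> Xbar_set Kbar \<rho>" using x by (simp add: Xbar_set_def)
      then show ?thesis using \<epsilon>(1) by (auto simp: U_def L2_set_def intro!: bexI[of _ x])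
    qed
    show "x c \<le> 1 + complete_gap x" if x: "\<forall>c\<in>cconfigs Kbar. 0 \<le> x c" and c: "c \<in> cconfigs Kbar" for x c
    proof -
      obtain i where i: "fst c i > 0" using cconfigsD(3)[OF c] config_pos by auto
      have "x c \<le> real (fst c i) * x c" using mult_right_mono[of 1 "real (fst c i)" "x c"] i c x by simp
      also have "\<dots> \<le> (\<Sum>c\<in>cconfigs Kbar. real (fst c i) * x c)"
        using c x finite_cconfigs by (intro member_le_sum[of c _ "\<lambda>c. real (fst c i) * x c"]) auto
      also have "\<dots> \<le> 1 + complete_gap x"
        using complete_gap_ge(2)[of i x] \<rho>_le_1[of i] by linarith
      finally show ?thesis .
    qed
  qed
  then obtain \<delta> where \<delta>: "\<delta> > 0" "\<And>x. (\<forall>c\<in>cconfigs Kbar. 0 \<le> x c) \<Longrightarrow> (\<forall>c. c \<notin> cconfigs Kbar \<longrightarrow> x c = 0)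
      \<Longrightarrow> complete_gap x < \<delta> \<Longrightarrow> x \<in> U"
    by blast
  show "(\<lambda>n. measure (measure_pmf (\<pi> n))
      {X. euclidean_setdist (cconfigs Kbar) (scaled (r n) X) (Xbar_set Kbar \<rho>) \<notin> V}) \<longlonglongrightarrow> 0"
  proof (rule markov_tendsto[OF complete_gap_limit \<delta>(1)])
    fix n X
    assume "X \<in> set_pmf (\<pi> n)"
      and "X \<in> {X. euclidean_setdist (cconfigs Kbar) (scaled (r n) X) (Xbar_set Kbar \<rho>) \<notin> V}"
    then have "scaled (r n) X \<notin> U" and X: "X \<in> states Kbar" using dist in_states by auto
    moreover have "\<forall>c\<in>cconfigs Kbar. 0 \<le> scaled (r n) X c" using r1[of n] by (simp add: scaled_def)
    moreover have "\<forall>c. c \<notin> cconfigs Kbar \<longrightarrow> scaled (r n) X c = 0"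
      using in_cconfigs_if_pos[OF X] by (auto simp: scaled_def)
    ultimately show "\<delta> \<le> complete_gap (scaled (r n) X)"
      using \<delta>(2)[of "scaled (r n) X"] by (intro leI notI) auto
  qed
qed

end

end

theorem theorem12:
  fixes Kbar :: "'i::finite config set"
    and lam mu \<rho> :: "'i \<Rightarrow> real" and mu0 \<alpha> :: real
    and r :: "nat \<Rightarrow> real"
    and R :: "nat \<Rightarrow> 'i rules"
    and \<pi> :: "nat \<Rightarrow> 'i state pmf"
  assumes "packing_constraints Kbar"
    and "\<And>i. lam i > 0" and "\<And>i. mu i > 0" and "mu0 > 0" and "\<alpha> > 0"
    and "\<And>i. \<rho> i = lam i / mu i" and "(\<Sum>i\<in>UNIV. \<rho> i) = 1"
    and "\<And>n. r n \<ge> 1" and "strict_mono r" and "filterlim r at_top sequentially"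
    and "\<And>n. greedy_dm_rules Kbar \<alpha> (R n)"
    and "\<And>n. stationary_distribution (states Kbar) (rate_matrix Kbar lam mu mu0 (R n) (r n)) (\<pi> n)"
  shows "weak_conv_m
           (\<lambda>n. distr (measure_pmf (\<pi> n)) borel
                  (\<lambda>X. euclidean_setdist (cconfigs Kbar) (scaled (r n) X) (Xbar_set Kbar \<rho>)))
           (return borel 0)
       \<and> (\<exists>xstar.
            is_arg_min (objective Kbar \<alpha>) (\<lambda>x. x \<in> X_set Kbar \<rho>) xstar \<and>
            (\<forall>y. is_arg_min (objective Kbar \<alpha>) (\<lambda>x. x \<in> X_set Kbar \<rho>) y \<longrightarrow> y = xstar) \<and>
            weakly_converges
              (\<lambda>n. distr (measure_pmf (\<pi> n)) borel (\<lambda>X. scaled (r n) (config_count Kbar X)))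
              (return borel xstar))"
proof -
  interpret greedy_dm Kbar lam mu \<rho> mu0 \<alpha>
    by unfold_locales (use assms in auto)
  obtain xstar where min: "is_arg_min (objective Kbar \<alpha>) (\<lambda>x. x \<in> X_set Kbar \<rho>) xstar"
    using minimizer_exists by blast
  note seq = assms(8,10,11,12)
  show ?thesis
    using weak_conv_m_return[OF complete_convergence[OF seq]] config_convergence[OF seq min]
      min minimizer_unique[OF min] by blast
qed

end
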